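(* Let $n\ge 1$, let $1<q<p<\infty$, and let $r\in(1,\infty)$ be defined by $\frac1q=\frac1r+\frac1p$. Let $\sigma$ and $\omega$ be nonnegative Radon measures on $\mathbb{R}^n$ and let $K:\mathcal{D}\to[0,\infty)$ be a map, where $\mathcal{D}$ is the family of all dyadic cubes of $\mathbb{R}^n$. Then there is a finite constant $C_1$ such that the two weight trace inequality $$ \|T_{K}[f\,d\sigma]\|_{L^q(d\omega)}\le C_1\|f\|_{L^p(d\sigma)} $$ holds for all $f\in L^p(d\sigma)$ if and only if there is a finite constant $C_2$ such that both $$ \big\|\mathcal{W}^{q}_{K,\omega}[\sigma]^{1/q}\big\|_{L^r(d\sigma)}\le C_2 \qquad\text{and}\qquad \big\|\mathcal{W}^{p'}_{K,\sigma}[\omega]^{1/p'}\big\|_{L^r(d\omega)}\le C_2 . $$ Moreover, the least possible $C_1$ and the least possible $C_2$ are equivalent, i.e. each is bounded by a constant multiple of the other, with the multiplicative constants depending only on $n$, $p$ and $q$ (and not on $K$, $\sigma$, $\omega$).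
   Context: $\mathcal{D}$ denotes the family of all dyadic cubes $Q=2^{-i}(k+[0,1)^n)$, $i\in\mathbb{Z}$, $k\in\mathbb{Z}^n$. For $1<p<\infty$, $p'=\frac{p}{p-1}$ is the dual exponent. $1_Q$ is the indicator function of $Q$. Sums over $Q'\subset Q$ run over all $Q'\in\mathcal{D}$ with $Q'\subset Q$ (including $Q'=Q$). For $f\in L^1_{\mathrm{loc}}(d\sigma)$ the positive dyadic operator is $$ T_K[f\,d\sigma](x):=\sum_{Q\in\mathcal{D}}K(Q)\left(\int_Q f\,d\sigma\right)1_Q(x),\qquad x\in\mathbb{R}^n . $$ For nonnegative $f$ the sum is defined pointwise in $[0,\infty]$; for general $f\in L^p(d\sigma)$, the trace inequality is understood to include that the series converges absolutely $\omega$-almost everywhere. For a nonnegative Radon measure $\mu$ on $\mathbb{R}^n$ and $Q\in\mathcal{D}$ define $$ \overline{K}_{\mu}(Q)(x):=\frac1{\mu(Q)}\sum_{Q'\subset Q}K(Q')\mu(Q')1_{Q'}(x),\qquad x\in Q, $$ and $\overline{K}_{\mu}(Q)(x):=0$ when $\mu(Q)=0$. For $s>1$ and nonnegative Radon measures $\mu,\nu$ on $\mathbb{R}^n$, the discrete Wolff potential of $\nu$ is $$ \mathcal{W}^{s}_{K,\mu}[\nu](x):=\sum_{Q\in\mathcal{D}}K(Q)\mu(Q)\left(\int_Q\overline{K}_{\mu}(Q)(y)\,d\nu(y)\right)^{s-1}1_Q(x),\qquad x\in\mathbb{R}^n, $$ with values in $[0,\infty]$ and the convention $0\cdot\infty=0$.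 In the claim this is used with $(s,\mu,\nu)=(q,\omega,\sigma)$ and $(s,\mu,\nu)=(p',\sigma,\omega)$. *)

theory Defs
  imports "HOL-Analysis.Analysis"
begin

definition dyadic_cube :: "int \<Rightarrow> int ^ 'n \<Rightarrow> (real ^ 'n) set" where
  "dyadic_cube i k =
     (\<lambda>y. (2 powi (- i)) *\<^sub>R ((\<chi> j. of_int (k $ j)) + y)) ` {y. \<forall>j. 0 \<le> y $ j \<and> y $ j < 1}"

definition dyadic_cubes :: "(real ^ 'n) set set" where
  "dyadic_cubes = {dyadic_cube i k | i k. True}"

definition radon_measure :: "'a::topological_space measure \<Rightarrow> bool" where
  "radon_measure \<mu> \<longleftrightarrow>
     sets \<mu> = sets borel \<and>
     (\<forall>C. compact C \<longrightarrow> emeasure \<mu> C < \<infinity>) \<and>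
     (\<forall>B \<in> sets borel. emeasure \<mu> B = (SUP C \<in> {C. compact C \<and> C \<subseteq> B}. emeasure \<mu> C))"

definition dual_exponent :: "real \<Rightarrow> real" where
  "dual_exponent p = p / (p - 1)"

text \<open>Powers in \<open>[0,\<infinity>]\<close>, used only for exponents \<open>a > 0\<close>, so that \<open>0\<close> and \<open>\<infinity>\<close> are fixed.\<close>

definition ennreal_powr :: "ennreal \<Rightarrow> real \<Rightarrow> ennreal" where
  "ennreal_powr x a = (if x = \<infinity> then \<infinity> else ennreal (enn2real x powr a))"

definition eLp_norm :: "real \<Rightarrow> 'a measure \<Rightarrow> ('a \<Rightarrow> ennreal) \<Rightarrow> ennreal" where
  "eLp_norm s M g = ennreal_powr (\<integral>\<^sup>+ x. ennreal_powr (g x) s \<partial>M) (1 / s)"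

definition Lp_norm :: "real \<Rightarrow> 'a measure \<Rightarrow> ('a \<Rightarrow> real) \<Rightarrow> ennreal" where
  "Lp_norm s M f = eLp_norm s M (\<lambda>x. ennreal \<bar>f x\<bar>)"

definition Lp_space :: "real \<Rightarrow> 'a measure \<Rightarrow> ('a \<Rightarrow> real) set" where
  "Lp_space s M = {f \<in> borel_measurable M. Lp_norm s M f < \<infinity>}"

definition T_term ::
  "((real ^ 'n) set \<Rightarrow> real) \<Rightarrow> (real ^ 'n) measure \<Rightarrow> (real ^ 'n \<Rightarrow> real) \<Rightarrow>
   real ^ 'n \<Rightarrow> (real ^ 'n) set \<Rightarrow> real" where
  "T_term K \<sigma> f x Q = K Q * (LINT y:Q|\<sigma>. f y) * indicator Q x"

definition T_op ::
  "((real ^ 'n) set \<Rightarrow> real) \<Rightarrow> (real ^ 'n) measure \<Rightarrow> (real ^ 'n \<Rightarrow> real) \<Rightarrow> real ^ 'n \<Rightarrow> real" where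
  "T_op K \<sigma> f x = (\<Sum>\<^sub>\<infinity>Q\<in>dyadic_cubes. T_term K \<sigma> f x Q)"

text \<open>The convergence clause makes \<^const>\<open>T_op\<close> meaningful \<open>\<omega>\<close>-almost everywhere. For \<open>f \<ge> 0\<close> it
  follows from the norm bound for the pointwise sum in \<open>[0,\<infinity>]\<close>.\<close>

definition trace_inequality ::
  "real \<Rightarrow> real \<Rightarrow> ((real ^ 'n) set \<Rightarrow> real) \<Rightarrow> (real ^ 'n) measure \<Rightarrow> (real ^ 'n) measure \<Rightarrow>
   real \<Rightarrow> bool" where
  "trace_inequality p q K \<sigma> \<omega> C \<longleftrightarrow>
     (\<forall>f \<in> Lp_space p \<sigma>.
        (AE x in \<omega>. (\<lambda>Q. \<bar>T_term K \<sigma> f x Q\<bar>) summable_on dyadic_cubes) \<and>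
        Lp_norm q \<omega> (T_op K \<sigma> f) \<le> ennreal C * Lp_norm p \<sigma> f)"

definition K_bar ::
  "((real ^ 'n) set \<Rightarrow> real) \<Rightarrow> (real ^ 'n) measure \<Rightarrow> (real ^ 'n) set \<Rightarrow> real ^ 'n \<Rightarrow> ennreal" where
  "K_bar K \<mu> Q x =
     (if emeasure \<mu> Q = 0 then 0
      else (\<Sum>\<^sub>\<infinity>Q'\<in>{Q' \<in> dyadic_cubes. Q' \<subseteq> Q}.
              ennreal (K Q') * emeasure \<mu> Q' * indicator Q' x) / emeasure \<mu> Q)"

definition wolff_potential ::
  "real \<Rightarrow> ((real ^ 'n) set \<Rightarrow> real) \<Rightarrow> (real ^ 'n) measure \<Rightarrow> (real ^ 'n) measure \<Rightarrow>
   real ^ 'n \<Rightarrow> ennreal" where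
  "wolff_potential s K \<mu> \<nu> x =
     (\<Sum>\<^sub>\<infinity>Q\<in>dyadic_cubes.
        ennreal (K Q) * emeasure \<mu> Q *
        ennreal_powr (\<integral>\<^sup>+ y\<in>Q. K_bar K \<mu> Q y \<partial>\<nu>) (s - 1) * indicator Q x)"

definition wolff_condition ::
  "real \<Rightarrow> real \<Rightarrow> real \<Rightarrow> ((real ^ 'n) set \<Rightarrow> real) \<Rightarrow> (real ^ 'n) measure \<Rightarrow>
   (real ^ 'n) measure \<Rightarrow> real \<Rightarrow> bool" where
  "wolff_condition p q r K \<sigma> \<omega> C \<longleftrightarrow>
     eLp_norm r \<sigma> (\<lambda>x. ennreal_powr (wolff_potential q K \<omega> \<sigma> x) (1 / q)) \<le> ennreal C \<and>
     eLp_norm r \<omega> (\<lambda>x. ennreal_powr (wolff_potential (dual_exponent p) K \<sigma> \<omega> x)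
                              (1 / dual_exponent p)) \<le> ennreal C"

text \<open>The least admissible constant, with value \<open>\<infinity>\<close> if no finite constant is admissible.\<close>

definition least_constant :: "(real \<Rightarrow> bool) \<Rightarrow> ennreal" where
  "least_constant P = (INF C \<in> {C. 0 \<le> C \<and> P C}. ennreal C)"

end

theory Submission
  imports Defs
begin

text \<open>
  For a finite family of cubes, write \<open>\<langle>f\<rangle>\<^sub>Q\<close>, \<open>\<langle>g\<rangle>\<^sub>Q\<close> for the averages with respect to \<open>\<sigma>\<close>, \<open>\<omega>\<close>, and
  \<open>F\<^sub>Q\<close>, \<open>G\<^sub>Q\<close> for their running maxima over the cubes containing \<open>Q\<close>. With
  \<open>a\<^sub>Q = K(Q) \<sigma>(Q) \<omega>(Q)\<close> and \<open>S(R) = \<Sum>Q\<subseteq>R. a\<^sub>Q\<close>, the form \<open>\<Sum> a\<^sub>Q \<langle>f\<rangle>\<^sub>Q \<langle>g\<rangle>\<^sub>Q\<close> is at most \<open>\<Sum> a\<^sub>Q F\<^sub>Q G\<^sub>Q\<close>.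
  Summation by parts along the chains of the family bounds it by
  \<open>\<Sum> F\<^sub>R \<Delta>G\<^sub>R S(R) + \<Sum> G\<^sub>R \<Delta>F\<^sub>R S(R)\<close>, a continuous substitute for parallel stopping cubes.
  In the first sum, \<open>\<omega>(R) \<Delta>G\<^sub>R / G\<^sub>R\<close> is a Carleson sequence for \<open>\<omega>\<close>; a Bellman function argument,
  summed by parts against \<open>F\<^sup>q\<close>, then bounds that sum by Doob's maximal inequality for \<open>g\<close> and
  \<open>\<Sum> a\<^sub>Q F\<^sub>Q\<^sup>q (S(Q) / \<omega>(Q))\<^bsup>q-1\<^esup> \<le> \<integral> (M f)\<^sup>q \<W> d\<sigma>\<close>, where \<open>\<W>\<close> is the Wolff potential. The second sum is
  symmetric.

  Conversely, with \<open>s = r / q\<close>, one tests the operator on \<open>f = (M (\<W>\<^bsup>s-1\<^esup>))\<^bsup>1/q\<^esup>\<close>. As the running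
  maxima grow when cubes shrink, \<open>F\<^sub>Q S(Q) / \<omega>(Q)\<close> is at most the \<open>\<omega>\<close>-average of \<open>T f\<close> over \<open>Q\<close>, and
  \<open>\<integral> \<W>\<^sup>s d\<sigma>\<close> is controlled by \<open>\<integral> T f (M (T f))\<^bsup>q-1\<^esup> d\<omega>\<close>.

  Young's inequality and scaling of \<open>K\<close>, \<open>f\<close>, \<open>g\<close> replace Hoelder's inequality throughout.
\<close>

section \<open>Inequalities for real powers\<close>

lemma dual_exponent_gt_1: "1 < p \<Longrightarrow> 1 < dual_exponent p"
  by (simp add: dual_exponent_def field_simps)

lemma dual_exponent_dual_exponent: "1 < p \<Longrightarrow> dual_exponent (dual_exponent p) = p"
  by (simp add: dual_exponent_def field_simps)

lemma inverse_dual_exponent: "1 < p \<Longrightarrow> 1 / dual_exponent p = 1 - 1 / p"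
  by (simp add: dual_exponent_def field_simps)

lemma young_le:
  fixes a b :: real
  assumes "1 < p" "1 < q" "1 / p + 1 / q = 1" "0 \<le> a" "0 \<le> b"
  shows "a * b \<le> a powr p + b powr q"
proof -
  have "a * b \<le> a powr p / p + b powr q / q"
    using assms by (intro Youngs_inequality) auto
  also have "\<dots> \<le> a powr p / 1 + b powr q / 1"
    using assms by (intro add_mono divide_left_mono) auto
  finally show ?thesis by simp
qed

text \<open>Young's inequality for x and y^(s-1) with s and its dual exponent, cleared of
  denominators. \<open>powr_tangent\<close> and \<open>powr_diff_le\<close> are rearrangements of
  it.\<close>

lemma mult_powr_pred_young:
  fixes x y :: real
  assumes "1 < s" "0 \<le> x" "0 \<le> y"
  shows "s * (x * y powr (s - 1)) \<le> x powr s + (s - 1) * y powr s"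
proof -
  have "x * y powr (s - 1) \<le> x powr s / s + (y powr (s - 1)) powr (dual_exponent s) / dual_exponent s"
    using assms dual_exponent_gt_1[of s] inverse_dual_exponent[of s]
    by (intro Youngs_inequality) auto
  moreover have "(y powr (s - 1)) powr (dual_exponent s) = y powr s"
    using assms by (simp add: powr_powr dual_exponent_def)
  ultimately have "s * (x * y powr (s - 1)) \<le> s * (x powr s / s + y powr s / dual_exponent s)"
    using assms by (intro mult_left_mono) auto
  also have "\<dots> = x powr s + (s - 1) * y powr s"
    using assms by (simp add: dual_exponent_def field_simps)
  finally show ?thesis .
qed

lemma powr_pred_mult: "0 \<le> x \<Longrightarrow> x * x powr (s - 1) = x powr s" for x s :: real
  by (cases "x = 0") (auto simp: powr_diff)

lemma powr_tangent:
  fixes x y :: real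
  assumes "1 < s" "0 \<le> x" "0 \<le> y"
  shows "x powr s + s * x powr (s - 1) * (y - x) \<le> y powr s"
  using mult_powr_pred_young[of s y x] powr_pred_mult[of x s] assms
  by (simp add: algebra_simps)

text \<open>Discrete form of d(x^s) = s/(s-1) x d(x^(s-1)). It trades increments of the s-th power
  for increments of the (s-1)-th, which Doob's inequality pairs with the integral of f.\<close>

lemma powr_diff_le:
  fixes x y :: real
  assumes "1 < s" "0 \<le> y" "y \<le> x"
  shows "x powr s - y powr s \<le> s / (s - 1) * (x * (x powr (s - 1) - y powr (s - 1)))"
proof -
  have "(s - 1) * (x powr s - y powr s) \<le> s * (x * (x powr (s - 1) - y powr (s - 1)))"
    using mult_powr_pred_young[of s x y] powr_pred_mult[of x s] assms
    by (simp add: algebra_simps)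
  then show ?thesis using assms by (simp add: field_simps)
qed

lemma powr_diff_ge:
  fixes x y :: real
  assumes "1 < s" "0 \<le> y" "y \<le> x"
  shows "(x - y) * x powr (s - 1) \<le> x powr s - y powr s"
proof -
  have "y * y powr (s - 1) \<le> y * x powr (s - 1)"
    using assms by (intro mult_left_mono powr_mono2) auto
  then show ?thesis
    using powr_pred_mult[of x s] powr_pred_mult[of y s] assms by (simp add: algebra_simps)
qed

text \<open>Either c x is at most m/2, and m^s/2 suffices, or m is less than 2 c x, and x^s controls
  everything. The factor 1/2 lets the first term be absorbed on the left in
  \<open>doob_maximal\<close>.\<close>

lemma mult_powr_pred_absorb:
  fixes x m c :: real
  assumes "1 < s" "0 \<le> x" "0 \<le> m" "0 < c"
  shows "c * (x * m powr (s - 1)) \<le> m powr s / 2 + c * (2 * c) powr (s - 1) * x powr s"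
proof (cases "c * x \<le> m / 2")
  case True
  then have "c * x * m powr (s - 1) \<le> m / 2 * m powr (s - 1)"
    by (intro mult_right_mono) auto
  moreover have "0 \<le> c * (2 * c) powr (s - 1) * x powr s"
    using assms by simp
  moreover have "m / 2 * m powr (s - 1) = m powr s / 2"
    using powr_pred_mult[of m s] assms by simp
  ultimately show ?thesis by (simp only: mult.assoc)
next
  case False
  then have "m powr (s - 1) \<le> (2 * c * x) powr (s - 1)"
    using assms by (intro powr_mono2) auto
  then have "c * x * m powr (s - 1) \<le> c * x * (2 * c * x) powr (s - 1)"
    using assms by (intro mult_left_mono) auto
  also have "\<dots> = c * (2 * c) powr (s - 1) * x powr s"
    using assms powr_pred_mult[of x s, symmetric] by (simp add: powr_mult)
  finally have "c * (x * m powr (s - 1)) \<le> c * (2 * c) powr (s - 1) * x powr s"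
    by (simp add: mult.assoc)
  moreover have "0 \<le> m powr s" by simp
  ultimately show ?thesis by linarith
qed

text \<open>\<open>U\<^sup>s V\<^bsup>1-s\<^esup>\<close> is convex and homogeneous of degree one in \<open>(U, V)\<close>, hence subadditive.\<close>

lemma perspective_powr_subadditive:
  fixes U V :: "'b \<Rightarrow> real"
  assumes "finite A" "1 < s" "\<And>c. c \<in> A \<Longrightarrow> 0 \<le> U c" "\<And>c. c \<in> A \<Longrightarrow> 0 < V c"
  shows "sum U A powr s * sum V A powr (1 - s) \<le> (\<Sum>c\<in>A. U c powr s * V c powr (1 - s))"
proof (cases "A = {}")
  case False
  \<comment> \<open>Jensen's inequality with weights V: u^s is bounded below by its tangent at the
    mean ratio t, where the linear terms sum to zero.\<close>
  define t where "t = sum U A / sum V A"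
  have V: "0 < sum V A" using assms False by (intro sum_pos) auto
  have U: "0 \<le> sum U A" using assms by (intro sum_nonneg) auto
  have persp: "u powr s * v powr (1 - s) = v * (u / v) powr s" if "0 \<le> u" "0 < v" for u v :: real
    using that by (simp add: powr_divide powr_diff)
  have t: "0 \<le> t" using U V by (simp add: t_def)
  have "sum U A powr s * sum V A powr (1 - s) = sum V A * t powr s"
    using persp[OF U V] by (simp add: t_def)
  also have "\<dots> = (\<Sum>c\<in>A. V c * (t powr s + s * t powr (s - 1) * (U c / V c - t)))"
  proof -
    have "(\<Sum>c\<in>A. V c * (t powr s + s * t powr (s - 1) * (U c / V c - t)))
        = (\<Sum>c\<in>A. V c * t powr s + s * t powr (s - 1) * (U c - V c * t))"
      using assms(4) by (intro sum.cong refl) (force simp: field_simps)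
    also have "\<dots> = sum V A * t powr s + s * t powr (s - 1) * (sum U A - sum V A * t)"
      by (simp add: sum.distrib sum_subtractf sum_distrib_right flip: sum_distrib_left)
    also have "sum U A - sum V A * t = 0" using V by (simp add: t_def)
    finally show ?thesis by simp
  qed
  also have "\<dots> \<le> (\<Sum>c\<in>A. V c * (U c / V c) powr s)"
    using assms t by (intro sum_mono mult_left_mono powr_tangent) (auto simp: less_imp_le)
  also have "\<dots> = (\<Sum>c\<in>A. U c powr s * V c powr (1 - s))"
    using assms by (intro sum.cong refl persp[symmetric]) auto
  finally show ?thesis .
qed simp

text \<open>V^(1-s) is convex and decreasing, so its drop from V to V + m is at least m times the
  absolute slope at V + m.\<close>

lemma powr_one_minus_decrease:
  fixes V m s :: real
  assumes "1 < s" "0 < V" "0 \<le> m"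
  shows "(s - 1) * m * (V + m) powr (- s) \<le> V powr (1 - s) - (V + m) powr (1 - s)"
proof -
  define t where "t = V / (V + m)"
  have t: "0 < t" using assms by (simp add: t_def)
  \<comment> \<open>Bernoulli's inequality for the negative exponent 1 - s, from ln t \<le> t - 1
    and 1 + y \<le> exp y.\<close>
  have "1 + (1 - s) * (t - 1) \<le> 1 + (1 - s) * ln t"
    using ln_le_minus_one[OF t] assms by (simp add: mult_left_mono_neg)
  also have "\<dots> \<le> exp ((1 - s) * ln t)" by (rule exp_ge_add_one_self)
  also have "\<dots> = t powr (1 - s)" using t by (simp add: powr_def)
  finally have "(1 + (1 - s) * (t - 1)) * (V + m) powr (1 - s) \<le> t powr (1 - s) * (V + m) powr (1 - s)"
    by (intro mult_right_mono) auto
  also have "\<dots> = V powr (1 - s)"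
    using assms by (simp add: t_def powr_divide)
  finally have *: "(1 + (1 - s) * (t - 1)) * (V + m) powr (1 - s) \<le> V powr (1 - s)" .
  have "(1 - s) * (t - 1) * (V + m) powr (1 - s) = (s - 1) * m * (V + m) powr (- s)"
  proof -
    have "(V + m) powr (1 - s) = (V + m) * (V + m) powr (- s)"
      using assms by (simp add: powr_diff powr_minus field_simps)
    moreover have "(t - 1) * (V + m) = - m" using assms by (simp add: t_def field_simps)
    ultimately show ?thesis
      by (metis (no_types, opaque_lifting) minus_diff_eq mult.assoc minus_mult_commute)
  qed
  then show ?thesis using * by (simp add: algebra_simps)
qed

section \<open>Finite laminar families\<close>

definition above :: "'a set set \<Rightarrow> 'a set \<Rightarrow> 'a set set" where
  "above T Q = {R \<in> T. Q \<subseteq> R}"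

definition strictly_above :: "'a set set \<Rightarrow> 'a set \<Rightarrow> 'a set set" where
  "strictly_above T Q = {R \<in> T. Q \<subset> R}"

definition below :: "'a set set \<Rightarrow> 'a set \<Rightarrow> 'a set set" where
  "below T Q = {R \<in> T. R \<subseteq> Q}"

definition containing :: "'a set set \<Rightarrow> 'a \<Rightarrow> 'a set set" where
  "containing T x = {R \<in> T. x \<in> R}"

text \<open>\<Theta> acts on sets of members rather than on points. One \<Theta> thus serves at a
  cube, through \<open>above T Q\<close>, and at a point, through \<open>containing T x\<close>,
  with the same increments.\<close>

definition incr :: "'a set set \<Rightarrow> ('a set set \<Rightarrow> real) \<Rightarrow> 'a set \<Rightarrow> real" where
  "incr T \<Theta> R = \<Theta> (above T R) - \<Theta> (strictly_above T R)"

text \<open>The extra 0 gives the empty set the value 0, as summation by parts requires; it changes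
  nothing for nonnegative values on nonempty sets.\<close>

definition max_val :: "('b \<Rightarrow> real) \<Rightarrow> 'b set \<Rightarrow> real" where
  "max_val v A = Max (insert 0 (v ` A))"

lemma max_val_empty [simp]: "max_val v {} = 0"
  by (simp add: max_val_def)

lemma max_val_mono: "finite B \<Longrightarrow> A \<subseteq> B \<Longrightarrow> max_val v A \<le> max_val v B"
  unfolding max_val_def by (intro Max_mono) auto

lemma max_val_nonneg: "finite A \<Longrightarrow> 0 \<le> max_val v A"
  unfolding max_val_def by (intro Max_ge) auto

lemma max_val_insert: "finite A \<Longrightarrow> max_val v (insert R A) = max (v R) (max_val v A)"
  unfolding max_val_def by (simp add: insert_commute[of 0 "v R"])

text \<open>Induction removing the smallest member P: its term is \<open>\<Theta> C\<close> minus
  \<Theta> of the remaining members, and no other term involves P.\<close>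

lemma chain_telescope:
  fixes \<Theta> :: "'a set set \<Rightarrow> real"
  assumes "finite C" "\<And>R R'. R \<in> C \<Longrightarrow> R' \<in> C \<Longrightarrow> R \<subseteq> R' \<or> R' \<subseteq> R"
  shows "(\<Sum>R\<in>C. \<Theta> {R' \<in> C. R \<subseteq> R'} - \<Theta> {R' \<in> C. R \<subset> R'}) = \<Theta> C - \<Theta> {}"
  using assms
proof (induction C rule: finite_psubset_induct)
  case (psubset C)
  show ?case
  proof (cases "C = {}")
    case False
    then obtain P where P: "P \<in> C" "\<And>R. R \<in> C \<Longrightarrow> R \<subseteq> P \<Longrightarrow> R = P"
      using finite_has_minimal[OF psubset.hyps] by blast
    have PR: "P \<subseteq> R" if "R \<in> C" for R
      using psubset.prems[OF P(1) that] P(2)[OF that] by blast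
    define C' where "C' = C - {P}"
    have "(\<Sum>R\<in>C. \<Theta> {R' \<in> C. R \<subseteq> R'} - \<Theta> {R' \<in> C. R \<subset> R'})
        = (\<Theta> {R' \<in> C. P \<subseteq> R'} - \<Theta> {R' \<in> C. P \<subset> R'})
          + (\<Sum>R\<in>C'. \<Theta> {R' \<in> C. R \<subseteq> R'} - \<Theta> {R' \<in> C. R \<subset> R'})"
      using psubset.hyps P(1) unfolding C'_def by (rule sum.remove)
    also have "{R' \<in> C. P \<subseteq> R'} = C" using PR by blast
    also have "{R' \<in> C. P \<subset> R'} = C'" using PR by (auto simp: C'_def)
    also have "(\<Sum>R\<in>C'. \<Theta> {R' \<in> C. R \<subseteq> R'} - \<Theta> {R' \<in> C. R \<subset> R'})
        = (\<Sum>R\<in>C'. \<Theta> {R' \<in> C'. R \<subseteq> R'} - \<Theta> {R' \<in> C'. R \<subset> R'})"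
    proof (intro sum.cong refl)
      fix R assume "R \<in> C'"
      then have "\<not> R \<subseteq> P" using P(2) by (auto simp: C'_def)
      then have "{R' \<in> C. R \<subseteq> R'} = {R' \<in> C'. R \<subseteq> R'}" "{R' \<in> C. R \<subset> R'} = {R' \<in> C'. R \<subset> R'}"
        by (auto simp: C'_def)
      then show "\<Theta> {R' \<in> C. R \<subseteq> R'} - \<Theta> {R' \<in> C. R \<subset> R'}
               = \<Theta> {R' \<in> C'. R \<subseteq> R'} - \<Theta> {R' \<in> C'. R \<subset> R'}" by simp
    qed
    also have "\<dots> = \<Theta> C' - \<Theta> {}"
      using P(1) psubset.prems by (intro psubset.IH) (auto simp: C'_def)
    finally show ?thesis by simp
  qed simp
qed

locale laminar_family =
  fixes T :: "'a set set"
  assumes finite_T: "finite T"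
    and nonempty_T: "{} \<notin> T"
    and laminar: "Q \<in> T \<Longrightarrow> R \<in> T \<Longrightarrow> Q \<subseteq> R \<or> R \<subseteq> Q \<or> Q \<inter> R = {}"
begin

lemma finite_above [simp]: "finite (above T Q)"
  and finite_strictly_above [simp]: "finite (strictly_above T Q)"
  and finite_below [simp]: "finite (below T Q)"
  and finite_containing [simp]: "finite (containing T x)"
  using finite_T by (auto simp: above_def strictly_above_def below_def containing_def)

lemma strictly_above_subset: "strictly_above T Q \<subseteq> above T Q"
  by (auto simp: strictly_above_def above_def)

lemma above_eq_insert: "R \<in> T \<Longrightarrow> above T R = insert R (strictly_above T R)"
  by (auto simp: strictly_above_def above_def)

lemma above_subset_containing: "x \<in> Q \<Longrightarrow> above T Q \<subseteq> containing T x"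
  by (auto simp: above_def containing_def)

text \<open>In an upward closed chain the ancestors in T of a member all belong to C, so the
  increments telescope.\<close>

lemma sum_incr_up_chain:
  assumes "C \<subseteq> T" "\<And>R R'. R \<in> C \<Longrightarrow> R' \<in> C \<Longrightarrow> R \<subseteq> R' \<or> R' \<subseteq> R"
    and up: "\<And>R R'. R \<in> C \<Longrightarrow> R' \<in> T \<Longrightarrow> R \<subseteq> R' \<Longrightarrow> R' \<in> C"
  shows "sum (incr T \<Theta>) C = \<Theta> C - \<Theta> {}"
proof -
  have "sum (incr T \<Theta>) C = (\<Sum>R\<in>C. \<Theta> {R' \<in> C. R \<subseteq> R'} - \<Theta> {R' \<in> C. R \<subset> R'})"
  proof (intro sum.cong refl)
    fix R assume "R \<in> C"
    then have "above T R = {R' \<in> C. R \<subseteq> R'}" "strictly_above T R = {R' \<in> C. R \<subset> R'}"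
      using up assms(1) by (auto simp: above_def strictly_above_def)
    then show "incr T \<Theta> R = \<Theta> {R' \<in> C. R \<subseteq> R'} - \<Theta> {R' \<in> C. R \<subset> R'}"
      by (simp add: incr_def)
  qed
  also have "\<dots> = \<Theta> C - \<Theta> {}"
    using assms finite_T by (intro chain_telescope) (auto intro: finite_subset)
  finally show ?thesis .
qed

lemma sum_incr_above: "Q \<in> T \<Longrightarrow> sum (incr T \<Theta>) (above T Q) = \<Theta> (above T Q) - \<Theta> {}"
proof (rule sum_incr_up_chain)
  fix R R' assume "Q \<in> T" "R \<in> above T Q" "R' \<in> above T Q"
  then have "R \<in> T" "R' \<in> T" "Q \<subseteq> R \<inter> R'" "Q \<noteq> {}"
    using nonempty_T by (auto simp: above_def)
  then show "R \<subseteq> R' \<or> R' \<subseteq> R"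
    using laminar[of R R'] by auto
qed (auto simp: above_def)

lemma sum_incr_containing: "sum (incr T \<Theta>) (containing T x) = \<Theta> (containing T x) - \<Theta> {}"
proof (rule sum_incr_up_chain)
  fix R R' assume "R \<in> containing T x" "R' \<in> containing T x"
  then show "R \<subseteq> R' \<or> R' \<subseteq> R"
    using laminar[of R R'] by (auto simp: containing_def)
qed (auto simp: containing_def)

text \<open>Abel summation along the forest: the value at Q is the sum of the increments over its
  ancestors, and exchanging the two sums collects c over descendants.\<close>

lemma sum_by_parts:
  assumes "\<Theta> {} = 0"
  shows "(\<Sum>Q\<in>T. c Q * \<Theta> (above T Q)) = (\<Sum>R\<in>T. incr T \<Theta> R * sum c (below T R))"
proof -
  have "(\<Sum>Q\<in>T. c Q * \<Theta> (above T Q)) = (\<Sum>Q\<in>T. \<Sum>R\<in>above T Q. incr T \<Theta> R * c Q)"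
    using sum_incr_above[of _ \<Theta>] assms
    by (intro sum.cong refl) (simp flip: sum_distrib_right)
  also have "\<dots> = (\<Sum>Q\<in>T. \<Sum>R | R \<in> T \<and> Q \<subseteq> R. incr T \<Theta> R * c Q)"
    by (simp add: above_def)
  also have "\<dots> = (\<Sum>R\<in>T. \<Sum>Q | Q \<in> T \<and> Q \<subseteq> R. incr T \<Theta> R * c Q)"
    using finite_T by (intro sum.swap_restrict)
  finally show ?thesis by (simp add: sum_distrib_left below_def)
qed

lemma incr_nonneg:
  assumes "\<And>A B. A \<subseteq> B \<Longrightarrow> finite B \<Longrightarrow> \<Theta> A \<le> \<Theta> B"
  shows "0 \<le> incr T \<Theta> R"
  using assms[OF strictly_above_subset[of R]] by (simp add: incr_def)

lemma sum_indicator_eq: "(\<Sum>Q\<in>T. w Q * indicator Q x) = sum w (containing T x)" for w :: "'a set \<Rightarrow> real"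
proof -
  have "sum w (containing T x) = (\<Sum>Q\<in>T. if x \<in> Q then w Q else 0)"
    unfolding containing_def using finite_T by (rule sum.inter_filter)
  then show ?thesis by (simp add: indicator_def of_bool_def if_distrib cong: if_cong)
qed

lemma fun_containing_eq:
  assumes "\<Theta> {} = 0"
  shows "\<Theta> (containing T x) = (\<Sum>R\<in>T. incr T \<Theta> R * indicator R x)"
  using sum_incr_containing[of \<Theta> x] assms by (simp add: sum_indicator_eq)

end

text \<open>Functions of the form \<open>x \<mapsto> \<Theta> (containing T x)\<close> with \<open>\<Theta> {} = 0\<close> are exactly the linear
  combinations of the indicators of the members of \<open>T\<close>, by telescoping along chains.\<close>

locale laminar_measure = laminar_family T for T :: "'a set set" +
  fixes M :: "'a measure"
  assumes sets_T: "Q \<in> T \<Longrightarrow> Q \<in> sets M"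
    and finite_measure_T: "Q \<in> T \<Longrightarrow> emeasure M Q < \<infinity>"
    and pos_measure_T: "Q \<in> T \<Longrightarrow> 0 < measure M Q"
begin

definition avg :: "('a \<Rightarrow> real) \<Rightarrow> 'a set \<Rightarrow> real" where
  "avg f Q = (LINT x:Q|M. f x) / measure M Q"

lemma integrable_indicator_T: "Q \<in> T \<Longrightarrow> integrable M (indicator Q :: 'a \<Rightarrow> real)"
  using sets_T finite_measure_T by (intro integrable_real_indicator) auto

lemma integrable_fun_containing:
  assumes "\<Theta> {} = (0 :: real)"
  shows "integrable M (\<lambda>x. \<Theta> (containing T x))"
  unfolding fun_containing_eq[of \<Theta>, OF assms] using integrable_indicator_T by auto

lemma integral_fun_containing:
  assumes "\<Theta> {} = (0 :: real)"
  shows "(\<integral>x. \<Theta> (containing T x) \<partial>M) = (\<Sum>R\<in>T. incr T \<Theta> R * measure M R)"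
  unfolding fun_containing_eq[of \<Theta>, OF assms]
  using integrable_indicator_T sets_T
  by (subst Bochner_Integration.integral_sum) (auto simp: sets.Int_space_eq2)

lemma integral_mult_fun_containing:
  assumes "\<Theta> {} = (0 :: real)" and f: "\<And>Q. Q \<in> T \<Longrightarrow> set_integrable M Q f"
  shows "integrable M (\<lambda>x. f x * \<Theta> (containing T x))"
    and "(\<integral>x. f x * \<Theta> (containing T x) \<partial>M) = (\<Sum>R\<in>T. incr T \<Theta> R * (LINT x:R|M. f x))"
proof -
  have eq: "(\<lambda>x. f x * \<Theta> (containing T x))
      = (\<lambda>x. \<Sum>R\<in>T. incr T \<Theta> R * (indicator R x *\<^sub>R f x))"
    unfolding fun_containing_eq[of \<Theta>, OF assms(1)]
    by (auto simp: sum_distrib_left mult_ac)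
  show "integrable M (\<lambda>x. f x * \<Theta> (containing T x))"
    unfolding eq using f by (auto simp: set_integrable_def)
  show "(\<integral>x. f x * \<Theta> (containing T x) \<partial>M) = (\<Sum>R\<in>T. incr T \<Theta> R * (LINT x:R|M. f x))"
    unfolding eq using f
    by (subst Bochner_Integration.integral_sum)
       (auto simp: set_integrable_def set_lebesgue_integral_def)
qed

lemma set_integrable_of_powr:
  fixes f :: "'a \<Rightarrow> real"
  assumes "1 < s" "f \<in> borel_measurable M" "\<And>x. 0 \<le> f x" "integrable M (\<lambda>x. f x powr s)" "Q \<in> T"
  shows "set_integrable M Q f"
  unfolding set_integrable_def
proof (rule Bochner_Integration.integrable_bound)
  show "integrable M (\<lambda>x. indicator Q x + f x powr s)"
    using assms(4) integrable_indicator_T[OF assms(5)] by (intro Bochner_Integration.integrable_add) auto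
  show "(\<lambda>x. indicator Q x *\<^sub>R f x) \<in> borel_measurable M"
    using assms sets_T[of Q] by measurable
  have "f x \<le> 1 + f x powr s" for x
  proof (cases "f x \<le> 1")
    case False
    then have "f x powr 1 \<le> f x powr s" using assms by (intro powr_mono) auto
    then show ?thesis using False by simp
  qed (simp add: add_increasing2)
  then show "AE x in M. norm (indicator Q x *\<^sub>R f x) \<le> norm (indicator Q x + f x powr s)"
    using assms by (auto simp: indicator_def)
qed

lemma LINT_const: "Q \<in> T \<Longrightarrow> (LINT x:Q|M. c) = measure M Q * c" for c :: real
  unfolding set_lebesgue_integral_def using sets_T[of Q] by (simp add: sets.Int_space_eq2)

lemma avg_nonneg: "(\<And>x. 0 \<le> f x) \<Longrightarrow> 0 \<le> avg f Q"
  unfolding avg_def set_lebesgue_integral_def by (intro divide_nonneg_nonneg Bochner_Integration.integral_nonneg) auto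

lemma measure_mult_avg: "Q \<in> T \<Longrightarrow> measure M Q * avg f Q = (LINT x:Q|M. f x)"
  using pos_measure_T[of Q] by (simp add: avg_def)

section \<open>Running maxima and Doob's maximal inequality\<close>

definition run :: "('a \<Rightarrow> real) \<Rightarrow> 'a set \<Rightarrow> real" where
  "run f Q = max_val (avg f) (above T Q)"

text \<open>For Q in T, \<open>run f Q\<close> differs from \<open>run_prev f Q\<close> only if the
  average over Q exceeds 0 and all averages over larger members, and then it equals that average.
  Such record cubes take the place of stopping cubes.\<close>

definition run_prev :: "('a \<Rightarrow> real) \<Rightarrow> 'a set \<Rightarrow> real" where
  "run_prev f Q = max_val (avg f) (strictly_above T Q)"

definition maximal :: "('a \<Rightarrow> real) \<Rightarrow> 'a \<Rightarrow> real" where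
  "maximal f x = max_val (avg f) (containing T x)"

lemma run_prev_nonneg: "0 \<le> run_prev f Q"
  and run_prev_le_run: "run_prev f Q \<le> run f Q"
  and run_nonneg: "0 \<le> run f Q"
  and maximal_nonneg: "0 \<le> maximal f x"
  by (auto simp: run_def run_prev_def maximal_def
      intro!: max_val_nonneg max_val_mono strictly_above_subset)

lemma run_eq: "Q \<in> T \<Longrightarrow> run f Q = max (avg f Q) (run_prev f Q)"
  by (simp add: run_def run_prev_def above_eq_insert max_val_insert)

lemma avg_le_run: "Q \<in> T \<Longrightarrow> avg f Q \<le> run f Q"
  by (simp add: run_eq)

lemma run_le_maximal: "x \<in> Q \<Longrightarrow> run f Q \<le> maximal f x"
  unfolding run_def maximal_def by (intro max_val_mono above_subset_containing) auto

lemma run_antimono: "Q \<subseteq> R \<Longrightarrow> run f R \<le> run f Q"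
  unfolding run_def by (intro max_val_mono finite_above) (auto simp: above_def)

lemma incr_max_val_powr:
  "incr T (\<lambda>A. max_val (avg f) A powr s) R = run f R powr s - run_prev f R powr s"
  by (simp add: incr_def run_def run_prev_def)

lemma integrable_maximal_powr: "integrable M (\<lambda>x. maximal f x powr s)"
  using integrable_fun_containing[of "\<lambda>A. max_val (avg f) A powr s"]
  by (auto simp: maximal_def)

lemma integral_maximal_powr:
  "(\<integral>x. maximal f x powr s \<partial>M) = (\<Sum>R\<in>T. (run f R powr s - run_prev f R powr s) * measure M R)"
  using integral_fun_containing[of "\<lambda>A. max_val (avg f) A powr s"]
  by (simp add: maximal_def incr_max_val_powr)

text \<open>Twice the coefficient that \<open>mult_powr_pred_absorb\<close> yields for c = s/(s-1);
  the 2 comes from absorbing half of the left-hand side. Being defined outside the locale, it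
  depends on s alone.\<close>

definition (in -) doob_const :: "real \<Rightarrow> real" where
  "doob_const s = 2 * (s / (s - 1) * (2 * (s / (s - 1))) powr (s - 1))"

text \<open>The left-hand side is a sum of increments of \<open>run f R\<close> powr s times the
  measure of R. They vanish except at record cubes, where the running maximum is the average, so
  \<open>powr_diff_le\<close> produces the integral of f over R. Summing back gives c times the
  integral of f M^(s-1), half of which is absorbed.\<close>

lemma doob_maximal:
  assumes s: "1 < s" and f: "f \<in> borel_measurable M" "\<And>x. 0 \<le> f x" "integrable M (\<lambda>x. f x powr s)"
  shows "(\<integral>x. maximal f x powr s \<partial>M) \<le> doob_const s * (\<integral>x. f x powr s \<partial>M)"
proof -
  define c where "c = s / (s - 1)"
  have c: "0 < c" using s by (simp add: c_def)
  have fQ: "set_integrable M Q f" if "Q \<in> T" for Q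
    using set_integrable_of_powr[OF s f that] .
  have int: "integrable M (\<lambda>x. f x * maximal f x powr (s - 1))"
    and eq: "(\<integral>x. f x * maximal f x powr (s - 1) \<partial>M)
      = (\<Sum>R\<in>T. (run f R powr (s - 1) - run_prev f R powr (s - 1)) * (LINT x:R|M. f x))"
    using integral_mult_fun_containing[of "\<lambda>A. max_val (avg f) A powr (s - 1)" f] fQ
    by (simp_all add: maximal_def incr_max_val_powr)
  have "(\<integral>x. maximal f x powr s \<partial>M)
      = (\<Sum>R\<in>T. (run f R powr s - run_prev f R powr s) * measure M R)"
    by (rule integral_maximal_powr)
  also have "\<dots> \<le> (\<Sum>R\<in>T. c * ((run f R powr (s - 1) - run_prev f R powr (s - 1)) * (LINT x:R|M. f x)))"
  proof (rule sum_mono)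
    fix R assume R: "R \<in> T"
    show "(run f R powr s - run_prev f R powr s) * measure M R
      \<le> c * ((run f R powr (s - 1) - run_prev f R powr (s - 1)) * (LINT x:R|M. f x))"
    proof (cases "run f R = run_prev f R")
      case False
      then have "avg f R = run f R" using run_eq[OF R, of f] by linarith
      then have "(LINT x:R|M. f x) = measure M R * run f R"
        using measure_mult_avg[OF R, of f] by simp
      moreover have "run f R powr s - run_prev f R powr s
          \<le> c * (run f R * (run f R powr (s - 1) - run_prev f R powr (s - 1)))"
        unfolding c_def using s run_prev_nonneg run_prev_le_run by (rule powr_diff_le)
      from mult_right_mono[OF this measure_nonneg[of M R]] calculation
      show ?thesis by (simp add: mult_ac)
    qed simp
  qed
  also have "\<dots> = (\<integral>x. c * (f x * maximal f x powr (s - 1)) \<partial>M)"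
    by (simp add: eq sum_distrib_left)
  also have "\<dots> \<le> (\<integral>x. maximal f x powr s / 2 + c * (2 * c) powr (s - 1) * f x powr s \<partial>M)"
    using int f s c integrable_maximal_powr maximal_nonneg
    by (intro integral_mono mult_powr_pred_absorb) auto
  also have "\<dots> = (\<integral>x. maximal f x powr s \<partial>M) / 2 + c * (2 * c) powr (s - 1) * (\<integral>x. f x powr s \<partial>M)"
    using f integrable_maximal_powr by (subst Bochner_Integration.integral_add) auto
  finally show ?thesis by (simp add: doob_const_def flip: c_def)
qed

lemma (in -) doob_const_pos: "1 < s \<Longrightarrow> 0 < doob_const s"
  by (simp add: doob_const_def)

end

section \<open>The Carleson embedding\<close>

definition children :: "'a set set \<Rightarrow> 'a set \<Rightarrow> 'a set set" where
  "children T R = {C \<in> T. C \<subset> R \<and> (\<forall>R'\<in>T. R' \<subset> R \<longrightarrow> C \<subseteq> R' \<longrightarrow> R' = C)}"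

context laminar_family
begin

lemma finite_children [simp]: "finite (children T R)"
  using finite_T by (simp add: children_def)

lemma children_disjoint: "disjoint_family_on (\<lambda>C. C) (children T R)"
  unfolding disjoint_family_on_def
proof (intro ballI impI)
  fix C C' assume "C \<in> children T R" "C' \<in> children T R" "C \<noteq> C'"
  then show "C \<inter> C' = {}" using laminar[of C C'] by (auto simp: children_def)
qed

lemma below_eq_insert: "R \<in> T \<Longrightarrow> below T R = insert R (\<Union>C\<in>children T R. below T C)"
proof (intro equalityI subsetI)
  fix Q assume "R \<in> T" and Q: "Q \<in> below T R"
  show "Q \<in> insert R (\<Union>C\<in>children T R. below T C)"
  proof (cases "Q = R")
    case False
    have "finite {R' \<in> T. R' \<subset> R}" "Q \<in> {R' \<in> T. R' \<subset> R}"
      using finite_T Q False by (auto simp: below_def)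
    from finite_has_maximal2[OF this] obtain C
      where "C \<in> T" "C \<subset> R" "Q \<subseteq> C" "\<forall>R'\<in>{R' \<in> T. R' \<subset> R}. C \<subseteq> R' \<longrightarrow> C = R'"
      by blast
    then show ?thesis using Q by (auto simp: children_def below_def)
  qed simp
qed (auto simp: below_def children_def)

text \<open>The recursion behind the Bellman induction. The families below distinct children are
  disjoint because the children are disjoint and no member is empty.\<close>

lemma sum_below_eq:
  fixes g :: "'a set \<Rightarrow> real"
  assumes "R \<in> T"
  shows "sum g (below T R) = g R + (\<Sum>C\<in>children T R. sum g (below T C))"
proof -
  have "R \<notin> (\<Union>C\<in>children T R. below T C)"
    by (auto simp: children_def below_def)
  then have "sum g (below T R) = g R + sum g (\<Union>C\<in>children T R. below T C)"
    unfolding below_eq_insert[OF assms] by (subst sum.insert) auto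
  also have "sum g (\<Union>C\<in>children T R. below T C) = (\<Sum>C\<in>children T R. sum g (below T C))"
  proof (rule sum.UNION_disjoint, simp, simp, intro ballI impI)
    fix C C' assume "C \<in> children T R" "C' \<in> children T R" "C \<noteq> C'"
    then have "C \<inter> C' = {}"
      using children_disjoint[of R] by (auto simp: disjoint_family_on_def)
    then have "Q = {}" if "Q \<subseteq> C" "Q \<subseteq> C'" for Q using that by blast
    then show "below T C \<inter> below T C' = {}"
      using nonempty_T unfolding below_def by blast
  qed
  finally show ?thesis .
qed

end

context laminar_measure
begin

lemma measure_children_le:
  assumes "R \<in> T"
  shows "(\<Sum>C\<in>children T R. measure M C) \<le> measure M R"
proof -
  have "(\<Sum>C\<in>children T R. measure M C) = measure M (\<Union>C\<in>children T R. C)"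
    using sets_T finite_measure_T children_disjoint[of R] finite_children[of R]
    by (intro measure_finite_Union[of "children T R" "\<lambda>C. C" M, symmetric])
       (auto simp: children_def less_top[symmetric])
  also have "\<dots> \<le> measure M R"
    using sets_T[OF assms] finite_measure_T[OF assms] sets_T finite_children[of R]
    by (intro measure_mono_fmeasurable sets.finite_UN) (auto simp: children_def fmeasurable_def)
  finally show ?thesis .
qed

text \<open>The relative gain of the running maximum at R, weighted by the measure. If
  \<open>run f R\<close> is 0, division by zero gives 0, in accordance with there being no
  gain.\<close>

definition jump :: "('a \<Rightarrow> real) \<Rightarrow> 'a set \<Rightarrow> real" where
  "jump f R = measure M R * ((run f R - run_prev f R) / run f R)"

lemma jump_nonneg: "0 \<le> jump f R"
  unfolding jump_def using run_prev_le_run run_nonneg by auto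

lemma jump_le: "jump f R \<le> measure M R"
proof -
  have "(run f R - run_prev f R) / run f R \<le> 1"
    using run_prev_nonneg[of f R] run_prev_le_run[of f R] by (cases "run f R = 0") (auto simp: field_simps)
  from mult_left_mono[OF this measure_nonneg[of M R]] show ?thesis by (simp add: jump_def)
qed

text \<open>R0 itself contributes at most its measure. Strictly below R0, a jump is at most
  1/\<open>run_prev\<close> - 1/\<open>run\<close> times the integral of f over R. These reciprocals
  telescope to at most 1/c with c = \<open>run f R0\<close>, so the remaining sum is at most the
  integral of f over R0 divided by c, hence again at most the measure of R0.\<close>

lemma jump_carleson:
  assumes f: "\<And>x. 0 \<le> f x" "\<And>Q. Q \<in> T \<Longrightarrow> set_integrable M Q f" and R0: "R0 \<in> T"
  shows "sum (jump f) (below T R0) \<le> 2 * measure M R0"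
proof -
  define B where "B = {R \<in> T. R \<subset> R0}"
  define I where "I R = (LINT x:R|M. f x)" for R
  have I_mono: "I R \<le> I R0" if "R \<in> B" for R
    unfolding I_def set_lebesgue_integral_def
    using that f(1) f(2)[OF R0] f(2)[of R] unfolding set_integrable_def
    by (intro integral_mono) (auto simp: B_def indicator_def)
  have I_nonneg: "0 \<le> I R" for R
    unfolding I_def set_lebesgue_integral_def using f(1) by (intro Bochner_Integration.integral_nonneg) auto
  have finB: "finite B" using finite_T by (simp add: B_def)
  have "sum (jump f) B \<le> measure M R0"
  proof (cases "avg f R0 = 0")
    \<comment> \<open>A zero average over R0 forces zero averages over all smaller members, so no
      records occur there.\<close>
    case True
    have "jump f R = 0" if "R \<in> B" for R
    proof -
      have "R \<in> T" using that by (simp add: B_def)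
      have "I R = 0" using I_mono[OF that] I_nonneg[of R] True measure_mult_avg[OF R0, of f]
        by (simp add: I_def)
      then have "avg f R = 0" by (simp add: avg_def I_def)
      then have "run f R = run_prev f R"
        using run_eq[OF \<open>R \<in> T\<close>, of f] run_prev_nonneg[of f R] by simp
      then show ?thesis by (simp add: jump_def)
    qed
    then show ?thesis by simp
  next
    case False
    define c where "c = run f R0"
    have avg_c: "0 < avg f R0" "avg f R0 \<le> c"
      using False avg_nonneg[of f R0] f(1) avg_le_run[OF R0] by (auto simp: c_def less_le)
    then have c: "0 < c" by linarith
    \<comment> \<open>Truncation at c makes \<Theta> vanish on the empty set and bounds it by 1/c.
      Strictly below R0 both running maxima are at least c, so there the truncation has no
      effect.\<close>
    define \<Theta> where "\<Theta> A = 1 / c - 1 / max c (max_val (avg f) A)" for A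
    have \<Theta>_empty: "\<Theta> {} = 0" using c by (simp add: \<Theta>_def)
    have \<Theta>_mono: "\<Theta> A \<le> \<Theta> A'" if "A \<subseteq> A'" "finite A'" for A A'
      using max_val_mono[OF that(2,1), of "avg f"] c unfolding \<Theta>_def
      by (intro diff_left_mono divide_left_mono) (auto simp: zero_less_mult_iff)
    \<comment> \<open>Restricting f to R0 keeps its integrals over the members inside R0, and allows
      the sum to be extended to all of T at the price of only the integral over R0.\<close>
    define f0 where "f0 x = indicator R0 x * f x" for x
    have f0: "set_integrable M R f0" if "R \<in> T" for R
    proof -
      have "integrable M (\<lambda>x. indicator R x *\<^sub>R (indicator R0 x *\<^sub>R f x))"
        using sets_T[OF that] f(2)[OF R0] unfolding set_integrable_def
        by (rule integrable_mult_indicator)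
      then show ?thesis by (simp add: set_integrable_def f0_def)
    qed
    have "jump f R \<le> incr T \<Theta> R * (LINT x:R|M. f0 x)" if "R \<in> B" for R
    proof -
      have R: "R \<in> T" "R \<subset> R0" using that by (auto simp: B_def)
      have cR: "c \<le> run_prev f R"
        unfolding c_def run_def run_prev_def
        using R by (intro max_val_mono finite_strictly_above) (auto simp: above_def strictly_above_def)
      have incr_eq: "incr T \<Theta> R = 1 / run_prev f R - 1 / run f R"
        using cR run_prev_le_run[of f R]
        by (simp add: incr_def \<Theta>_def run_def[symmetric] run_prev_def[symmetric] max_absorb2)
      have f0_eq: "(LINT x:R|M. f0 x) = measure M R * avg f R"
        unfolding measure_mult_avg[OF R(1)] set_lebesgue_integral_def f0_def
        using R(2) by (intro Bochner_Integration.integral_cong) (auto simp: indicator_def)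
      show ?thesis
      proof (cases "run f R = run_prev f R")
        case False
        then have avg: "avg f R = run f R" using run_eq[OF R(1), of f] by linarith
        have pos: "0 < run_prev f R" "run_prev f R < run f R"
          using c cR run_prev_le_run[of f R] False by linarith+
        have "(run f R - run_prev f R) / run f R \<le> (run f R - run_prev f R) / run_prev f R"
          using pos by (intro divide_left_mono) auto
        also have "\<dots> = (1 / run_prev f R - 1 / run f R) * run f R"
          using pos by (simp add: field_simps)
        finally have "jump f R \<le> measure M R * ((1 / run_prev f R - 1 / run f R) * run f R)"
          unfolding jump_def by (intro mult_left_mono) auto
        then show ?thesis unfolding incr_eq f0_eq avg by (simp add: mult_ac)
      qed (simp add: jump_def incr_eq)
    qed
    then have "sum (jump f) B \<le> (\<Sum>R\<in>B. incr T \<Theta> R * (LINT x:R|M. f0 x))"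
      by (rule sum_mono)
    also have "\<dots> \<le> (\<Sum>R\<in>T. incr T \<Theta> R * (LINT x:R|M. f0 x))"
      using finite_T \<Theta>_mono f(1)
      by (intro sum_mono2 mult_nonneg_nonneg incr_nonneg)
         (auto simp: B_def f0_def set_lebesgue_integral_def intro!: Bochner_Integration.integral_nonneg)
    also have "\<dots> = (\<integral>x. f0 x * \<Theta> (containing T x) \<partial>M)"
      using integral_mult_fun_containing(2)[of \<Theta> f0, OF \<Theta>_empty f0] by simp
    also have "\<dots> \<le> (\<integral>x. f0 x * (1 / c) \<partial>M)"
    proof (rule integral_mono)
      show "integrable M (\<lambda>x. f0 x * \<Theta> (containing T x))"
        using integral_mult_fun_containing(1)[of \<Theta> f0, OF \<Theta>_empty f0] by simp
      show "integrable M (\<lambda>x. f0 x * (1 / c))"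
        using f(2)[OF R0] by (simp add: f0_def set_integrable_def)
      fix x
      have "\<Theta> (containing T x) \<le> 1 / c" using c by (auto simp: \<Theta>_def)
      then show "f0 x * \<Theta> (containing T x) \<le> f0 x * (1 / c)"
        using f(1) by (intro mult_left_mono) (auto simp: f0_def)
    qed
    also have "\<dots> = measure M R0 * (avg f R0 / c)"
      using measure_mult_avg[OF R0, of f, symmetric] by (simp add: f0_def set_lebesgue_integral_def)
    also have "\<dots> \<le> measure M R0 * 1"
      using avg_c c by (intro mult_left_mono) auto
    finally show ?thesis by simp
  qed
  moreover have "sum (jump f) (below T R0) = jump f R0 + sum (jump f) B"
  proof -
    have "below T R0 = insert R0 B" "R0 \<notin> B" using R0 by (auto simp: below_def B_def)
    then show ?thesis using finB by simp
  qed
  ultimately show ?thesis using jump_le[of f R0] by simp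
qed

text \<open>The first summand is the Bellman function \<open>S\<^sup>q V\<^bsup>1-q\<^esup>\<close> that drives the induction: \<open>S\<close> and \<open>V\<close> are
  superadditive over the children, and the dependence on \<open>V\<close> pays for the Carleson sequence.\<close>

lemma carleson_bellman:
  fixes a \<mu> :: "'a set \<Rightarrow> real"
  assumes q: "1 < q" and a: "\<And>Q. Q \<in> T \<Longrightarrow> 0 \<le> a Q" and \<mu>: "\<And>Q. Q \<in> T \<Longrightarrow> 0 \<le> \<mu> Q"
    and carleson: "\<And>R. R \<in> T \<Longrightarrow> sum \<mu> (below T R) \<le> 2 * measure M R"
    and R0: "R0 \<in> T"
  shows "sum a (below T R0) powr q * (measure M R0 + sum \<mu> (below T R0)) powr (1 - q)
      + (q - 1) * 3 powr (- q) * (\<Sum>R\<in>below T R0. \<mu> R * (sum a (below T R) / measure M R) powr q)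
    \<le> q * (\<Sum>Q\<in>below T R0. a Q * (sum a (below T Q) / measure M Q) powr (q - 1))"
  using R0
proof (induction "card (below T R0)" arbitrary: R0 rule: less_induct)
  case less
  define S where "S R = sum a (below T R)" for R
  define V where "V R = measure M R + sum \<mu> (below T R)" for R
  define k where "k = (q - 1) * 3 powr (- q)"
  define A where "A R = (\<Sum>R'\<in>below T R. \<mu> R' * (S R' / measure M R') powr q)" for R
  define E where "E R = (\<Sum>Q\<in>below T R. a Q * (S Q / measure M Q) powr (q - 1))" for R
  define m where "m = measure M R0"
  define Ch where "Ch = children T R0"
  have ChT: "C \<in> T" if "C \<in> Ch" for C using that by (simp add: Ch_def children_def)
  have m: "0 < m" unfolding m_def by (rule pos_measure_T[OF less.prems])
  have S_nonneg: "0 \<le> S R" for R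
    unfolding S_def using a by (intro sum_nonneg) (auto simp: below_def)
  have \<mu>_nonneg: "0 \<le> sum \<mu> (below T R)" for R
    using \<mu> by (intro sum_nonneg) (auto simp: below_def)
  have V_pos: "0 < V R" if "R \<in> T" for R
    unfolding V_def using pos_measure_T[OF that] \<mu>_nonneg[of R] by linarith
  have IH: "S C powr q * V C powr (1 - q) + k * A C \<le> q * E C" if "C \<in> Ch" for C
  proof -
    have "below T C \<subset> below T R0"
      using that less.prems by (auto simp: Ch_def children_def below_def)
    then have "card (below T C) < card (below T R0)"
      by (intro psubset_card_mono) auto
    from less.hyps[OF this ChT[OF that]] show ?thesis
      by (simp add: S_def V_def k_def A_def E_def)
  qed
  \<comment> \<open>S^q V^(1-q) is passed from R0 to its children in three moves: remove
    \<open>\<mu> R0\<close> from V, which leaves W, remove \<open>a R0\<close> from S, then split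
    over the children.\<close>
  define W where "W = V R0 - \<mu> R0"
  have W_eq: "W = m + (\<Sum>C\<in>Ch. sum \<mu> (below T C))"
    by (simp add: W_def V_def m_def Ch_def sum_below_eq[OF less.prems])
  have W_ge: "m \<le> W" using \<mu>_nonneg by (simp add: W_eq sum_nonneg)
  have W_Ch: "sum V Ch \<le> W"
    using measure_children_le[OF less.prems] by (simp add: W_eq V_def sum.distrib m_def Ch_def)
  have V3: "V R0 \<le> 3 * m" using carleson[OF less.prems] by (simp add: V_def m_def)
  have \<mu>0: "0 \<le> \<mu> R0" and a0: "0 \<le> a R0" using \<mu> a less.prems by auto
  have S_eq: "S R0 = a R0 + sum S Ch"
    by (simp add: S_def Ch_def sum_below_eq[OF less.prems])
  have SCh: "0 \<le> sum S Ch" using S_nonneg by (simp add: sum_nonneg)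

  \<comment> \<open>Removing \<open>\<mu> R0\<close> pays for the term of \<open>A\<close> at R0.
    The Carleson condition gives V \<le> m + 2 m, whence the factor 3^(-q).\<close>
  have step1: "S R0 powr q * V R0 powr (1 - q) + k * (\<mu> R0 * (S R0 / m) powr q)
      \<le> S R0 powr q * W powr (1 - q)"
  proof -
    have "(3 * m) powr (- q) \<le> V R0 powr (- q)"
      using V3 V_pos[OF less.prems] q by (intro powr_mono2') auto
    then have "(q - 1) * \<mu> R0 * (3 * m) powr (- q) \<le> (q - 1) * \<mu> R0 * V R0 powr (- q)"
      using q \<mu>0 by (intro mult_left_mono) auto
    also have "\<dots> \<le> W powr (1 - q) - V R0 powr (1 - q)"
      using powr_one_minus_decrease[of q W "\<mu> R0"] q m W_ge \<mu>0 by (simp add: W_def)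
    finally have "S R0 powr q * ((q - 1) * \<mu> R0 * (3 * m) powr (- q))
        \<le> S R0 powr q * (W powr (1 - q) - V R0 powr (1 - q))"
      by (intro mult_left_mono) auto
    moreover have "S R0 powr q * ((q - 1) * \<mu> R0 * (3 * m) powr (- q)) = k * (\<mu> R0 * (S R0 / m) powr q)"
      using m S_nonneg[of R0] by (simp add: k_def powr_mult powr_divide powr_minus_divide)
    ultimately show ?thesis by (simp add: right_diff_distrib)
  qed
  \<comment> \<open>Removing \<open>a R0\<close> costs at most a tangent increment, which is at most
    q times the term of \<open>E\<close> at R0 since W is at least m and the exponent 1 - q is
    negative.\<close>
  have step2: "S R0 powr q * W powr (1 - q)
      \<le> sum S Ch powr q * W powr (1 - q) + q * (a R0 * (S R0 / m) powr (q - 1))"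
  proof -
    have "S R0 powr q \<le> sum S Ch powr q + q * S R0 powr (q - 1) * a R0"
      using powr_tangent[of q "S R0" "sum S Ch"] q SCh S_nonneg[of R0] S_eq by (simp add: algebra_simps)
    then have "S R0 powr q * W powr (1 - q)
        \<le> (sum S Ch powr q + q * S R0 powr (q - 1) * a R0) * W powr (1 - q)"
      by (intro mult_right_mono) auto
    also have "\<dots> = sum S Ch powr q * W powr (1 - q) + q * S R0 powr (q - 1) * a R0 * W powr (1 - q)"
      by (simp add: algebra_simps)
    also have "\<dots> \<le> sum S Ch powr q * W powr (1 - q) + q * S R0 powr (q - 1) * a R0 * m powr (1 - q)"
      using W_ge m q a0 by (intro add_left_mono mult_left_mono powr_mono2') auto
    also have "q * S R0 powr (q - 1) * a R0 * m powr (1 - q) = q * (a R0 * (S R0 / m) powr (q - 1))"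
      using m S_nonneg[of R0] powr_minus_divide[of m "q - 1"] by (simp add: powr_divide)
    finally show ?thesis .
  qed
  \<comment> \<open>The values of V on the children sum to at most W, and U^q V^(1-q) is
    subadditive.\<close>
  have step3: "sum S Ch powr q * W powr (1 - q) \<le> (\<Sum>C\<in>Ch. S C powr q * V C powr (1 - q))"
  proof (cases "Ch = {}")
    case False
    have "0 < sum V Ch"
      using False V_pos ChT by (intro sum_pos) (auto simp: Ch_def)
    then have "sum S Ch powr q * W powr (1 - q) \<le> sum S Ch powr q * sum V Ch powr (1 - q)"
      using W_Ch q by (intro mult_left_mono powr_mono2') auto
    also have "\<dots> \<le> (\<Sum>C\<in>Ch. S C powr q * V C powr (1 - q))"
      using q S_nonneg V_pos ChT by (intro perspective_powr_subadditive) (auto simp: Ch_def)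
    finally show ?thesis .
  qed simp
  have "(\<Sum>C\<in>Ch. S C powr q * V C powr (1 - q)) + k * sum A Ch
      = (\<Sum>C\<in>Ch. S C powr q * V C powr (1 - q) + k * A C)"
    by (simp add: sum.distrib sum_distrib_left)
  also have "\<dots> \<le> q * sum E Ch"
    unfolding sum_distrib_left using IH by (rule sum_mono)
  finally have step4: "(\<Sum>C\<in>Ch. S C powr q * V C powr (1 - q)) + k * sum A Ch \<le> q * sum E Ch" .
  have AE: "A R0 = \<mu> R0 * (S R0 / m) powr q + sum A Ch"
    "E R0 = a R0 * (S R0 / m) powr (q - 1) + sum E Ch"
    by (simp_all add: A_def E_def m_def Ch_def sum_below_eq[OF less.prems])
  have "S R0 powr q * V R0 powr (1 - q) + k * A R0 \<le> q * E R0"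
    using step1 step2 step3 step4 unfolding AE by (simp add: algebra_simps)
  then show ?case by (simp add: S_def V_def k_def A_def E_def)
qed

text \<open>Dropping the nonnegative Bellman term leaves an inequality at every R0. Weighting it by
  the increments of \<Theta> and reversing the summation by parts inserts \<Theta> on both
  sides.\<close>

lemma weighted_carleson_embedding:
  fixes a \<mu> :: "'a set \<Rightarrow> real"
  assumes q: "1 < q" and a: "\<And>Q. Q \<in> T \<Longrightarrow> 0 \<le> a Q" and \<mu>: "\<And>Q. Q \<in> T \<Longrightarrow> 0 \<le> \<mu> Q"
    and carleson: "\<And>R. R \<in> T \<Longrightarrow> sum \<mu> (below T R) \<le> 2 * measure M R"
    and \<Theta>: "\<Theta> {} = 0" "\<And>A B. A \<subseteq> B \<Longrightarrow> finite B \<Longrightarrow> \<Theta> A \<le> \<Theta> B"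
  shows "(q - 1) * 3 powr (- q) * (\<Sum>R\<in>T. \<mu> R * (sum a (below T R) / measure M R) powr q * \<Theta> (above T R))
    \<le> q * (\<Sum>Q\<in>T. a Q * (sum a (below T Q) / measure M Q) powr (q - 1) * \<Theta> (above T Q))"
proof -
  have "(q - 1) * 3 powr (- q) * (\<Sum>R\<in>below T R0. \<mu> R * (sum a (below T R) / measure M R) powr q)
    \<le> q * (\<Sum>Q\<in>below T R0. a Q * (sum a (below T Q) / measure M Q) powr (q - 1))" if "R0 \<in> T" for R0
  proof -
    have "0 \<le> sum a (below T R0) powr q * (measure M R0 + sum \<mu> (below T R0)) powr (1 - q)"
      by simp
    then show ?thesis using carleson_bellman[OF q, of a \<mu> R0, OF a \<mu> carleson that] by linarith
  qed
  then have "(\<Sum>R0\<in>T. incr T \<Theta> R0 * ((q - 1) * 3 powr (- q) *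
        (\<Sum>R\<in>below T R0. \<mu> R * (sum a (below T R) / measure M R) powr q)))
    \<le> (\<Sum>R0\<in>T. incr T \<Theta> R0 * (q *
        (\<Sum>Q\<in>below T R0. a Q * (sum a (below T Q) / measure M Q) powr (q - 1))))"
    using \<Theta>(2) by (intro sum_mono mult_left_mono incr_nonneg) auto
  then show ?thesis
    unfolding sum_by_parts[of \<Theta>, OF \<Theta>(1)] by (simp add: sum_distrib_left mult_ac)
qed

end

section \<open>The bilinear form of two measures\<close>

definition Lp_nonneg :: "real \<Rightarrow> 'a measure \<Rightarrow> ('a \<Rightarrow> real) \<Rightarrow> bool" where
  "Lp_nonneg s M f \<longleftrightarrow> f \<in> borel_measurable M \<and> (\<forall>x. 0 \<le> f x) \<and> integrable M (\<lambda>x. f x powr s)"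

lemma Lp_nonnegD:
  assumes "Lp_nonneg s M f"
  shows "f \<in> borel_measurable M" "\<And>x. 0 \<le> f x" "integrable M (\<lambda>x. f x powr s)"
  using assms by (auto simp: Lp_nonneg_def)

lemma Lp_nonneg_mult:
  assumes "Lp_nonneg s M f" "0 \<le> c"
  shows "Lp_nonneg s M (\<lambda>x. c * f x)"
    and "(\<integral>x. (c * f x) powr s \<partial>M) = c powr s * (\<integral>x. f x powr s \<partial>M)"
  using Lp_nonnegD[OF assms(1)] assms(2) by (auto simp: Lp_nonneg_def powr_mult)

lemma (in laminar_family) incr_sum:
  assumes "R \<in> T"
  shows "incr T (sum w) R = w R"
proof -
  have "R \<notin> strictly_above T R" by (simp add: strictly_above_def)
  then show ?thesis by (simp add: incr_def above_eq_insert[OF assms])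
qed

context laminar_measure
begin

lemma Lp_nonneg_fun_containing:
  assumes "\<Theta> {} = 0" "\<And>A. A \<subseteq> T \<Longrightarrow> 0 \<le> \<Theta> A"
  shows "Lp_nonneg s M (\<lambda>x. \<Theta> (containing T x))"
  unfolding Lp_nonneg_def
proof (intro conjI allI)
  show "(\<lambda>x. \<Theta> (containing T x)) \<in> borel_measurable M"
    using integrable_fun_containing[of \<Theta>, OF assms(1)] by auto
  show "0 \<le> \<Theta> (containing T x)" for x
    by (intro assms(2)) (auto simp: containing_def)
  show "integrable M (\<lambda>x. \<Theta> (containing T x) powr s)"
    using integrable_fun_containing[of "\<lambda>A. \<Theta> A powr s"] assms(1) by simp
qed

lemma Lp_nonneg_set_integrable: "1 < s \<Longrightarrow> Lp_nonneg s M f \<Longrightarrow> Q \<in> T \<Longrightarrow> set_integrable M Q f"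
  by (rule set_integrable_of_powr) (auto simp: Lp_nonneg_def)

lemma doob: "1 < s \<Longrightarrow> Lp_nonneg s M f \<Longrightarrow>
    (\<integral>x. maximal f x powr s \<partial>M) \<le> doob_const s * (\<integral>x. f x powr s \<partial>M)"
  by (rule doob_maximal) (auto simp: Lp_nonneg_def)

end

text \<open>The three summands are the coefficients of the integrals of g, f and the Wolff potential
  that arise in \<open>half_form_le\<close>.\<close>

definition half_const :: "real \<Rightarrow> real \<Rightarrow> real" where
  "half_const p q = doob_const (dual_exponent q)
     + q / ((q - 1) * 3 powr (- q)) * doob_const p + q / ((q - 1) * 3 powr (- q))"

lemma half_const_pos: "1 < q \<Longrightarrow> 1 < p \<Longrightarrow> 0 < half_const p q"
  unfolding half_const_def
  by (intro add_pos_pos mult_pos_pos divide_pos_pos doob_const_pos dual_exponent_gt_1) auto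

locale two_weight = sigma: laminar_measure T \<sigma> + omega: laminar_measure T \<omega>
  for T :: "'a set set" and \<sigma> \<omega> :: "'a measure" +
  fixes K :: "'a set \<Rightarrow> real"
  assumes K_nonneg: "Q \<in> T \<Longrightarrow> 0 \<le> K Q"
begin

definition mass :: "'a set \<Rightarrow> real" where
  "mass Q = K Q * measure \<sigma> Q * measure \<omega> Q"

text \<open>The quotient is the \<sigma>-integral of \<open>K_bar K \<omega> Q\<close> over Q with
  its defining sum truncated to T.\<close>

definition wolff_weight :: "real \<Rightarrow> 'a set \<Rightarrow> real" where
  "wolff_weight q Q = K Q * measure \<omega> Q * (sum mass (below T Q) / measure \<omega> Q) powr (q - 1)"

definition wolff :: "real \<Rightarrow> 'a \<Rightarrow> real" where
  "wolff q x = sum (wolff_weight q) (containing T x)"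

definition form :: "('a \<Rightarrow> real) \<Rightarrow> ('a \<Rightarrow> real) \<Rightarrow> real" where
  "form f g = (\<Sum>Q\<in>T. K Q * (LINT x:Q|\<sigma>. f x) * (LINT x:Q|\<omega>. g x))"

definition op :: "('a \<Rightarrow> real) \<Rightarrow> 'a \<Rightarrow> real" where
  "op f x = (\<Sum>Q\<in>containing T x. K Q * (LINT x:Q|\<sigma>. f x))"

lemma mass_nonneg: "Q \<in> T \<Longrightarrow> 0 \<le> mass Q"
  by (simp add: mass_def K_nonneg)

lemma sum_mass_nonneg: "0 \<le> sum mass (below T Q)"
  by (intro sum_nonneg mass_nonneg) (auto simp: below_def)

lemma wolff_weight_nonneg: "Q \<in> T \<Longrightarrow> 0 \<le> wolff_weight q Q"
  by (simp add: wolff_weight_def K_nonneg)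

lemma Lp_nonneg_wolff: "Lp_nonneg s \<sigma> (wolff q)"
  unfolding wolff_def
  by (rule sigma.Lp_nonneg_fun_containing) (auto intro!: sum_nonneg wolff_weight_nonneg)

lemma wolff_nonneg: "0 \<le> wolff q x"
  unfolding wolff_def by (intro sum_nonneg wolff_weight_nonneg) (auto simp: containing_def)

lemma LINT_nonneg: "(\<And>x. 0 \<le> f x) \<Longrightarrow> 0 \<le> (LINT x:Q|M. f x)" for f :: "'a \<Rightarrow> real"
  unfolding set_lebesgue_integral_def by (intro Bochner_Integration.integral_nonneg) auto

lemma Lp_nonneg_op: "(\<And>x. 0 \<le> f x) \<Longrightarrow> Lp_nonneg s \<omega> (op f)"
  unfolding op_def
  by (rule omega.Lp_nonneg_fun_containing)
     (auto intro!: sum_nonneg mult_nonneg_nonneg LINT_nonneg intro: K_nonneg)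

lemma form_eq_integral:
  assumes "\<And>Q. Q \<in> T \<Longrightarrow> set_integrable \<omega> Q g"
  shows "integrable \<omega> (\<lambda>x. g x * op f x)" "form f g = (\<integral>x. g x * op f x \<partial>\<omega>)"
proof -
  note * = omega.integral_mult_fun_containing[of "sum (\<lambda>Q. K Q * (LINT x:Q|\<sigma>. f x))" g, OF _ assms]
  show "integrable \<omega> (\<lambda>x. g x * op f x)"
    using *(1) by (simp add: op_def)
  show "form f g = (\<integral>x. g x * op f x \<partial>\<omega>)"
    using *(2) by (simp add: op_def form_def sigma.incr_sum mult_ac)
qed

section \<open>One half of the bilinear form\<close>

lemma sum_wolff_le:
  assumes exps: "1 < q" "q < p" "1 / q = 1 / r + 1 / p" and f: "Lp_nonneg p \<sigma> f"
  shows "(\<Sum>Q\<in>T. mass Q * (sum mass (below T Q) / measure \<omega> Q) powr (q - 1) * sigma.run f Q powr q)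
    \<le> doob_const p * (\<integral>x. f x powr p \<partial>\<sigma>) + (\<integral>x. wolff q x powr (r / q) \<partial>\<sigma>)"
proof -
  have "1 / p < 1 / q"
    using exps(1,2) by (simp add: frac_less2)
  then have "0 < 1 / r" using exps(3) by linarith
  then have r: "0 < r" by simp
  have pq: "1 < p / q" using exps by simp
  \<comment> \<open>Multiplied by q, the relation between the exponents says that p/q and r/q are
    dual. They serve in Young's inequality for (M f)^q times the Wolff potential.\<close>
  have conj: "1 / (p / q) + 1 / (r / q) = 1"
  proof -
    have "1 = q * (1 / q)" using exps(1) by simp
    also have "\<dots> = q / r + q / p" unfolding exps(3) by (simp add: distrib_left)
    finally show ?thesis by simp
  qed
  have rq: "1 < r / q"
  proof -
    have "0 < 1 / (p / q)" using exps by simp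
    then have "1 / (r / q) < 1" using conj by linarith
    then show ?thesis using r exps by (simp add: field_simps)
  qed
  have intW: "integrable \<sigma> (\<lambda>x. wolff q x powr (r / q))"
    using Lp_nonnegD(3)[OF Lp_nonneg_wolff] .
  have max_int: "set_integrable \<sigma> Q (\<lambda>x. sigma.maximal f x powr q)" if "Q \<in> T" for Q
    unfolding set_integrable_def using sigma.sets_T[OF that] sigma.integrable_maximal_powr
    by (rule integrable_mult_indicator)
  note W = sigma.integral_mult_fun_containing[of "sum (wolff_weight q)", OF _ max_int]
  \<comment> \<open>The factor \<sigma>(Q) in the mass turns each summand into a Wolff weight times
    the integral over Q of a constant, which the maximal function then dominates.\<close>
  have "(\<Sum>Q\<in>T. mass Q * (sum mass (below T Q) / measure \<omega> Q) powr (q - 1) * sigma.run f Q powr q)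
      = (\<Sum>Q\<in>T. wolff_weight q Q * (LINT x:Q|\<sigma>. sigma.run f Q powr q))"
    by (intro sum.cong refl) (simp add: sigma.LINT_const mass_def wolff_weight_def mult_ac)
  also have "\<dots> \<le> (\<Sum>Q\<in>T. wolff_weight q Q * (LINT x:Q|\<sigma>. sigma.maximal f x powr q))"
  proof (intro sum_mono mult_left_mono wolff_weight_nonneg)
    fix Q assume Q: "Q \<in> T"
    have "set_integrable \<sigma> Q (\<lambda>x. sigma.run f Q powr q)"
      using sigma.integrable_indicator_T[OF Q] by (simp add: set_integrable_def)
    then show "(LINT x:Q|\<sigma>. sigma.run f Q powr q) \<le> (LINT x:Q|\<sigma>. sigma.maximal f x powr q)"
      using max_int[OF Q] exps sigma.run_le_maximal sigma.run_nonneg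
      by (intro set_integral_mono powr_mono2) auto
  qed
  also have "\<dots> = (\<integral>x. sigma.maximal f x powr q * wolff q x \<partial>\<sigma>)"
    using W(2) by (simp add: wolff_def sigma.incr_sum)
  also have "\<dots> \<le> (\<integral>x. sigma.maximal f x powr p + wolff q x powr (r / q) \<partial>\<sigma>)"
  proof (rule integral_mono)
    show "integrable \<sigma> (\<lambda>x. sigma.maximal f x powr q * wolff q x)"
      using W(1) by (simp add: wolff_def)
    show "integrable \<sigma> (\<lambda>x. sigma.maximal f x powr p + wolff q x powr (r / q))"
      using intW sigma.integrable_maximal_powr by auto
    fix x
    have "sigma.maximal f x powr q * wolff q x
        \<le> (sigma.maximal f x powr q) powr (p / q) + wolff q x powr (r / q)"
      using pq rq conj wolff_nonneg by (intro young_le) auto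
    then show "sigma.maximal f x powr q * wolff q x
        \<le> sigma.maximal f x powr p + wolff q x powr (r / q)"
      using exps by (simp add: powr_powr)
  qed
  also have "\<dots> = (\<integral>x. sigma.maximal f x powr p \<partial>\<sigma>) + (\<integral>x. wolff q x powr (r / q) \<partial>\<sigma>)"
    using intW sigma.integrable_maximal_powr by (intro Bochner_Integration.integral_add) auto
  also have "\<dots> \<le> doob_const p * (\<integral>x. f x powr p \<partial>\<sigma>) + (\<integral>x. wolff q x powr (r / q) \<partial>\<sigma>)"
    using sigma.doob[OF _ f] exps by simp
  finally show ?thesis .
qed

text \<open>With G the running maximum of g, F that of f, and u as below, each summand is
  \<open>jump g R\<close> times G times F u. Young's inequality splits it: the part with G^q' is at
  most an increment of G^q', summed by Doob, and in the part with (F u)^q the embedding replaces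
  jump times u^q by mass times u^(q-1), which \<open>sum_wolff_le\<close> bounds.\<close>

lemma half_form_le:
  assumes exps: "1 < q" "q < p" "1 / q = 1 / r + 1 / p"
    and f: "Lp_nonneg p \<sigma> f" and g: "Lp_nonneg (dual_exponent q) \<omega> g"
  shows "(\<Sum>R\<in>T. sigma.run f R * (omega.run g R - omega.run_prev g R) * sum mass (below T R))
    \<le> half_const p q * ((\<integral>x. f x powr p \<partial>\<sigma>) + (\<integral>x. g x powr dual_exponent q \<partial>\<omega>)
        + (\<integral>x. wolff q x powr (r / q) \<partial>\<sigma>))"
proof -
  define q' where "q' = dual_exponent q"
  define k where "k = (q - 1) * 3 powr (- q)"
  define u where "u R = sum mass (below T R) / measure \<omega> R" for R
  define If where "If = (\<integral>x. f x powr p \<partial>\<sigma>)"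
  define Ig where "Ig = (\<integral>x. g x powr q' \<partial>\<omega>)"
  define IW where "IW = (\<integral>x. wolff q x powr (r / q) \<partial>\<sigma>)"
  have k: "0 < k" using exps by (simp add: k_def)
  have q': "1 < q'" using exps by (simp add: q'_def dual_exponent_gt_1)
  have u: "0 \<le> u R" for R using sum_mass_nonneg by (simp add: u_def)
  have nonneg: "0 \<le> If" "0 \<le> Ig" "0 \<le> IW"
    unfolding If_def Ig_def IW_def by (auto intro!: Bochner_Integration.integral_nonneg)
  have g_int: "set_integrable \<omega> Q g" if "Q \<in> T" for Q
    using omega.Lp_nonneg_set_integrable[OF q' _ that] g by (simp add: q'_def)
  have pointwise: "sigma.run f R * (omega.run g R - omega.run_prev g R) * sum mass (below T R)
      \<le> (omega.run g R powr q' - omega.run_prev g R powr q') * measure \<omega> R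
        + omega.jump g R * u R powr q * sigma.run f R powr q" if R: "R \<in> T" for R
  proof (cases "omega.run g R = 0")
    case True
    then have "omega.run_prev g R = 0"
      using omega.run_prev_nonneg[of g R] omega.run_prev_le_run[of g R] by linarith
    then show ?thesis using True by (simp add: omega.jump_def)
  next
    case False
    define G H F where "G = omega.run g R" "H = omega.run_prev g R" "F = sigma.run f R"
    have GHF: "0 < G" "0 \<le> H" "H \<le> G" "0 \<le> F"
      using False omega.run_nonneg[of g R] omega.run_prev_nonneg[of g R]
        omega.run_prev_le_run[of g R] sigma.run_nonneg[of f R]
      by (auto simp: G_H_F_def)
    have m: "0 < measure \<omega> R" using omega.pos_measure_T[OF R] .
    have "F * (G - H) * sum mass (below T R) = omega.jump g R * (G * (F * u R))"
      using m GHF by (simp add: omega.jump_def u_def flip: G_H_F_def)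
    also have "\<dots> \<le> omega.jump g R * (G powr q' + (F * u R) powr q)"
      using GHF u q' exps inverse_dual_exponent[of q] omega.jump_nonneg
      by (intro mult_left_mono young_le) (auto simp: q'_def)
    also have "\<dots> = omega.jump g R * G powr q' + omega.jump g R * u R powr q * F powr q"
      using GHF u by (simp add: powr_mult algebra_simps)
    also have "omega.jump g R * G powr q' = (G - H) * G powr (q' - 1) * measure \<omega> R"
      using GHF powr_pred_mult[of G q', symmetric]
      by (simp add: omega.jump_def flip: G_H_F_def)
    also have "(G - H) * G powr (q' - 1) * measure \<omega> R + omega.jump g R * u R powr q * F powr q
        \<le> (G powr q' - H powr q') * measure \<omega> R + omega.jump g R * u R powr q * F powr q"
      using powr_diff_ge[OF q' GHF(2,3)] by (intro add_right_mono mult_right_mono) auto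
    finally show ?thesis by (simp add: G_H_F_def)
  qed
  have "k * (\<Sum>R\<in>T. omega.jump g R * u R powr q * sigma.run f R powr q)
      \<le> q * (\<Sum>Q\<in>T. mass Q * u Q powr (q - 1) * sigma.run f Q powr q)"
  proof -
    \<comment> \<open>The embedding is applied in \<omega>, but its weight comes from averages in
      \<sigma>: it only asks \<Theta> to be monotone and to vanish on the empty set.\<close>
    define \<Theta> where "\<Theta> A = max_val (sigma.avg f) A powr q" for A
    have "\<Theta> A \<le> \<Theta> B" if "A \<subseteq> B" "finite B" for A B
      unfolding \<Theta>_def using that exps
      by (intro powr_mono2 max_val_mono max_val_nonneg) (auto intro: finite_subset)
    moreover have "\<Theta> {} = 0" by (simp add: \<Theta>_def)
    moreover note mass_nonneg omega.jump_nonneg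
      omega.jump_carleson[of g, OF Lp_nonnegD(2)[OF g] g_int]
    ultimately have "k * (\<Sum>R\<in>T. omega.jump g R * u R powr q * \<Theta> (above T R))
        \<le> q * (\<Sum>Q\<in>T. mass Q * u Q powr (q - 1) * \<Theta> (above T Q))"
      unfolding k_def u_def using exps
      by (intro omega.weighted_carleson_embedding) auto
    then show ?thesis by (simp add: \<Theta>_def sigma.run_def)
  qed
  also have "\<dots> \<le> q * (doob_const p * If + IW)"
    using sum_wolff_le[OF exps f] exps by (intro mult_left_mono) (auto simp: u_def If_def IW_def)
  finally have "(\<Sum>R\<in>T. omega.jump g R * u R powr q * sigma.run f R powr q)
      \<le> q / k * (doob_const p * If + IW)"
    using k by (simp add: field_simps)
  moreover have "(\<Sum>R\<in>T. (omega.run g R powr q' - omega.run_prev g R powr q') * measure \<omega> R)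
      \<le> doob_const q' * Ig"
    using omega.doob[OF q'] g by (simp add: omega.integral_maximal_powr q'_def Ig_def)
  moreover have "(\<Sum>R\<in>T. sigma.run f R * (omega.run g R - omega.run_prev g R) * sum mass (below T R))
      \<le> (\<Sum>R\<in>T. (omega.run g R powr q' - omega.run_prev g R powr q') * measure \<omega> R)
       + (\<Sum>R\<in>T. omega.jump g R * u R powr q * sigma.run f R powr q)"
    unfolding sum.distrib[symmetric] by (intro sum_mono pointwise)
  ultimately have "(\<Sum>R\<in>T. sigma.run f R * (omega.run g R - omega.run_prev g R) * sum mass (below T R))
      \<le> doob_const q' * Ig + (q / k * doob_const p) * If + q / k * IW"
    by (simp add: algebra_simps)
  also have "\<dots> \<le> half_const p q * Ig + half_const p q * If + half_const p q * IW"
  proof -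
    have "0 < doob_const p" "0 < doob_const q'" "0 < q / k"
      using exps q' k by (auto intro: doob_const_pos)
    moreover from this have "0 < q / k * doob_const p" by (intro mult_pos_pos)
    ultimately show ?thesis
      using nonneg unfolding half_const_def q'_def[symmetric] k_def[symmetric]
      by (intro add_mono mult_right_mono) linarith+
  qed
  finally show ?thesis by (simp add: If_def Ig_def IW_def q'_def algebra_simps)
qed

end

text \<open>The hypotheses on the exponents are invariant under replacing (p, q) by (q', p') with
  the same r. Hence exchanging the two measures transfers every result to the second Wolff
  potential.\<close>

lemma dual_exponents_swap:
  assumes "1 < q" "q < p" "1 / q = 1 / r + 1 / p"
  shows "1 < dual_exponent p" "dual_exponent p < dual_exponent q"
    "1 / dual_exponent p = 1 / r + 1 / dual_exponent q"
proof -
  show "1 < dual_exponent p" using assms by (intro dual_exponent_gt_1) auto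
  have "1 / p < 1 / q" using assms(1,2) by (simp add: frac_less2)
  then have "1 / dual_exponent q < 1 / dual_exponent p"
    using assms(1,2) by (simp only: inverse_dual_exponent)
  moreover have "0 < dual_exponent q" "0 < dual_exponent p"
    using dual_exponent_gt_1[of q] dual_exponent_gt_1[of p] assms by auto
  ultimately show "dual_exponent p < dual_exponent q" by (simp add: field_simps)
  show "1 / dual_exponent p = 1 / r + 1 / dual_exponent q"
    using assms by (simp only: inverse_dual_exponent[of p] inverse_dual_exponent[of q])
qed

definition form_const :: "real \<Rightarrow> real \<Rightarrow> real" where
  "form_const p q = half_const p q + half_const (dual_exponent q) (dual_exponent p)"

lemma form_const_pos: "1 < q \<Longrightarrow> 1 < p \<Longrightarrow> 0 < form_const p q"
  unfolding form_const_def by (intro add_pos_pos half_const_pos dual_exponent_gt_1)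

section \<open>Sufficiency of the Wolff conditions for a finite family\<close>

context two_weight
begin

lemma swap: "two_weight T \<omega> \<sigma> K"
  by unfold_locales (rule K_nonneg)

lemma swap_mass: "two_weight.mass \<omega> \<sigma> K = mass"
  by (simp add: fun_eq_iff mass_def two_weight.mass_def[OF swap] mult_ac)

lemma swap_form: "two_weight.form T \<omega> \<sigma> K g f = form f g"
  by (simp add: form_def two_weight.form_def[OF swap] mult_ac)

lemma form_le:
  assumes exps: "1 < q" "q < p" "1 / q = 1 / r + 1 / p"
    and f: "Lp_nonneg p \<sigma> f" and g: "Lp_nonneg (dual_exponent q) \<omega> g"
  shows "form f g \<le> form_const p q * ((\<integral>x. f x powr p \<partial>\<sigma>) + (\<integral>x. g x powr dual_exponent q \<partial>\<omega>)
        + (\<integral>x. wolff q x powr (r / q) \<partial>\<sigma>)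
        + (\<integral>x. two_weight.wolff T \<omega> \<sigma> K (dual_exponent p) x powr (r / dual_exponent p) \<partial>\<omega>))"
proof -
  interpret sw: two_weight T \<omega> \<sigma> K by (rule swap)
  define p' q' where "p' = dual_exponent p" "q' = dual_exponent q"
  define S where "S R = sum mass (below T R)" for R
  define If where "If = (\<integral>x. f x powr p \<partial>\<sigma>)"
  define Ig where "Ig = (\<integral>x. g x powr q' \<partial>\<omega>)"
  define I1 where "I1 = (\<integral>x. wolff q x powr (r / q) \<partial>\<sigma>)"
  define I2 where "I2 = (\<integral>x. sw.wolff p' x powr (r / p') \<partial>\<omega>)"
  define F F' where "F = sigma.run f" "F' = sigma.run_prev f"
  define G G' where "G = omega.run g" "G' = omega.run_prev g"
  have nonneg: "0 \<le> If" "0 \<le> Ig" "0 \<le> I1" "0 \<le> I2"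
    unfolding If_def Ig_def I1_def I2_def by (auto intro!: Bochner_Integration.integral_nonneg)
  have FG: "0 \<le> F' R" "F' R \<le> F R" "0 \<le> G' R" "G' R \<le> G R" for R
    by (auto simp: F_F'_def G_G'_def sigma.run_prev_nonneg sigma.run_prev_le_run
        omega.run_prev_nonneg omega.run_prev_le_run)
  have half1: "(\<Sum>R\<in>T. F R * (G R - G' R) * S R) \<le> half_const p q * (If + Ig + I1)"
    using half_form_le[OF exps f g]
    by (simp add: F_F'_def G_G'_def S_def If_def Ig_def I1_def p'_q'_def)
  have "dual_exponent p' = p" using exps by (simp add: p'_q'_def dual_exponent_dual_exponent)
  \<comment> \<open>The first half with (f, \<sigma>, p) and (g, \<omega>, q') exchanged.\<close>
  then have half2: "(\<Sum>R\<in>T. G R * (F R - F' R) * S R) \<le> half_const q' p' * (Ig + If + I2)"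
    using sw.half_form_le[of p' q' r g f] dual_exponents_swap[OF exps] f g
    by (simp add: F_F'_def G_G'_def S_def If_def Ig_def I2_def p'_q'_def swap_mass)
  define \<Theta> where "\<Theta> A = max_val (sigma.avg f) A * max_val (omega.avg g) A" for A
  have "form f g = (\<Sum>Q\<in>T. mass Q * (sigma.avg f Q * omega.avg g Q))"
    unfolding form_def mass_def
    by (intro sum.cong refl) (simp flip: sigma.measure_mult_avg omega.measure_mult_avg)
  also have "\<dots> \<le> (\<Sum>Q\<in>T. mass Q * \<Theta> (above T Q))"
    unfolding \<Theta>_def sigma.run_def[symmetric] omega.run_def[symmetric]
    using Lp_nonnegD(2)[OF f] Lp_nonnegD(2)[OF g]
    by (intro sum_mono mult_left_mono mult_mono mass_nonneg sigma.avg_le_run omega.avg_le_run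
        sigma.run_nonneg omega.avg_nonneg)
  also have "\<dots> = (\<Sum>R\<in>T. incr T \<Theta> R * S R)"
    unfolding S_def by (rule sigma.sum_by_parts) (simp add: \<Theta>_def)
  also have "\<dots> \<le> (\<Sum>R\<in>T. F R * (G R - G' R) * S R + G R * (F R - F' R) * S R)"
  proof (rule sum_mono)
    fix R
    have "incr T \<Theta> R = F R * G R - F' R * G' R"
      by (simp add: incr_def \<Theta>_def F_F'_def G_G'_def sigma.run_def omega.run_def
          sigma.run_prev_def omega.run_prev_def)
    \<comment> \<open>The right-hand side exceeds the left by (F - F') (G - G').\<close>
    also have "\<dots> \<le> F R * (G R - G' R) + G R * (F R - F' R)"
      using mult_nonneg_nonneg[of "F R - F' R" "G R - G' R"] FG[of R] by (simp add: algebra_simps)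
    finally have "incr T \<Theta> R * S R \<le> (F R * (G R - G' R) + G R * (F R - F' R)) * S R"
      using sum_mass_nonneg by (intro mult_right_mono) (auto simp: S_def)
    then show "incr T \<Theta> R * S R \<le> F R * (G R - G' R) * S R + G R * (F R - F' R) * S R"
      by (simp add: algebra_simps)
  qed
  also have "\<dots> \<le> half_const p q * (If + Ig + I1) + half_const q' p' * (Ig + If + I2)"
    using half1 half2 by (simp add: sum.distrib)
  also have "\<dots> \<le> half_const p q * (If + Ig + I1 + I2) + half_const q' p' * (If + Ig + I1 + I2)"
  proof (rule add_mono; rule mult_left_mono)
    show "0 \<le> half_const p q" "0 \<le> half_const q' p'"
      using half_const_pos[of q p] half_const_pos[of p' q'] exps
        dual_exponent_gt_1[of p] dual_exponent_gt_1[of q] by (auto simp: p'_q'_def)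
  qed (use nonneg in auto)
  finally show ?thesis
    by (simp add: form_const_def If_def Ig_def I1_def I2_def p'_q'_def distrib_right)
qed

text \<open>(T f)^(q-1) is the extremal function for the duality of L^q and L^q': its pairing with T
  f and the integral of its q'-th power both equal the integral of (T f)^q.\<close>

lemma op_dual_function:
  assumes q: "1 < q" and f: "\<And>x. 0 \<le> f x"
  shows "Lp_nonneg (dual_exponent q) \<omega> (\<lambda>x. op f x powr (q - 1))"
    and "(op f x powr (q - 1)) powr dual_exponent q = op f x powr q"
    and "form f (\<lambda>x. op f x powr (q - 1)) = (\<integral>x. op f x powr q \<partial>\<omega>)"
proof -
  show Lp: "Lp_nonneg (dual_exponent q) \<omega> (\<lambda>x. op f x powr (q - 1))"
    unfolding op_def by (rule omega.Lp_nonneg_fun_containing) auto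
  show "(op f x powr (q - 1)) powr dual_exponent q = op f x powr q"
    using q by (simp add: powr_powr dual_exponent_def)
  have "form f (\<lambda>x. op f x powr (q - 1)) = (\<integral>x. op f x powr (q - 1) * op f x \<partial>\<omega>)"
    using q by (intro form_eq_integral omega.Lp_nonneg_set_integrable[OF _ Lp] dual_exponent_gt_1)
  also have "\<dots> = (\<integral>x. op f x powr q \<partial>\<omega>)"
    using Lp_nonnegD(2)[OF Lp_nonneg_op[of f 1]] f powr_pred_mult[of "op f _" q]
    by (intro Bochner_Integration.integral_cong) (auto simp: mult.commute)
  finally show "form f (\<lambda>x. op f x powr (q - 1)) = (\<integral>x. op f x powr q \<partial>\<omega>)" .
qed

lemma form_mult: "form (\<lambda>x. c * f x) (\<lambda>x. d * g x) = c * d * form f g"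
  by (simp add: form_def sum_distrib_left mult_ac)

text \<open>The form is tested on a small multiple of the extremal function, and half of the
  left-hand side is absorbed. This is legitimate since T f is a finite combination of indicators, so
  its q-th power is integrable.\<close>

lemma integral_op_le:
  assumes exps: "1 < q" "q < p" "1 / q = 1 / r + 1 / p"
    and f: "Lp_nonneg p \<sigma> f"
  shows "(\<integral>x. op f x powr q \<partial>\<omega>) \<le> (2 * form_const p q) powr q * ((\<integral>x. f x powr p \<partial>\<sigma>)
        + (\<integral>x. wolff q x powr (r / q) \<partial>\<sigma>)
        + (\<integral>x. two_weight.wolff T \<omega> \<sigma> K (dual_exponent p) x powr (r / dual_exponent p) \<partial>\<omega>))"
    (is "?Y \<le> _ * (?If + ?I1 + ?I2)")
proof -
  define q' where "q' = dual_exponent q"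
  define H where "H = form_const p q"
  \<comment> \<open>Chosen so that H e^q' = e/2; then 2 H / e = (2 H)^q.\<close>
  define e where "e = (1 / (2 * H)) powr (q - 1)"
  have H: "0 < H" using form_const_pos exps by (simp add: H_def)
  then have e: "0 < e" by (simp add: e_def)
  note f0 = Lp_nonnegD(2)[OF f]
  note h = op_dual_function[of q f, OF exps(1) f0]
  note eh = Lp_nonneg_mult[OF h(1), of e]
  have "form f (\<lambda>x. e * op f x powr (q - 1)) = e * ?Y"
    using form_mult[of 1 f e "\<lambda>x. op f x powr (q - 1)"] h(3) by simp
  moreover have "(\<integral>x. (e * op f x powr (q - 1)) powr q' \<partial>\<omega>) = e powr q' * ?Y"
    using eh(2) e h(2) by (simp add: q'_def)
  ultimately have "e * ?Y \<le> H * (?If + e powr q' * ?Y + ?I1 + ?I2)"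
    using form_le[OF exps f, of "\<lambda>x. e * op f x powr (q - 1)"] eh(1) e by (simp add: q'_def H_def)
  moreover have "H * e powr q' = e / 2"
  proof -
    have "(q - 1) * (q' - 1) = 1" using exps by (simp add: q'_def dual_exponent_def field_simps)
    then have "e powr (q' - 1) = 1 / (2 * H)" using H by (simp add: e_def powr_powr)
    then have "e powr q' = e * (1 / (2 * H))" using powr_pred_mult[of e q', symmetric] e by simp
    then show ?thesis using H by simp
  qed
  moreover have "H * (?If + e powr q' * ?Y + ?I1 + ?I2) = H * (?If + ?I1 + ?I2) + H * e powr q' * ?Y"
    by (simp add: algebra_simps)
  ultimately have "e * ?Y \<le> H * (?If + ?I1 + ?I2) + e / 2 * ?Y"
    by simp
  then have "?Y \<le> 2 * H / e * (?If + ?I1 + ?I2)"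
    using e by (simp add: field_simps)
  also have "2 * H / e = (2 * H) powr q"
    using H powr_pred_mult[of "2 * H" q] by (simp add: e_def powr_divide)
  finally show ?thesis by (simp add: H_def)
qed

section \<open>Necessity of the Wolff conditions for a finite family\<close>

text \<open>The form is tested on \<open>\<alpha> f\<close> and \<open>\<beta> (T f)\<^bsup>q-1\<^esup>\<close>; the condition on \<open>\<alpha>\<close>, \<open>\<beta>\<close> lets the left-hand side
  absorb the norms of the test functions.\<close>

lemma integral_wolff_le:
  assumes exps: "1 < q" "q < p" "1 / q = 1 / r + 1 / p"
    and form: "\<And>f g. Lp_nonneg p \<sigma> f \<Longrightarrow> Lp_nonneg (dual_exponent q) \<omega> g \<Longrightarrow>
        form f g \<le> 1 + (\<integral>x. f x powr p \<partial>\<sigma>) + (\<integral>x. g x powr dual_exponent q \<partial>\<omega>)"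
    and \<alpha>\<beta>: "0 < \<alpha>" "0 < \<beta>"
      "\<alpha> powr p * (doob_const (p / q) * (1 + doob_const q)) + \<beta> powr dual_exponent q \<le> \<alpha> * \<beta> / 2"
  shows "(\<integral>x. wolff q x powr (r / q) \<partial>\<sigma>) \<le> (1 + doob_const q) * (2 / (\<alpha> * \<beta>))"
proof -
  define s where "s = r / q"
  define X where "X = (\<integral>x. wolff q x powr s \<partial>\<sigma>)"
  define \<phi> where "\<phi> x = wolff q x powr (s - 1)" for x
  define F where "F Q = sigma.run \<phi> Q powr (1 / q)" for Q
  \<comment> \<open>Because of the maximal function, f is at least \<open>F Q\<close> on Q and F
    grows as cubes shrink, while \<open>F Q powr q\<close> dominates the average of \<phi> over
    Q.\<close>
  define f where "f x = sigma.maximal \<phi> x powr (1 / q)" for x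
  define h where "h = op f"
  define Y where "Y = (\<integral>x. h x powr q \<partial>\<omega>)"
  define u where "u Q = sum mass (below T Q) / measure \<omega> Q" for Q
  have pq: "1 < p / q" using exps by simp
  have "1 / p < 1 / q" using exps(1,2) by (simp add: frac_less2)
  then have "0 < 1 / r" using exps(3) by linarith
  then have r: "0 < r" by simp
  \<comment> \<open>s and p/q are dual, so the power p/q of \<phi> is the power s of the Wolff
    potential, with integral X.\<close>
  have s_dual: "(s - 1) * (p / q) = s"
  proof -
    have "p * r = q * p + q * r" using exps r by (simp add: field_simps)
    then show ?thesis using exps by (simp add: s_def field_simps)
  qed

  have \<phi>: "Lp_nonneg t \<sigma> \<phi>" for t
    unfolding \<phi>_def wolff_def by (rule sigma.Lp_nonneg_fun_containing) auto
  have f: "Lp_nonneg t \<sigma> f" for t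
    unfolding f_def sigma.maximal_def by (rule sigma.Lp_nonneg_fun_containing) auto
  have f0: "0 \<le> f x" for x by (simp add: f_def)
  have \<phi>_int: "set_integrable \<sigma> Q \<phi>" and f_int: "set_integrable \<sigma> Q f" if "Q \<in> T" for Q
    using sigma.Lp_nonneg_set_integrable[OF pq] \<phi> f that by auto
  have h: "Lp_nonneg t \<omega> h" for t
    unfolding h_def by (rule Lp_nonneg_op[OF f0])
  note h0 = Lp_nonnegD(2)[OF h]

  have "(\<integral>x. f x powr p \<partial>\<sigma>) = (\<integral>x. sigma.maximal \<phi> x powr (p / q) \<partial>\<sigma>)"
    by (simp add: f_def powr_powr)
  also have "\<dots> \<le> doob_const (p / q) * (\<integral>x. \<phi> x powr (p / q) \<partial>\<sigma>)"
    by (rule sigma.doob[OF pq \<phi>])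
  also have "(\<integral>x. \<phi> x powr (p / q) \<partial>\<sigma>) = X"
    unfolding X_def \<phi>_def powr_powr s_dual ..
  finally have f_le: "(\<integral>x. f x powr p \<partial>\<sigma>) \<le> doob_const (p / q) * X" .

  have F_le: "measure \<sigma> Q * F Q \<le> (LINT x:Q|\<sigma>. f x)" if Q: "Q \<in> T" for Q
  proof -
    have "measure \<sigma> Q * F Q = (LINT x:Q|\<sigma>. F Q)"
      by (simp add: sigma.LINT_const[OF Q])
    also have "\<dots> \<le> (LINT x:Q|\<sigma>. f x)"
      using f_int[OF Q] sigma.integrable_indicator_T[OF Q] sigma.run_le_maximal sigma.run_nonneg exps(1)
      by (intro set_integral_mono) (auto simp: set_integrable_def F_def f_def intro!: powr_mono2)
    finally show ?thesis .
  qed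
  \<comment> \<open>Since F grows as cubes shrink, \<open>F Q\<close> can be moved into the sum
    defining u as \<open>F R\<close>. This yields the average over Q of the part of T f that comes
    from cubes inside Q.\<close>
  have Fu_le: "F Q * u Q \<le> omega.avg h Q" if Q: "Q \<in> T" for Q
  proof -
    define w where "w R = K R * (LINT x:R|\<sigma>. f x)" for R
    have w: "0 \<le> w R" if "R \<in> T" for R using that f0 by (simp add: w_def K_nonneg LINT_nonneg)
    have "F Q * sum mass (below T Q) \<le> (\<Sum>R\<in>below T Q. w R * measure \<omega> R)"
      unfolding sum_distrib_left
    proof (rule sum_mono)
      fix R assume "R \<in> below T Q"
      then have R: "R \<in> T" "R \<subseteq> Q" by (auto simp: below_def)
      have "F Q \<le> F R"
        unfolding F_def using R sigma.run_antimono sigma.run_nonneg exps(1) by (intro powr_mono2) auto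
      then have "measure \<sigma> R * F Q \<le> (LINT x:R|\<sigma>. f x)"
        using F_le[OF R(1)] mult_left_mono[of "F Q" "F R" "measure \<sigma> R"] by simp
      then have "K R * measure \<omega> R * (measure \<sigma> R * F Q) \<le> K R * measure \<omega> R * (LINT x:R|\<sigma>. f x)"
        using K_nonneg[OF R(1)] by (intro mult_left_mono) auto
      then show "F Q * mass R \<le> w R * measure \<omega> R" by (simp add: mass_def w_def mult_ac)
    qed
    also have "\<dots> = (\<Sum>R\<in>below T Q. LINT x:Q|\<omega>. w R * indicator R x)"
    proof (rule sum.cong[OF refl])
      fix R assume "R \<in> below T Q"
      then have R: "R \<in> T" "R \<subseteq> Q" by (auto simp: below_def)
      have "w R * measure \<omega> R = (\<integral>x. w R * indicator R x \<partial>\<omega>)"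
        using omega.sets_T[OF R(1)] by (simp add: sets.Int_space_eq2)
      also have "\<dots> = (LINT x:Q|\<omega>. w R * indicator R x)"
        unfolding set_lebesgue_integral_def using R
        by (intro Bochner_Integration.integral_cong) (auto simp: indicator_def)
      finally show "w R * measure \<omega> R = (LINT x:Q|\<omega>. w R * indicator R x)" .
    qed
    also have "\<dots> = (LINT x:Q|\<omega>. \<Sum>R\<in>below T Q. w R * indicator R x)"
      using omega.integrable_indicator_T omega.sets_T[OF Q] unfolding set_lebesgue_integral_def scaleR_sum_right
      by (intro Bochner_Integration.integral_sum[symmetric] integrable_mult_indicator)
         (auto simp: below_def)
    also have "\<dots> \<le> (LINT x:Q|\<omega>. h x)"
    proof (rule set_integral_mono)
      show "set_integrable \<omega> Q (\<lambda>x. \<Sum>R\<in>below T Q. w R * indicator R x)"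
        using omega.integrable_indicator_T omega.sets_T[OF Q] unfolding set_integrable_def
        by (intro integrable_mult_indicator Bochner_Integration.integrable_sum) (auto simp: below_def)
      show "set_integrable \<omega> Q h" using omega.Lp_nonneg_set_integrable[OF exps(1) h Q] .
      fix x
      have "(\<Sum>R\<in>below T Q. w R * indicator R x) \<le> (\<Sum>R\<in>T. w R * indicator R x)"
        using w sigma.finite_T by (intro sum_mono2) (auto simp: below_def)
      then show "(\<Sum>R\<in>below T Q. w R * indicator R x) \<le> h x"
        by (simp add: sigma.sum_indicator_eq h_def op_def w_def)
    qed
    finally show ?thesis
      using omega.pos_measure_T[OF Q] by (simp add: u_def omega.avg_def divide_right_mono)
  qed

  have "X = (\<integral>x. \<phi> x * wolff q x \<partial>\<sigma>)"
    unfolding X_def \<phi>_def using powr_pred_mult[of "wolff q _" s] wolff_nonneg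
    by (intro Bochner_Integration.integral_cong) (auto simp: mult.commute)
  also have "\<dots> = (\<Sum>Q\<in>T. wolff_weight q Q * (LINT x:Q|\<sigma>. \<phi> x))"
    using sigma.integral_mult_fun_containing(2)[of "sum (wolff_weight q)" \<phi>, OF _ \<phi>_int]
    by (simp add: wolff_def sigma.incr_sum)
  also have "\<dots> \<le> (\<Sum>Q\<in>T. K Q * (LINT x:Q|\<sigma>. f x) * (LINT x:Q|\<omega>. omega.maximal h x powr (q - 1)))"
  proof (rule sum_mono)
    fix Q assume Q: "Q \<in> T"
    have u0: "0 \<le> u Q" using sum_mass_nonneg by (simp add: u_def)
    have F0: "0 \<le> F Q" by (simp add: F_def)
    have FQ: "sigma.avg \<phi> Q \<le> F Q powr q"
      using sigma.avg_le_run[OF Q, of \<phi>] sigma.run_nonneg[of \<phi> Q] exps(1) by (simp add: F_def powr_powr)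
    have "wolff_weight q Q * (LINT x:Q|\<sigma>. \<phi> x) = K Q * measure \<omega> Q * measure \<sigma> Q * (u Q powr (q - 1) * sigma.avg \<phi> Q)"
      by (simp add: wolff_weight_def u_def flip: sigma.measure_mult_avg[OF Q])
    also have "\<dots> \<le> K Q * measure \<omega> Q * measure \<sigma> Q * (u Q powr (q - 1) * F Q powr q)"
      using FQ K_nonneg[OF Q] by (intro mult_left_mono) auto
    \<comment> \<open>One of the q powers of F joins \<sigma>(Q) to form the integral of f; the
      other q - 1 join u and are dominated by the maximal function of T f.\<close>
    also have "\<dots> = K Q * (measure \<sigma> Q * F Q) * (measure \<omega> Q * (F Q * u Q) powr (q - 1))"
      using F0 u0 powr_pred_mult[of "F Q" q, symmetric] by (simp add: powr_mult)
    also have "\<dots> \<le> K Q * (LINT x:Q|\<sigma>. f x) * (LINT x:Q|\<omega>. omega.maximal h x powr (q - 1))"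
    proof (intro mult_mono mult_nonneg_nonneg LINT_nonneg f0 K_nonneg[OF Q] F_le[OF Q] order_refl)
      have "measure \<omega> Q * (F Q * u Q) powr (q - 1) = (LINT x:Q|\<omega>. (F Q * u Q) powr (q - 1))"
        by (simp add: omega.LINT_const[OF Q])
      also have "\<dots> \<le> (LINT x:Q|\<omega>. omega.maximal h x powr (q - 1))"
      proof (rule set_integral_mono)
        show "set_integrable \<omega> Q (\<lambda>x. (F Q * u Q) powr (q - 1))"
          using omega.integrable_indicator_T[OF Q] by (simp add: set_integrable_def)
        show "set_integrable \<omega> Q (\<lambda>x. omega.maximal h x powr (q - 1))"
          unfolding set_integrable_def using omega.sets_T[OF Q] omega.integrable_maximal_powr
          by (rule integrable_mult_indicator)
        fix x assume "x \<in> Q"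
        then have "F Q * u Q \<le> omega.maximal h x"
          using Fu_le[OF Q] omega.avg_le_run[OF Q, of h] omega.run_le_maximal[of x Q h] by linarith
        then show "(F Q * u Q) powr (q - 1) \<le> omega.maximal h x powr (q - 1)"
          using exps F0 u0 by (intro powr_mono2) auto
      qed
      finally show "measure \<omega> Q * (F Q * u Q) powr (q - 1) \<le> (LINT x:Q|\<omega>. omega.maximal h x powr (q - 1))" .
    qed (use F0 in auto)
    finally show "wolff_weight q Q * (LINT x:Q|\<sigma>. \<phi> x)
      \<le> K Q * (LINT x:Q|\<sigma>. f x) * (LINT x:Q|\<omega>. omega.maximal h x powr (q - 1))" .
  qed
  also have "\<dots> = form f (\<lambda>x. omega.maximal h x powr (q - 1))"
    by (simp add: form_def)
  also have "\<dots> \<le> (\<integral>x. h x powr q + omega.maximal h x powr q \<partial>\<omega>)"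
  proof -
    have mh: "set_integrable \<omega> Q (\<lambda>x. omega.maximal h x powr (q - 1))" if "Q \<in> T" for Q
      unfolding set_integrable_def using omega.sets_T[OF that] omega.integrable_maximal_powr
      by (rule integrable_mult_indicator)
    have *: "omega.maximal h x powr (q - 1) * h x \<le> h x powr q + omega.maximal h x powr q" for x
    proof -
      have "h x * omega.maximal h x powr (q - 1)
          \<le> h x powr q + (omega.maximal h x powr (q - 1)) powr dual_exponent q"
        using exps h0 dual_exponent_gt_1[of q] inverse_dual_exponent[of q] by (intro young_le) auto
      then show ?thesis using exps by (simp add: powr_powr dual_exponent_def mult.commute)
    qed
    have fe: "integrable \<omega> (\<lambda>x. omega.maximal h x powr (q - 1) * h x)"
      "form f (\<lambda>x. omega.maximal h x powr (q - 1)) = (\<integral>x. omega.maximal h x powr (q - 1) * h x \<partial>\<omega>)"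
      using form_eq_integral[of "\<lambda>x. omega.maximal h x powr (q - 1)" f] mh by (simp_all add: h_def)
    show ?thesis
      unfolding fe(2) using fe(1) Lp_nonnegD(3)[OF h] omega.integrable_maximal_powr *
      by (intro integral_mono Bochner_Integration.integrable_add) auto
  qed
  also have "\<dots> = Y + (\<integral>x. omega.maximal h x powr q \<partial>\<omega>)"
    unfolding Y_def using Lp_nonnegD(3)[OF h] omega.integrable_maximal_powr
    by (intro Bochner_Integration.integral_add) auto
  also have "\<dots> \<le> (1 + doob_const q) * Y"
    using omega.doob[OF exps(1) h] by (simp add: Y_def algebra_simps)
  finally have XY: "X \<le> (1 + doob_const q) * Y" .

  note hd = op_dual_function[of q f, OF exps(1) f0, folded h_def]
  have Y0: "0 \<le> Y" unfolding Y_def by (auto intro!: Bochner_Integration.integral_nonneg)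
  \<comment> \<open>The integral of f^p is bounded by X, and X by Y, so every term except 1 is a
    multiple of Y and half of the left-hand side survives.\<close>
  have "\<alpha> * \<beta> * Y = form (\<lambda>x. \<alpha> * f x) (\<lambda>x. \<beta> * h x powr (q - 1))"
    unfolding form_mult hd(3) Y_def ..
  also have "\<dots> \<le> 1 + (\<integral>x. (\<alpha> * f x) powr p \<partial>\<sigma>)
      + (\<integral>x. (\<beta> * h x powr (q - 1)) powr dual_exponent q \<partial>\<omega>)"
    using \<alpha>\<beta> f hd(1) by (intro form Lp_nonneg_mult) auto
  also have "\<dots> = 1 + \<alpha> powr p * (\<integral>x. f x powr p \<partial>\<sigma>) + \<beta> powr dual_exponent q * Y"
    using Lp_nonneg_mult(2)[OF f, of \<alpha> p] Lp_nonneg_mult(2)[OF hd(1), of \<beta>] hd(2) \<alpha>\<beta>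
    by (simp add: Y_def)
  also have "\<dots> \<le> 1 + \<alpha> powr p * (doob_const (p / q) * ((1 + doob_const q) * Y)) + \<beta> powr dual_exponent q * Y"
  proof -
    have "doob_const (p / q) * X \<le> doob_const (p / q) * ((1 + doob_const q) * Y)"
      using XY doob_const_pos[OF pq] by (intro mult_left_mono) auto
    then have "(\<integral>x. f x powr p \<partial>\<sigma>) \<le> doob_const (p / q) * ((1 + doob_const q) * Y)"
      using f_le by linarith
    then show ?thesis by (intro add_mono mult_left_mono) auto
  qed
  also have "\<dots> = 1 + (\<alpha> powr p * (doob_const (p / q) * (1 + doob_const q)) + \<beta> powr dual_exponent q) * Y"
    by (simp add: algebra_simps)
  also have "\<dots> \<le> 1 + \<alpha> * \<beta> / 2 * Y"
    using \<alpha>\<beta> Y0 by (intro add_left_mono mult_right_mono) auto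
  finally have "Y \<le> 2 / (\<alpha> * \<beta>)"
    using \<alpha>\<beta> by (simp add: field_simps)
  then have "(1 + doob_const q) * Y \<le> (1 + doob_const q) * (2 / (\<alpha> * \<beta>))"
    using doob_const_pos[of q] exps by (intro mult_left_mono) auto
  then show ?thesis using XY by (simp add: X_def s_def)
qed

section \<open>Homogeneity in the kernel and normalised bounds\<close>

lemma scaled: "0 \<le> c \<Longrightarrow> two_weight T \<sigma> \<omega> (\<lambda>Q. c * K Q)"
  by unfold_locales (simp add: K_nonneg)

lemma scaled_op: "0 \<le> c \<Longrightarrow> two_weight.op T \<sigma> (\<lambda>Q. c * K Q) f x = c * op f x"
  by (simp add: op_def two_weight.op_def[OF scaled] sum_distrib_left mult_ac)

lemma scaled_form: "0 \<le> c \<Longrightarrow> two_weight.form T \<sigma> \<omega> (\<lambda>Q. c * K Q) f g = c * form f g"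
  by (simp add: form_def two_weight.form_def[OF scaled] sum_distrib_left mult_ac)

text \<open>K enters each Wolff weight once directly and q - 1 times through the power, so the
  degree of homogeneity is q.\<close>

lemma scaled_wolff:
  assumes "0 < c"
  shows "two_weight.wolff T \<sigma> \<omega> (\<lambda>Q. c * K Q) q x = c powr q * wolff q x"
proof -
  interpret sc: two_weight T \<sigma> \<omega> "\<lambda>Q. c * K Q" using assms by (intro scaled) auto
  have "sc.wolff_weight q Q = c powr q * wolff_weight q Q" for Q
  proof -
    have "sum sc.mass (below T Q) = c * sum mass (below T Q)"
      by (simp add: sum_distrib_left sc.mass_def mass_def mult_ac)
    then have "sc.wolff_weight q Q
        = c * K Q * measure \<omega> Q * (c * (sum mass (below T Q) / measure \<omega> Q)) powr (q - 1)"
      by (simp add: sc.wolff_weight_def)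
    also have "(c * (sum mass (below T Q) / measure \<omega> Q)) powr (q - 1)
        = c powr (q - 1) * (sum mass (below T Q) / measure \<omega> Q) powr (q - 1)"
      by (rule powr_mult)
    also have "c * K Q * measure \<omega> Q * \<dots> = c powr q * wolff_weight q Q"
      using assms powr_pred_mult[of c q, symmetric] by (simp add: wolff_weight_def)
    finally show ?thesis .
  qed
  then show ?thesis by (simp add: sc.wolff_def wolff_def sum_distrib_left)
qed

lemma integral_scaled_wolff:
  assumes "0 < c" "0 < q"
  shows "(\<integral>x. two_weight.wolff T \<sigma> \<omega> (\<lambda>Q. c * K Q) q x powr (r / q) \<partial>\<sigma>)
    = c powr r * (\<integral>x. wolff q x powr (r / q) \<partial>\<sigma>)"
  using assms wolff_nonneg by (simp add: scaled_wolff powr_mult powr_powr)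

text \<open>Dividing K by C and f by l makes each of the three integrals in
  \<open>integral_op_le\<close> at most 1, whence the factor 3. The number l only bounds the norm
  from above, so that it can be positive even if the norm is zero.\<close>

lemma integral_op_bound:
  assumes exps: "1 < q" "q < p" "1 / q = 1 / r + 1 / p" and C: "0 < C" "0 < l"
    and W1: "(\<integral>x. wolff q x powr (r / q) \<partial>\<sigma>) \<le> C powr r"
    and W2: "(\<integral>x. two_weight.wolff T \<omega> \<sigma> K (dual_exponent p) x powr (r / dual_exponent p) \<partial>\<omega>) \<le> C powr r"
    and f: "Lp_nonneg p \<sigma> f" "(\<integral>x. f x powr p \<partial>\<sigma>) \<le> l powr p"
  shows "(\<integral>x. op f x powr q \<partial>\<omega>) \<le> 3 * (2 * form_const p q) powr q * (C * l) powr q"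
proof -
  define c where "c = 1 / C"
  have c: "0 < c" "c * C = 1" using C by (auto simp: c_def)
  interpret sw: two_weight T \<omega> \<sigma> K by (rule swap)
  interpret sc: two_weight T \<sigma> \<omega> "\<lambda>Q. c * K Q" using c by (intro scaled) auto
  define d where "d = 1 / l"
  have d: "0 < d" "d * l = 1" using C by (auto simp: d_def)
  define A where "A = (2 * form_const p q) powr q"
  have A: "0 \<le> A" by (simp add: A_def)
  have one: "a powr t * v \<le> 1" if "v \<le> b powr t" "a * b = 1" "0 < a" "0 < b" for a b t v :: real
  proof -
    have "a powr t * v \<le> a powr t * b powr t" using that by (intro mult_left_mono) auto
    also have "\<dots> = 1" using that by (simp flip: powr_mult)
    finally show ?thesis .
  qed
  have p': "0 < dual_exponent p" using dual_exponent_gt_1[of p] exps by simp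
  have op: "sc.op (\<lambda>x. d * f x) x = c * d * op f x" for x
    using c scaled_op[of c "\<lambda>x. d * f x" x] by (simp add: op_def sum_distrib_left mult_ac)
  have "(\<integral>x. sc.op (\<lambda>x. d * f x) x powr q \<partial>\<omega>)
      \<le> A * ((\<integral>x. (d * f x) powr p \<partial>\<sigma>) + (\<integral>x. sc.wolff q x powr (r / q) \<partial>\<sigma>)
        + (\<integral>x. two_weight.wolff T \<omega> \<sigma> (\<lambda>Q. c * K Q) (dual_exponent p) x powr (r / dual_exponent p) \<partial>\<omega>))"
    unfolding A_def using Lp_nonneg_mult(1)[OF f(1)] d by (intro sc.integral_op_le[OF exps]) auto
  also have "\<dots> \<le> A * (1 + 1 + 1)"
  proof (intro mult_left_mono add_mono A)
    show "(\<integral>x. (d * f x) powr p \<partial>\<sigma>) \<le> 1"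
      using Lp_nonneg_mult(2)[OF f(1), of d] one[OF f(2) d(2)] d C by simp
    show "(\<integral>x. sc.wolff q x powr (r / q) \<partial>\<sigma>) \<le> 1"
      using integral_scaled_wolff[of c q r] one[OF W1 c(2)] c exps C by simp
    show "(\<integral>x. two_weight.wolff T \<omega> \<sigma> (\<lambda>Q. c * K Q) (dual_exponent p) x powr (r / dual_exponent p) \<partial>\<omega>) \<le> 1"
      using sw.integral_scaled_wolff[of c "dual_exponent p" r] one[OF W2 c(2)] c p' C by simp
  qed
  also have "(\<integral>x. sc.op (\<lambda>x. d * f x) x powr q \<partial>\<omega>) = (c * d) powr q * (\<integral>x. op f x powr q \<partial>\<omega>)"
    using Lp_nonneg_mult(2)[OF Lp_nonneg_op, of f "c * d" q] Lp_nonnegD(2)[OF f(1)] c d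
    by (simp add: op)
  finally have "(C * l) powr q * ((c * d) powr q * (\<integral>x. op f x powr q \<partial>\<omega>)) \<le> (C * l) powr q * (A * (1 + 1 + 1))"
    by (intro mult_left_mono) auto
  moreover have "(C * l) powr q * (c * d) powr q = 1"
  proof -
    have "(C * l) * (c * d) = 1" using c d by (simp add: mult_ac)
    then show ?thesis using C c d by (simp flip: powr_mult)
  qed
  ultimately show ?thesis by (simp add: A_def mult_ac flip: mult.assoc)
qed

text \<open>Dividing K by C reduces the hypothesis to that of \<open>integral_wolff_le\<close>; the
  Wolff integral has degree r in K, which restores C^r.\<close>

lemma integral_wolff_bound:
  assumes exps: "1 < q" "q < p" "1 / q = 1 / r + 1 / p" and C: "0 < C"
    and form: "\<And>f g. Lp_nonneg p \<sigma> f \<Longrightarrow> Lp_nonneg (dual_exponent q) \<omega> g \<Longrightarrow>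
        form f g \<le> C * (1 + (\<integral>x. f x powr p \<partial>\<sigma>) + (\<integral>x. g x powr dual_exponent q \<partial>\<omega>))"
    and \<alpha>\<beta>: "0 < \<alpha>" "0 < \<beta>"
      "\<alpha> powr p * (doob_const (p / q) * (1 + doob_const q)) + \<beta> powr dual_exponent q \<le> \<alpha> * \<beta> / 2"
  shows "(\<integral>x. wolff q x powr (r / q) \<partial>\<sigma>) \<le> (1 + doob_const q) * (2 / (\<alpha> * \<beta>)) * C powr r"
proof -
  define c where "c = 1 / C"
  have c: "0 < c" using C by (auto simp: c_def)
  interpret sc: two_weight T \<sigma> \<omega> "\<lambda>Q. c * K Q" using c by (intro scaled) auto
  have "(\<integral>x. sc.wolff q x powr (r / q) \<partial>\<sigma>) \<le> (1 + doob_const q) * (2 / (\<alpha> * \<beta>))"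
  proof (rule sc.integral_wolff_le[OF exps _ \<alpha>\<beta>])
    fix f g assume "Lp_nonneg p \<sigma> f" "Lp_nonneg (dual_exponent q) \<omega> g"
    from form[OF this] show "sc.form f g
        \<le> 1 + (\<integral>x. f x powr p \<partial>\<sigma>) + (\<integral>x. g x powr dual_exponent q \<partial>\<omega>)"
      unfolding scaled_form[OF less_imp_le[OF c]] using C by (simp add: c_def field_simps)
  qed
  then have "c powr r * (\<integral>x. wolff q x powr (r / q) \<partial>\<sigma>) \<le> (1 + doob_const q) * (2 / (\<alpha> * \<beta>))"
    using integral_scaled_wolff[of c q r] c exps by simp
  moreover have "c powr r = 1 / C powr r" using C by (simp add: c_def powr_divide)
  ultimately show ?thesis using C by (simp add: field_simps)
qed

end

text \<open>\<beta> makes the first term equal \<alpha>\<beta>/4, and \<alpha> then does the same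
  for the second. This is solvable because e = (p-1)/(q-1) - 1 is positive when q < p.\<close>

lemma exists_test_scaling:
  assumes "1 < q" "q < p" "0 < D"
  shows "\<exists>\<alpha>>0. \<exists>\<beta>>0. \<alpha> powr p * D + \<beta> powr dual_exponent q \<le> \<alpha> * \<beta> / (2 :: real)"
proof -
  define q' where "q' = dual_exponent q"
  define e where "e = (p - 1) * (q' - 1) - 1"
  define \<alpha> where "\<alpha> = (4 * (4 * D) powr (q' - 1)) powr (- (1 / e))"
  define \<beta> where "\<beta> = 4 * D * \<alpha> powr (p - 1)"
  have e: "0 < e" using assms by (simp add: e_def q'_def dual_exponent_def field_simps)
  have \<alpha>: "0 < \<alpha>" using assms by (simp add: \<alpha>_def)
  have \<beta>: "0 < \<beta>" using assms \<alpha> by (simp add: \<beta>_def)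
  have "\<alpha> powr p * D = \<alpha> * \<beta> / 4"
    using powr_pred_mult[of \<alpha> p] \<alpha> by (simp add: \<beta>_def)
  moreover have "\<beta> powr q' = \<alpha> * \<beta> / 4"
  proof -
    have "\<beta> powr (q' - 1) = (4 * D) powr (q' - 1) * \<alpha> powr (1 + e)"
      using assms \<alpha> by (simp add: \<beta>_def powr_mult powr_powr e_def)
    also have "\<dots> = \<alpha> * ((4 * D) powr (q' - 1) * \<alpha> powr e)"
      using \<alpha> by (simp add: powr_add)
    also have "(4 * D) powr (q' - 1) * \<alpha> powr e = 1 / 4"
    proof -
      have "\<alpha> powr e = 1 / (4 * (4 * D) powr (q' - 1))"
        unfolding \<alpha>_def powr_powr using e assms by (simp add: powr_minus_divide[of _ 1])
      then show ?thesis using assms by simp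
    qed
    finally show ?thesis using powr_pred_mult[of \<beta> q', symmetric] \<beta> by simp
  qed
  ultimately show ?thesis using \<alpha> \<beta> by (intro exI[of _ \<alpha>] exI[of _ \<beta>] conjI) (auto simp: q'_def)
qed

section \<open>Powers and sums of extended nonnegative reals\<close>

lemma ennreal_powr_ennreal: "0 \<le> x \<Longrightarrow> ennreal_powr (ennreal x) a = ennreal (x powr a)"
  by (simp add: ennreal_powr_def)

lemma ennreal_powr_0 [simp]: "ennreal_powr 0 a = 0"
  using ennreal_powr_ennreal[of 0 a] by simp

lemma ennreal_powr_top [simp]: "ennreal_powr top a = top"
  by (simp add: ennreal_powr_def)

lemma ennreal_powr_powr: "ennreal_powr (ennreal_powr x a) b = ennreal_powr x (a * b)"
  by (cases x) (auto simp: ennreal_powr_ennreal powr_powr)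

lemma ennreal_powr_one [simp]: "ennreal_powr x 1 = x"
  by (cases x) (auto simp: ennreal_powr_ennreal)

lemma ennreal_powr_mono: "0 \<le> a \<Longrightarrow> x \<le> y \<Longrightarrow> ennreal_powr x a \<le> ennreal_powr y a"
  by (cases x; cases y) (auto simp: ennreal_powr_ennreal top_unique intro!: ennreal_leI powr_mono2)

lemma ennreal_powr_le_iff:
  assumes "0 < a"
  shows "ennreal_powr x a \<le> y \<longleftrightarrow> x \<le> ennreal_powr y (1 / a)"
proof
  assume "ennreal_powr x a \<le> y"
  then show "x \<le> ennreal_powr y (1 / a)"
    using ennreal_powr_mono[of "1 / a" "ennreal_powr x a" y] assms by (simp add: ennreal_powr_powr)
next
  assume "x \<le> ennreal_powr y (1 / a)"
  then show "ennreal_powr x a \<le> y"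
    using ennreal_powr_mono[of a x "ennreal_powr y (1 / a)"] assms by (simp add: ennreal_powr_powr)
qed

text \<open>Powers have an upper adjoint by the previous lemma, hence preserve suprema.\<close>

lemma ennreal_powr_SUP:
  assumes "0 < a"
  shows "ennreal_powr (SUP i\<in>I. X i) a = (SUP i\<in>I. ennreal_powr (X i) a)"
proof (rule antisym)
  have "X i \<le> ennreal_powr (SUP i\<in>I. ennreal_powr (X i) a) (1 / a)" if "i \<in> I" for i
    using that by (subst ennreal_powr_le_iff[OF assms, symmetric]) (rule SUP_upper)
  then show "ennreal_powr (SUP i\<in>I. X i) a \<le> (SUP i\<in>I. ennreal_powr (X i) a)"
    by (subst ennreal_powr_le_iff[OF assms]) (rule SUP_least)
  show "(SUP i\<in>I. ennreal_powr (X i) a) \<le> ennreal_powr (SUP i\<in>I. X i) a"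
    using assms by (intro SUP_least ennreal_powr_mono SUP_upper) auto
qed

lemma eLp_norm_le_iff:
  assumes "0 < s" "0 \<le> C"
  shows "eLp_norm s M g \<le> ennreal C \<longleftrightarrow> (\<integral>\<^sup>+ x. ennreal_powr (g x) s \<partial>M) \<le> ennreal (C powr s)"
  unfolding eLp_norm_def using assms by (simp add: ennreal_powr_le_iff ennreal_powr_ennreal)

text \<open>The exhaustion is cofinal: every finite subset of D lies in some
  \<open>E n\<close>.\<close>

lemma infsum_ennreal_eq_SUP:
  fixes f :: "'b \<Rightarrow> ennreal"
  assumes "incseq E" "\<And>n. finite (E n)" "(\<Union>n. E n) = D"
  shows "infsum f D = (SUP n. sum f (E n))"
proof -
  have "infsum f D = (SUP F\<in>{F. finite F \<and> F \<subseteq> D}. sum f F)"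
    by (rule nonneg_infsum_complete) simp
  also have "\<dots> = (SUP n. sum f (E n))"
  proof (rule antisym)
    show "(SUP F\<in>{F. finite F \<and> F \<subseteq> D}. sum f F) \<le> (SUP n. sum f (E n))"
    proof (rule SUP_least, clarify)
      fix F assume F: "finite F" "F \<subseteq> D"
      have "\<exists>n. F \<subseteq> E n" using F
      proof (induction F rule: finite_induct)
        case (insert x F)
        then obtain n m where "F \<subseteq> E n" "x \<in> E m" using assms(3) by auto
        then have "insert x F \<subseteq> E (max n m)"
          using incseqD[OF assms(1), of n "max n m"] incseqD[OF assms(1), of m "max n m"] by auto
        then show ?case by blast
      qed simp
      then obtain n where "F \<subseteq> E n" by blast
      then show "sum f F \<le> (SUP n. sum f (E n))"
        using assms(2) by (intro SUP_upper2[of n] sum_mono2) auto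
    qed
    show "(SUP n. sum f (E n)) \<le> (SUP F\<in>{F. finite F \<and> F \<subseteq> D}. sum f F)"
      using assms(2,3) by (intro SUP_least SUP_upper) auto
  qed
  finally show ?thesis .
qed

text \<open>For truncating the outer sum of the Wolff potential and the inner sum in
  \<open>K_bar\<close> by a single index.\<close>

lemma SUP_SUP_diagonal:
  fixes h :: "nat \<Rightarrow> nat \<Rightarrow> ennreal"
  assumes "\<And>m m' n n'. m \<le> m' \<Longrightarrow> n \<le> n' \<Longrightarrow> h m n \<le> h m' n'"
  shows "(SUP m. SUP n. h m n) = (SUP n. h n n)"
proof (rule antisym)
  show "(SUP m. SUP n. h m n) \<le> (SUP n. h n n)"
  proof (intro SUP_least)
    fix m n show "h m n \<le> (SUP n. h n n)"
      by (rule SUP_upper2[of "max m n"]) (auto intro: assms)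
  qed
  show "(SUP n. h n n) \<le> (SUP m. SUP n. h m n)"
    by (intro SUP_least) (meson SUP_upper SUP_upper2 UNIV_I)
qed

section \<open>Dyadic cubes\<close>

text \<open>With floors, nestedness of cubes becomes a statement about integer division by powers of
  2.\<close>

lemma mem_dyadic_cube:
  "x \<in> dyadic_cube i k \<longleftrightarrow> (\<forall>j. \<lfloor>2 powi i * x $ j\<rfloor> = k $ j)"
proof -
  have pos: "0 < (2 :: real) powi i" by simp
  have inv: "(2 :: real) powi (- i) = 1 / 2 powi i" by (simp add: power_int_minus field_simps)
  have "x \<in> dyadic_cube i k \<longleftrightarrow> (\<forall>j. 0 \<le> 2 powi i * x $ j - k $ j \<and> 2 powi i * x $ j - k $ j < 1)"
  proof
    assume "x \<in> dyadic_cube i k"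
    then show "\<forall>j. 0 \<le> 2 powi i * x $ j - k $ j \<and> 2 powi i * x $ j - k $ j < 1"
      using pos by (auto simp: dyadic_cube_def inv)
  next
    assume *: "\<forall>j. 0 \<le> 2 powi i * x $ j - k $ j \<and> 2 powi i * x $ j - k $ j < 1"
    have "x = (2 powi (- i)) *\<^sub>R ((\<chi> j. of_int (k $ j)) + (\<chi> j. 2 powi i * x $ j - k $ j))"
      using pos by (simp add: vec_eq_iff inv)
    then show "x \<in> dyadic_cube i k"
      unfolding dyadic_cube_def using * by (intro image_eqI) auto
  qed
  also have "\<dots> \<longleftrightarrow> (\<forall>j. \<lfloor>2 powi i * x $ j\<rfloor> = k $ j)"
    unfolding floor_eq_iff by (auto simp: algebra_simps)
  finally show ?thesis .
qed

lemma dyadic_cube_finer_subset: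
  assumes "i \<le> i'" "x \<in> dyadic_cube i k" "x \<in> dyadic_cube i' k'"
  shows "dyadic_cube i' k' \<subseteq> dyadic_cube i k"
proof
  fix y assume y: "y \<in> dyadic_cube i' k'"
  define m where "m = nat (i' - i)"
  have i': "i' = i + int m" using assms(1) by (simp add: m_def)
  \<comment> \<open>The floor at the finer scale determines the floor at the coarser one.\<close>
  have coarse: "\<lfloor>2 powi i * t\<rfloor> = \<lfloor>2 powi i' * t\<rfloor> div 2 ^ m" for t :: real
  proof -
    have "2 powi i * t = (2 powi i' * t) / real_of_int (2 ^ m)"
      by (simp add: i' power_int_add)
    then show ?thesis using floor_divide_real_eq_div[of "2 ^ m" "2 powi i' * t"] by simp
  qed
  show "y \<in> dyadic_cube i k"
    using assms(2,3) y by (auto simp: mem_dyadic_cube coarse)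
qed

lemma dyadic_cubes_laminar:
  assumes "Q \<in> dyadic_cubes" "R \<in> dyadic_cubes"
  shows "Q \<subseteq> R \<or> R \<subseteq> Q \<or> Q \<inter> R = {}"
proof -
  obtain i k i' k' where eq: "Q = dyadic_cube i k" "R = dyadic_cube i' k'"
    using assms by (auto simp: dyadic_cubes_def)
  show ?thesis
  proof (cases "Q \<inter> R = {}")
    case False
    then obtain x where "x \<in> Q" "x \<in> R" by blast
    then show ?thesis
      using dyadic_cube_finer_subset[of i i' x k k'] dyadic_cube_finer_subset[of i' i x k' k]
      by (cases "i \<le> i'") (auto simp: eq)
  qed simp
qed

lemma countable_vec_int: "countable (UNIV :: (int ^ 'n) set)"
proof -
  have "countable (vec_nth ` (UNIV :: (int ^ 'n) set))"
    by (rule countable_subset[OF subset_UNIV]) simp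
  then show ?thesis
    by (rule countable_image_inj_on) (auto simp: inj_on_def vec_eq_iff)
qed

lemma countable_dyadic_cubes: "countable (dyadic_cubes :: (real ^ 'n) set set)"
proof -
  have "dyadic_cubes = (\<lambda>(i, k). dyadic_cube i k) ` (UNIV \<times> UNIV)"
    by (auto simp: dyadic_cubes_def)
  moreover have "countable ((UNIV :: int set) \<times> (UNIV :: (int ^ 'n) set))"
    by (intro countable_SIGMA countable_vec_int) simp
  ultimately show ?thesis by (metis countable_image)
qed

lemma dyadic_cube_borel: "dyadic_cube i k \<in> sets borel"
proof -
  have "dyadic_cube i k = (\<Inter>j. {x. real_of_int (k $ j) \<le> 2 powi i * x $ j}
      \<inter> {x. 2 powi i * x $ j < real_of_int (k $ j) + 1})"
    by (auto simp: mem_dyadic_cube floor_eq_iff)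
  moreover have "\<dots> \<in> sets borel"
    by (intro sets.finite_INT sets.Int borel_closed closed_Collect_le borel_open open_Collect_less
        continuous_intros) auto
  ultimately show ?thesis by simp
qed

lemma dyadic_cube_bounded: "\<exists>C. compact C \<and> dyadic_cube i k \<subseteq> C"
proof -
  define a b :: "real ^ 'a" where "a = (\<chi> j. k $ j / 2 powi i)" and "b = (\<chi> j. (k $ j + 1) / 2 powi i)"
  have pos: "0 < (2 :: real) powi i" by simp
  have "dyadic_cube i k \<subseteq> cbox a b"
  proof
    fix x assume "x \<in> dyadic_cube i k"
    then have *: "real_of_int (k $ j) \<le> 2 powi i * x $ j" "2 powi i * x $ j \<le> real_of_int (k $ j) + 1" for j
      by (auto simp: mem_dyadic_cube floor_eq_iff less_imp_le)
    have "a $ j \<le> x $ j" "x $ j \<le> b $ j" for j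
      using *[of j] pos by (auto simp: a_def b_def divide_le_eq le_divide_eq mult.commute)
    then show "x \<in> cbox a b" by (simp add: mem_box_cart)
  qed
  then show ?thesis using compact_cbox by blast
qed

lemma radon_measure_dyadic_cube:
  assumes "radon_measure \<mu>" "Q \<in> dyadic_cubes"
  shows "Q \<in> sets \<mu>" "emeasure \<mu> Q < \<infinity>"
proof -
  obtain i k where Q: "Q = dyadic_cube i k" using assms(2) by (auto simp: dyadic_cubes_def)
  obtain C where C: "compact C" "Q \<subseteq> C" using dyadic_cube_bounded Q by blast
  have sets: "sets \<mu> = sets borel" using assms by (simp add: radon_measure_def)
  show "Q \<in> sets \<mu>" by (simp add: sets Q dyadic_cube_borel)
  have "emeasure \<mu> Q \<le> emeasure \<mu> C"
    using C by (intro emeasure_mono) (auto simp: sets borel_compact)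
  also have "\<dots> < \<infinity>" using assms C by (auto simp: radon_measure_def)
  finally show "emeasure \<mu> Q < \<infinity>" .
qed

section \<open>Truncation of the Wolff potential\<close>

definition cube_enum :: "nat \<Rightarrow> (real ^ 'n) set set" where
  "cube_enum n = from_nat_into dyadic_cubes ` {..<n}"

lemma dyadic_cubes_nonempty: "dyadic_cubes \<noteq> {}"
  by (auto simp: dyadic_cubes_def)

lemma finite_cube_enum [simp]: "finite (cube_enum n)"
  by (simp add: cube_enum_def)

lemma incseq_cube_enum: "incseq cube_enum"
  by (auto simp: incseq_def cube_enum_def)

lemma UN_cube_enum: "(\<Union>n. cube_enum n) = (dyadic_cubes :: (real ^ 'n) set set)"
proof -
  have "(\<Union>n. cube_enum n) = range (from_nat_into (dyadic_cubes :: (real ^ 'n) set set))"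
    by (auto simp: cube_enum_def)
  then show ?thesis
    using range_from_nat_into[OF dyadic_cubes_nonempty countable_dyadic_cubes] by simp
qed

lemma cube_enum_subset: "cube_enum n \<subseteq> dyadic_cubes"
  using UN_cube_enum by blast

text \<open>Cubes that are null for either measure are removed so that all averages have positive
  denominators; they carry no mass in the form.\<close>

definition charged_cubes :: "(real ^ 'n) measure \<Rightarrow> (real ^ 'n) measure \<Rightarrow> nat \<Rightarrow> (real ^ 'n) set set" where
  "charged_cubes \<sigma> \<omega> n = {Q \<in> cube_enum n. 0 < measure \<sigma> Q \<and> 0 < measure \<omega> Q}"

lemma charged_cubes_commute: "charged_cubes \<omega> \<sigma> = charged_cubes \<sigma> \<omega>"
  by (auto simp: charged_cubes_def fun_eq_iff)

locale dyadic_weights =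
  fixes \<sigma> \<omega> :: "(real ^ 'n) measure" and K :: "(real ^ 'n) set \<Rightarrow> real"
  assumes radon_\<sigma>: "radon_measure \<sigma>" and radon_\<omega>: "radon_measure \<omega>"
    and K_nonneg: "Q \<in> dyadic_cubes \<Longrightarrow> 0 \<le> K Q"
begin

abbreviation T :: "nat \<Rightarrow> (real ^ 'n) set set" where
  "T \<equiv> charged_cubes \<sigma> \<omega>"

lemma T_subset: "T n \<subseteq> cube_enum n" "T n \<subseteq> dyadic_cubes"
  using cube_enum_subset by (auto simp: charged_cubes_def)

lemma finite_T: "finite (T n)"
  using T_subset(1) finite_cube_enum by (rule finite_subset)

lemma T_mono: "n \<le> m \<Longrightarrow> T n \<subseteq> T m"
  using incseqD[OF incseq_cube_enum] by (auto simp: charged_cubes_def)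

lemma emeasure_\<sigma>: "Q \<in> dyadic_cubes \<Longrightarrow> emeasure \<sigma> Q = ennreal (measure \<sigma> Q)"
  and emeasure_\<omega>: "Q \<in> dyadic_cubes \<Longrightarrow> emeasure \<omega> Q = ennreal (measure \<omega> Q)"
  using radon_measure_dyadic_cube(2)[OF radon_\<sigma>] radon_measure_dyadic_cube(2)[OF radon_\<omega>]
  by (auto intro!: emeasure_eq_ennreal_measure simp flip: less_top)

lemma measure_mono_\<sigma>:
  assumes "Q \<in> dyadic_cubes" "R \<in> dyadic_cubes" "Q \<subseteq> R"
  shows "measure \<sigma> Q \<le> measure \<sigma> R"
  using assms radon_measure_dyadic_cube[OF radon_\<sigma>]
  by (intro measure_mono_fmeasurable) (auto simp: fmeasurable_def)

lemma two_weight_T: "two_weight (T n) \<sigma> \<omega> K"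
proof unfold_locales
  show "finite (T n)" by (rule finite_T)
  show "{} \<notin> T n" by (auto simp: charged_cubes_def)
  fix Q R assume "Q \<in> T n" "R \<in> T n"
  then show "Q \<subseteq> R \<or> R \<subseteq> Q \<or> Q \<inter> R = {}"
    using T_subset by (intro dyadic_cubes_laminar) auto
next
  fix Q assume Q: "Q \<in> T n"
  then have D: "Q \<in> dyadic_cubes" using T_subset by auto
  show "Q \<in> sets \<sigma>" "emeasure \<sigma> Q < \<infinity>" "Q \<in> sets \<omega>" "emeasure \<omega> Q < \<infinity>"
    using radon_measure_dyadic_cube[OF radon_\<sigma> D] radon_measure_dyadic_cube[OF radon_\<omega> D] by auto
  show "0 < measure \<sigma> Q" "0 < measure \<omega> Q" using Q by (auto simp: charged_cubes_def)
  show "0 \<le> K Q" using K_nonneg D by simp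
qed

definition S :: "nat \<Rightarrow> (real ^ 'n) set \<Rightarrow> real" where
  "S n Q = sum (two_weight.mass \<sigma> \<omega> K) (below (T n) Q)"

lemma mass_eq: "two_weight.mass \<sigma> \<omega> K Q = K Q * measure \<sigma> Q * measure \<omega> Q"
  by (rule two_weight.mass_def[OF two_weight_T[of 0]])

lemma S_nonneg: "0 \<le> S n Q"
  unfolding S_def by (rule two_weight.sum_mass_nonneg[OF two_weight_T])

lemma S_mono: "n \<le> m \<Longrightarrow> S n Q \<le> S m Q"
  unfolding S_def using finite_T T_mono[of n m] T_subset(2)[of m] K_nonneg
  by (intro sum_mono2) (auto simp: below_def mass_eq)

lemma sum_cubes_eq_S:
  "(\<Sum>Q' | Q' \<in> cube_enum n \<and> Q' \<subseteq> Q. ennreal (K Q') * emeasure \<omega> Q' * emeasure \<sigma> Q') = ennreal (S n Q)"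
proof -
  have "ennreal (S n Q) = (\<Sum>Q'\<in>below (T n) Q. ennreal (two_weight.mass \<sigma> \<omega> K Q'))"
    unfolding S_def using T_subset(2)[of n] K_nonneg
    by (intro sum_ennreal[symmetric]) (auto simp: below_def mass_eq)
  also have "\<dots> = (\<Sum>Q'\<in>below (T n) Q. ennreal (K Q') * emeasure \<omega> Q' * emeasure \<sigma> Q')"
    using T_subset(2)[of n] K_nonneg
    by (intro sum.cong refl)
       (auto simp: below_def mass_eq emeasure_\<sigma> emeasure_\<omega> ennreal_mult[symmetric] mult_ac)
  also have "\<dots> = (\<Sum>Q' | Q' \<in> cube_enum n \<and> Q' \<subseteq> Q. ennreal (K Q') * emeasure \<omega> Q' * emeasure \<sigma> Q')"
    using cube_enum_subset[of n] T_subset(1)[of n]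
    by (intro sum.mono_neutral_left)
       (auto simp: below_def charged_cubes_def emeasure_\<sigma> emeasure_\<omega> zero_less_measure_iff)
  finally show ?thesis by simp
qed

text \<open>Monotone convergence along the enumeration; cubes that are not charged add nothing to
  the partial sums by \<open>sum_cubes_eq_S\<close>.\<close>

lemma nn_integral_K_bar:
  assumes Q: "Q \<in> dyadic_cubes" and pos: "emeasure \<omega> Q \<noteq> 0"
  shows "(\<integral>\<^sup>+ y\<in>Q. K_bar K \<omega> Q y \<partial>\<sigma>) = (SUP n. ennreal (S n Q) / emeasure \<omega> Q)"
proof -
  define E where "E n = {Q' \<in> cube_enum n. Q' \<subseteq> Q}" for n
  define s where "s n y = (\<Sum>Q'\<in>E n. ennreal (K Q') * emeasure \<omega> Q' * indicator Q' y)" for n y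
  have E: "incseq E" "\<And>n. finite (E n)" "(\<Union>n. E n) = {Q' \<in> dyadic_cubes. Q' \<subseteq> Q}"
    using incseq_cube_enum UN_cube_enum by (auto simp: E_def incseq_def)
  have E_sets: "Q' \<in> sets \<sigma>" if "Q' \<in> E n" for Q' n
    using that cube_enum_subset[of n] radon_measure_dyadic_cube(1)[OF radon_\<sigma>] by (auto simp: E_def)
  have "K_bar K \<omega> Q y * indicator Q y = (SUP n. s n y) / emeasure \<omega> Q" for y
  proof -
    have "K_bar K \<omega> Q y = (SUP n. s n y) / emeasure \<omega> Q"
      unfolding K_bar_def s_def using pos infsum_ennreal_eq_SUP[OF E] by simp
    moreover have "s n y = 0" if "y \<notin> Q" for n
      using that by (auto simp: s_def E_def indicator_def intro!: sum.neutral)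
    ultimately show ?thesis by (cases "y \<in> Q") auto
  qed
  then have "(\<integral>\<^sup>+ y\<in>Q. K_bar K \<omega> Q y \<partial>\<sigma>) = (\<integral>\<^sup>+ y. (SUP n. s n y) / emeasure \<omega> Q \<partial>\<sigma>)"
    by simp
  also have "\<dots> = (\<integral>\<^sup>+ y. (SUP n. s n y) \<partial>\<sigma>) / emeasure \<omega> Q"
    using E_sets by (intro nn_integral_divide borel_measurable_SUP) (auto simp: s_def)
  also have "(\<integral>\<^sup>+ y. (SUP n. s n y) \<partial>\<sigma>) = (SUP n. \<integral>\<^sup>+ y. s n y \<partial>\<sigma>)"
  proof (rule nn_integral_monotone_convergence_SUP)
    show "incseq s"
      using E(1,2) unfolding incseq_def le_fun_def s_def by (intro allI impI sum_mono2) auto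
    show "s n \<in> borel_measurable \<sigma>" for n
      unfolding s_def using E_sets by auto
  qed
  also have "(\<lambda>n. \<integral>\<^sup>+ y. s n y \<partial>\<sigma>) = (\<lambda>n. ennreal (S n Q))"
  proof
    fix n
    have "(\<integral>\<^sup>+ y. s n y \<partial>\<sigma>) = (\<Sum>Q'\<in>E n. ennreal (K Q') * emeasure \<omega> Q' * emeasure \<sigma> Q')"
      unfolding s_def using E_sets
      by (subst nn_integral_sum) (auto intro!: sum.cong nn_integral_cmult_indicator)
    then show "(\<integral>\<^sup>+ y. s n y \<partial>\<sigma>) = ennreal (S n Q)"
      using sum_cubes_eq_S[of n Q] by (simp add: E_def)
  qed
  finally show ?thesis by (simp add: SUP_divide_ennreal)
qed

definition W :: "real \<Rightarrow> nat \<Rightarrow> real ^ 'n \<Rightarrow> real" where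
  "W q n = two_weight.wolff (T n) \<sigma> \<omega> K q"

text \<open>\<open>t n Q\<close> truncates the inner sum at level n. Powers and finite sums commute
  with the increasing suprema, and the diagonal of the two truncations is the Wolff function of the
  charged cubes.\<close>

lemma wolff_potential_eq_SUP:
  assumes q: "1 < q"
  shows "wolff_potential q K \<omega> \<sigma> x = (SUP n. ennreal (W q n x))"
    and "incseq (\<lambda>n. ennreal (W q n x))"
proof -
  define t where "t n Q = ennreal (K Q) * emeasure \<omega> Q *
      ennreal_powr (ennreal (S n Q) / emeasure \<omega> Q) (q - 1) * indicator Q x" for n Q
  have t_mono: "t n Q \<le> t m Q" if "n \<le> m" for n m Q
    unfolding t_def using S_mono[OF that] q
    by (intro mult_right_mono mult_left_mono ennreal_powr_mono divide_right_mono_ennreal ennreal_leI) auto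
  have sum_mono: "sum (t n) (cube_enum m) \<le> sum (t n') (cube_enum m')" if "m \<le> m'" "n \<le> n'" for n n' m m'
  proof -
    have "sum (t n) (cube_enum m) \<le> sum (t n) (cube_enum m')"
      using incseqD[OF incseq_cube_enum that(1)] by (intro sum_mono2) auto
    also have "\<dots> \<le> sum (t n') (cube_enum m')"
      using that(2) t_mono by (intro sum_mono) auto
    finally show ?thesis .
  qed
  have W_eq: "ennreal (W q n x) = sum (t n) (cube_enum n)" for n
  proof -
    interpret tw: two_weight "T n" \<sigma> \<omega> K by (rule two_weight_T)
    have "ennreal (W q n x) = ennreal (\<Sum>Q\<in>T n. tw.wolff_weight q Q * indicator Q x)"
      by (simp add: W_def tw.wolff_def tw.sigma.sum_indicator_eq)
    also have "\<dots> = (\<Sum>Q\<in>T n. ennreal (tw.wolff_weight q Q * indicator Q x))"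
      using tw.wolff_weight_nonneg by (intro sum_ennreal[symmetric]) auto
    also have "\<dots> = (\<Sum>Q\<in>T n. t n Q)"
    proof (rule sum.cong[OF refl])
      fix Q assume Q: "Q \<in> T n"
      then have D: "Q \<in> dyadic_cubes" using T_subset by auto
      have "0 < measure \<omega> Q" using Q by (simp add: charged_cubes_def)
      then have "ennreal (S n Q) / emeasure \<omega> Q = ennreal (S n Q / measure \<omega> Q)"
        using S_nonneg by (simp add: emeasure_\<omega>[OF D] divide_ennreal)
      then show "ennreal (tw.wolff_weight q Q * indicator Q x) = t n Q"
        using S_nonneg[of n Q] K_nonneg[OF D]
        by (simp add: t_def tw.wolff_weight_def emeasure_\<omega>[OF D] ennreal_powr_ennreal ennreal_mult
            S_def[symmetric] indicator_def)
    qed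
    also have "\<dots> = sum (t n) (cube_enum n)"
    proof (rule sum.mono_neutral_left)
      show "\<forall>Q\<in>cube_enum n - T n. t n Q = 0"
      proof
        fix Q assume Q: "Q \<in> cube_enum n - T n"
        then have D: "Q \<in> dyadic_cubes" using cube_enum_subset by auto
        consider "measure \<omega> Q = 0" | "measure \<sigma> Q = 0"
          using Q by (auto simp: charged_cubes_def zero_less_measure_iff)
        then show "t n Q = 0"
        proof cases
          case 2
          \<comment> \<open>A \<sigma>-null cube contains no charged cube, so its inner sum and its
            term vanish.\<close>
          have "below (T n) Q = {}"
          proof (rule ccontr)
            assume "below (T n) Q \<noteq> {}"
            then obtain R where R: "R \<in> T n" "R \<subseteq> Q" by (auto simp: below_def)
            then have "0 < measure \<sigma> R" by (simp add: charged_cubes_def)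
            moreover have "measure \<sigma> R \<le> measure \<sigma> Q"
              using R T_subset(2)[of n] D by (intro measure_mono_\<sigma>) auto
            ultimately show False using 2 by simp
          qed
          then show ?thesis by (simp add: t_def S_def)
        qed (simp add: t_def emeasure_\<omega>[OF D])
      qed
    qed (use T_subset in auto)
    finally show ?thesis .
  qed
  have full: "ennreal (K Q) * emeasure \<omega> Q *
        ennreal_powr (\<integral>\<^sup>+ y\<in>Q. K_bar K \<omega> Q y \<partial>\<sigma>) (q - 1) * indicator Q x = (SUP n. t n Q)"
    if Q: "Q \<in> dyadic_cubes" for Q
  proof (cases "emeasure \<omega> Q = 0")
    case False
    show ?thesis
      unfolding nn_integral_K_bar[OF Q False] t_def using q
      by (simp add: ennreal_powr_SUP SUP_mult_left_ennreal SUP_mult_right_ennreal)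
  qed (simp add: t_def)
  have "wolff_potential q K \<omega> \<sigma> x = (\<Sum>\<^sub>\<infinity>Q\<in>dyadic_cubes. SUP n. t n Q)"
    unfolding wolff_potential_def using full by (intro infsum_cong) auto
  also have "\<dots> = (SUP m. \<Sum>Q\<in>cube_enum m. SUP n. t n Q)"
    using incseq_cube_enum UN_cube_enum by (intro infsum_ennreal_eq_SUP) auto
  also have "\<dots> = (SUP m. SUP n. \<Sum>Q\<in>cube_enum m. t n Q)"
    using t_mono by (subst ennreal_SUP_sum) (auto simp: incseq_def)
  also have "\<dots> = (SUP n. \<Sum>Q\<in>cube_enum n. t n Q)"
    by (rule SUP_SUP_diagonal) (rule sum_mono)
  finally show "wolff_potential q K \<omega> \<sigma> x = (SUP n. ennreal (W q n x))"
    by (simp add: W_eq)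
  show "incseq (\<lambda>n. ennreal (W q n x))"
    unfolding W_eq incseq_def using sum_mono by blast
qed

text \<open>By monotone convergence the norm bound for the full potential is a uniform bound over
  the truncations.\<close>

lemma wolff_norm_le_iff:
  assumes "1 < q" "0 < r" "0 \<le> C"
  shows "eLp_norm r \<sigma> (\<lambda>x. ennreal_powr (wolff_potential q K \<omega> \<sigma> x) (1 / q)) \<le> ennreal C
    \<longleftrightarrow> (\<forall>n. (\<integral>x. W q n x powr (r / q) \<partial>\<sigma>) \<le> C powr r)"
proof -
  have W: "Lp_nonneg s \<sigma> (W q n)" for n s
    unfolding W_def by (rule two_weight.Lp_nonneg_wolff[OF two_weight_T])
  note W0 = Lp_nonnegD(2)[OF W]
  have rq: "0 < r / q" using assms by simp
  have "(\<integral>\<^sup>+ x. ennreal_powr (ennreal_powr (wolff_potential q K \<omega> \<sigma> x) (1 / q)) r \<partial>\<sigma>)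
      = (\<integral>\<^sup>+ x. (SUP n. ennreal (W q n x powr (r / q))) \<partial>\<sigma>)"
    using W0 rq
    by (simp add: ennreal_powr_powr wolff_potential_eq_SUP(1)[OF assms(1)] ennreal_powr_SUP
        ennreal_powr_ennreal)
  also have "\<dots> = (SUP n. \<integral>\<^sup>+ x. ennreal (W q n x powr (r / q)) \<partial>\<sigma>)"
  proof (rule nn_integral_monotone_convergence_SUP)
    show "incseq (\<lambda>n x. ennreal (W q n x powr (r / q)))"
      using wolff_potential_eq_SUP(2)[OF assms(1)] W0 rq
      by (auto simp: incseq_def le_fun_def intro!: ennreal_leI powr_mono2)
    show "(\<lambda>x. ennreal (W q n x powr (r / q))) \<in> borel_measurable \<sigma>" for n
      using Lp_nonnegD(3)[OF W] by (intro measurable_compose[OF _ measurable_ennreal]) auto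
  qed
  also have "\<dots> = (SUP n. ennreal (\<integral>x. W q n x powr (r / q) \<partial>\<sigma>))"
    using Lp_nonnegD(3)[OF W] by (intro SUP_cong refl nn_integral_eq_integral) auto
  finally show ?thesis
    using assms by (simp add: eLp_norm_le_iff SUP_le_iff)
qed

lemma swap: "dyadic_weights \<omega> \<sigma> K"
  by unfold_locales (auto intro: radon_\<sigma> radon_\<omega> K_nonneg)

lemma wolff_condition_iff:
  assumes "1 < q" "q < p" "0 < r" "0 \<le> C"
  shows "wolff_condition p q r K \<sigma> \<omega> C \<longleftrightarrow>
    (\<forall>n. (\<integral>x. two_weight.wolff (T n) \<sigma> \<omega> K q x powr (r / q) \<partial>\<sigma>) \<le> C powr r) \<and>
    (\<forall>n. (\<integral>x. two_weight.wolff (T n) \<omega> \<sigma> K (dual_exponent p) x powr (r / dual_exponent p) \<partial>\<omega>) \<le> C powr r)"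
proof -
  interpret sw: dyadic_weights \<omega> \<sigma> K by (rule swap)
  show ?thesis
    unfolding wolff_condition_def using assms dual_exponent_gt_1[of p]
    by (simp add: wolff_norm_le_iff sw.wolff_norm_le_iff W_def sw.W_def charged_cubes_commute[of \<omega> \<sigma>])
qed

end

section \<open>From truncated families to all dyadic cubes\<close>

lemma Lp_spaceD:
  assumes "f \<in> Lp_space p M" "0 < p"
  shows "Lp_nonneg p M (\<lambda>x. \<bar>f x\<bar>)"
    and "Lp_norm p M f = ennreal ((\<integral>x. \<bar>f x\<bar> powr p \<partial>M) powr (1 / p))"
proof -
  have f: "f \<in> borel_measurable M" "Lp_norm p M f < \<infinity>"
    using assms by (auto simp: Lp_space_def)
  have "(\<integral>\<^sup>+ x. ennreal (\<bar>f x\<bar> powr p) \<partial>M) \<noteq> \<infinity>"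
    using f(2) by (auto simp: Lp_norm_def eLp_norm_def ennreal_powr_ennreal)
  then have int: "integrable M (\<lambda>x. \<bar>f x\<bar> powr p)"
    using f(1) by (intro integrableI_nonneg) (auto simp: less_top)
  then show "Lp_nonneg p M (\<lambda>x. \<bar>f x\<bar>)"
    using f(1) by (simp add: Lp_nonneg_def)
  show "Lp_norm p M f = ennreal ((\<integral>x. \<bar>f x\<bar> powr p \<partial>M) powr (1 / p))"
    using int by (simp add: Lp_norm_def eLp_norm_def ennreal_powr_ennreal nn_integral_eq_integral
        Bochner_Integration.integral_nonneg)
qed

lemma Lp_nonneg_Lp_space:
  assumes "Lp_nonneg p M f"
  shows "f \<in> Lp_space p M"
proof -
  have "(\<integral>\<^sup>+ x. ennreal (\<bar>f x\<bar> powr p) \<partial>M) = ennreal (\<integral>x. f x powr p \<partial>M)"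
    using Lp_nonnegD[OF assms] by (simp add: nn_integral_eq_integral)
  then show ?thesis
    using Lp_nonnegD(1)[OF assms]
    by (simp add: Lp_space_def Lp_norm_def eLp_norm_def ennreal_powr_ennreal
        Bochner_Integration.integral_nonneg)
qed

context dyadic_weights
begin

text \<open>A \<sigma>-null cube has a zero term, but an \<omega>-null cube need not. The hypothesis
  keeps x out of the latter, which by \<open>AE_charged\<close> holds for \<omega>-almost every
  x.\<close>

lemma sum_T_term_eq:
  assumes "\<And>Q. Q \<in> dyadic_cubes \<Longrightarrow> x \<in> Q \<Longrightarrow> measure \<omega> Q \<noteq> 0"
  shows "(\<Sum>Q\<in>cube_enum n. T_term K \<sigma> f x Q) = two_weight.op (T n) \<sigma> K f x"
proof -
  interpret tw: two_weight "T n" \<sigma> \<omega> K by (rule two_weight_T)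
  have "tw.op f x = (\<Sum>Q\<in>T n. T_term K \<sigma> f x Q)"
    unfolding tw.op_def T_term_def
    using tw.sigma.sum_indicator_eq[of "\<lambda>Q. K Q * (LINT y:Q|\<sigma>. f y)" x] by simp
  also have "\<dots> = (\<Sum>Q\<in>cube_enum n. T_term K \<sigma> f x Q)"
  proof (rule sum.mono_neutral_left)
    show "\<forall>Q\<in>cube_enum n - T n. T_term K \<sigma> f x Q = 0"
    proof
      fix Q assume Q: "Q \<in> cube_enum n - T n"
      then have D: "Q \<in> dyadic_cubes" using cube_enum_subset by auto
      consider "x \<notin> Q" | "measure \<sigma> Q = 0"
        using Q assms[OF D] by (auto simp: charged_cubes_def zero_less_measure_iff)
      then show "T_term K \<sigma> f x Q = 0"
      proof cases
        case 2
        then have "emeasure \<sigma> Q = 0" by (simp add: emeasure_\<sigma>[OF D])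
        then have "AE y in \<sigma>. y \<notin> Q"
          using radon_measure_dyadic_cube(1)[OF radon_\<sigma> D] by (intro AE_not_in null_setsI)
        then have "AE y in \<sigma>. indicator Q y *\<^sub>R f y = 0"
          by eventually_elim simp
        then have "(LINT y:Q|\<sigma>. f y) = 0"
          unfolding set_lebesgue_integral_def by (rule integral_eq_zero_AE)
        then show ?thesis by (simp add: T_term_def)
      qed (simp add: T_term_def)
    qed
  qed (use T_subset in auto)
  finally show ?thesis by simp
qed

lemma AE_charged: "AE x in \<omega>. \<forall>Q\<in>dyadic_cubes. x \<in> Q \<longrightarrow> measure \<omega> Q \<noteq> 0"
proof (subst AE_ball_countable[OF countable_dyadic_cubes], intro ballI)
  fix Q :: "(real ^ 'n) set" assume D: "Q \<in> dyadic_cubes"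
  show "AE x in \<omega>. x \<in> Q \<longrightarrow> measure \<omega> Q \<noteq> 0"
  proof (cases "measure \<omega> Q = 0")
    case True
    then have "AE y in \<omega>. y \<notin> Q"
      using radon_measure_dyadic_cube(1)[OF radon_\<omega> D] by (intro AE_not_in null_setsI) (auto simp: emeasure_\<omega>[OF D])
    then show ?thesis by eventually_elim simp
  qed simp
qed

lemma abs_T_term_le:
  assumes "Q \<in> dyadic_cubes"
  shows "\<bar>T_term K \<sigma> f x Q\<bar> \<le> T_term K \<sigma> (\<lambda>y. \<bar>f y\<bar>) x Q"
proof -
  have "\<bar>LINT y:Q|\<sigma>. f y\<bar> \<le> (\<integral>y. \<bar>indicator Q y *\<^sub>R f y\<bar> \<partial>\<sigma>)"
    unfolding set_lebesgue_integral_def by (rule integral_abs_bound)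
  also have "\<dots> = (LINT y:Q|\<sigma>. \<bar>f y\<bar>)"
    by (simp add: set_lebesgue_integral_def abs_mult)
  finally show ?thesis
    using K_nonneg[OF assms] by (auto simp: T_term_def abs_mult indicator_def intro!: mult_left_mono)
qed

text \<open>The supremum V of the truncations for the absolute value of f dominates the series of
  absolute values almost everywhere. The uniform bound passes to V by monotone convergence, so V is
  finite almost everywhere, giving both convergence and the norm bound.\<close>

lemma T_op_bound:
  assumes q: "1 < q" and B: "0 \<le> B"
    and bound: "\<And>n. (\<integral>x. two_weight.op (T n) \<sigma> K (\<lambda>x. \<bar>f x\<bar>) x powr q \<partial>\<omega>) \<le> B powr q"
  shows "AE x in \<omega>. (\<lambda>Q. \<bar>T_term K \<sigma> f x Q\<bar>) summable_on dyadic_cubes"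
    and "Lp_norm q \<omega> (T_op K \<sigma> f) \<le> ennreal B"
proof -
  define h where "h n x = two_weight.op (T n) \<sigma> K (\<lambda>x. \<bar>f x\<bar>) x" for n x
  define V where "V x = (SUP n. ennreal (h n x))" for x
  have h: "Lp_nonneg s \<omega> (h n)" for n s
    unfolding h_def[abs_def] by (rule two_weight.Lp_nonneg_op[OF two_weight_T]) simp
  note h0 = Lp_nonnegD(2)[OF h]
  have h_mono: "h n x \<le> h m x" if "n \<le> m" for n m x
    unfolding h_def two_weight.op_def[OF two_weight_T]
    using T_mono[OF that] finite_T[of m] T_subset(2)[of m] K_nonneg
    by (intro sum_mono2)
       (auto simp: containing_def set_lebesgue_integral_def
         intro!: mult_nonneg_nonneg Bochner_Integration.integral_nonneg)
  have powr_V: "ennreal_powr (V x) q = (SUP n. ennreal (h n x powr q))" for x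
    using q h0 by (simp add: V_def ennreal_powr_SUP ennreal_powr_ennreal)
  have meas: "(\<lambda>x. ennreal (h n x powr q)) \<in> borel_measurable \<omega>" for n
    using Lp_nonnegD(3)[OF h] by (intro measurable_compose[OF _ measurable_ennreal]) auto
  have "(\<integral>\<^sup>+ x. ennreal_powr (V x) q \<partial>\<omega>) = (SUP n. \<integral>\<^sup>+ x. ennreal (h n x powr q) \<partial>\<omega>)"
    unfolding powr_V
  proof (rule nn_integral_monotone_convergence_SUP)
    show "incseq (\<lambda>n x. ennreal (h n x powr q))"
      using h_mono h0 q by (auto simp: incseq_def le_fun_def intro!: ennreal_leI powr_mono2)
  qed (rule meas)
  also have "\<dots> \<le> ennreal (B powr q)"
  proof (rule SUP_least)
    fix n
    have "(\<integral>\<^sup>+ x. ennreal (h n x powr q) \<partial>\<omega>) = ennreal (\<integral>x. h n x powr q \<partial>\<omega>)"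
      using Lp_nonnegD(3)[OF h] by (intro nn_integral_eq_integral) auto
    then show "(\<integral>\<^sup>+ x. ennreal (h n x powr q) \<partial>\<omega>) \<le> ennreal (B powr q)"
      using bound[of n] by (simp add: h_def ennreal_leI)
  qed
  finally have int_V: "(\<integral>\<^sup>+ x. ennreal_powr (V x) q \<partial>\<omega>) \<le> ennreal (B powr q)" .
  have "AE x in \<omega>. ennreal_powr (V x) q \<noteq> \<infinity>"
  proof (rule nn_integral_PInf_AE)
    show "(\<lambda>x. ennreal_powr (V x) q) \<in> borel_measurable \<omega>"
      unfolding powr_V using meas by (intro borel_measurable_SUP) auto
    show "(\<integral>\<^sup>+ x. ennreal_powr (V x) q \<partial>\<omega>) \<noteq> \<infinity>" using int_V by (auto simp: top_unique)
  qed
  then have fin: "AE x in \<omega>. V x \<noteq> \<infinity> \<and> (\<forall>Q\<in>dyadic_cubes. x \<in> Q \<longrightarrow> measure \<omega> Q \<noteq> 0)"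
    using AE_charged by eventually_elim (auto simp: ennreal_powr_def)
  have key: "(\<lambda>Q. \<bar>T_term K \<sigma> f x Q\<bar>) summable_on dyadic_cubes \<and> ennreal \<bar>T_op K \<sigma> f x\<bar> \<le> V x"
    if x: "V x \<noteq> \<infinity>" "\<forall>Q\<in>dyadic_cubes. x \<in> Q \<longrightarrow> measure \<omega> Q \<noteq> 0" for x
  proof -
    obtain v where v: "V x = ennreal v" "0 \<le> v" using x(1) by (cases "V x") auto
    have "(\<Sum>\<^sub>\<infinity>Q\<in>dyadic_cubes. ennreal \<bar>T_term K \<sigma> f x Q\<bar>) = (SUP n. \<Sum>Q\<in>cube_enum n. ennreal \<bar>T_term K \<sigma> f x Q\<bar>)"
      using incseq_cube_enum UN_cube_enum by (intro infsum_ennreal_eq_SUP) auto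
    also have "\<dots> \<le> V x"
      unfolding V_def
    proof (rule SUP_mono')
      fix n
      have "(\<Sum>Q\<in>cube_enum n. ennreal \<bar>T_term K \<sigma> f x Q\<bar>) = ennreal (\<Sum>Q\<in>cube_enum n. \<bar>T_term K \<sigma> f x Q\<bar>)"
        by (rule sum_ennreal) simp
      also have "\<dots> \<le> ennreal (\<Sum>Q\<in>cube_enum n. T_term K \<sigma> (\<lambda>y. \<bar>f y\<bar>) x Q)"
        using cube_enum_subset[of n] by (intro ennreal_leI sum_mono abs_T_term_le) auto
      also have "(\<Sum>Q\<in>cube_enum n. T_term K \<sigma> (\<lambda>y. \<bar>f y\<bar>) x Q) = h n x"
        unfolding h_def using x(2) by (intro sum_T_term_eq) auto
      finally show "(\<Sum>Q\<in>cube_enum n. ennreal \<bar>T_term K \<sigma> f x Q\<bar>) \<le> ennreal (h n x)" .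
    qed
    finally have le_V: "(\<Sum>\<^sub>\<infinity>Q\<in>dyadic_cubes. ennreal \<bar>T_term K \<sigma> f x Q\<bar>) \<le> V x" .
    have fin_le: "(\<Sum>Q\<in>F. \<bar>T_term K \<sigma> f x Q\<bar>) \<le> v" if "finite F" "F \<subseteq> dyadic_cubes" for F
    proof -
      have "ennreal (\<Sum>Q\<in>F. \<bar>T_term K \<sigma> f x Q\<bar>) = (\<Sum>Q\<in>F. ennreal \<bar>T_term K \<sigma> f x Q\<bar>)"
        by (rule sum_ennreal[symmetric]) simp
      also have "\<dots> \<le> (SUP F\<in>{F. finite F \<and> F \<subseteq> dyadic_cubes}. \<Sum>Q\<in>F. ennreal \<bar>T_term K \<sigma> f x Q\<bar>)"
        using that by (intro SUP_upper) auto
      also have "\<dots> = (\<Sum>\<^sub>\<infinity>Q\<in>dyadic_cubes. ennreal \<bar>T_term K \<sigma> f x Q\<bar>)"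
        by (rule nonneg_infsum_complete[symmetric]) simp
      also have "\<dots> \<le> ennreal v" using le_V v by simp
      finally show ?thesis using v by simp
    qed
    have summable: "(\<lambda>Q. \<bar>T_term K \<sigma> f x Q\<bar>) summable_on dyadic_cubes"
      using fin_le by (intro nonneg_bdd_above_summable_on) (auto simp: bdd_above_def)
    have "\<bar>T_op K \<sigma> f x\<bar> \<le> (\<Sum>\<^sub>\<infinity>Q\<in>dyadic_cubes. \<bar>T_term K \<sigma> f x Q\<bar>)"
      unfolding T_op_def using norm_infsum_bound[of "T_term K \<sigma> f x" dyadic_cubes] summable by simp
    also have "\<dots> \<le> v"
      using summable fin_le by (intro infsum_le_finite_sums) auto
    finally show ?thesis using summable v by (simp add: ennreal_leI)
  qed
  show "AE x in \<omega>. (\<lambda>Q. \<bar>T_term K \<sigma> f x Q\<bar>) summable_on dyadic_cubes"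
    using fin by eventually_elim (use key in blast)
  have "(\<integral>\<^sup>+ x. ennreal_powr (ennreal \<bar>T_op K \<sigma> f x\<bar>) q \<partial>\<omega>) \<le> (\<integral>\<^sup>+ x. ennreal_powr (V x) q \<partial>\<omega>)"
  proof (rule nn_integral_mono_AE)
    show "AE x in \<omega>. ennreal_powr (ennreal \<bar>T_op K \<sigma> f x\<bar>) q \<le> ennreal_powr (V x) q"
      using fin by eventually_elim (use key q in \<open>auto intro!: ennreal_powr_mono\<close>)
  qed
  then show "Lp_norm q \<omega> (T_op K \<sigma> f) \<le> ennreal B"
    using int_V q B by (simp add: Lp_norm_def eLp_norm_le_iff)
qed

lemma trace_of_wolff:
  assumes exps: "1 < q" "q < p" "0 < r" "1 / q = 1 / r + 1 / p" and C: "0 < C"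
    and wolff: "wolff_condition p q r K \<sigma> \<omega> C"
  shows "trace_inequality p q K \<sigma> \<omega> ((3 * (2 * form_const p q) powr q) powr (1 / q) * C)"
  unfolding trace_inequality_def
proof
  define A where "A = (3 * (2 * form_const p q) powr q) powr (1 / q)"
  fix f assume "f \<in> Lp_space p \<sigma>"
  note f = Lp_spaceD[OF this]
  have p: "0 < p" using exps by simp
  define I where "I = (\<integral>x. \<bar>f x\<bar> powr p \<partial>\<sigma>)"
  define \<nu> where "\<nu> = I powr (1 / p)"
  have I0: "0 \<le> I" unfolding I_def by (auto intro!: Bochner_Integration.integral_nonneg)
  have A: "0 < A" using form_const_pos[of q p] exps(1,2) by (simp add: A_def)
  note W = wolff[unfolded wolff_condition_iff[OF exps(1,2,3) less_imp_le[OF C]]]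
  \<comment> \<open>The finite bound asks for a positive l, while the norm \<nu> of f may be zero; l
    > \<nu> is kept free and lowered to \<nu> at the end.\<close>
  have bound: "(\<integral>x. two_weight.op (T n) \<sigma> K (\<lambda>x. \<bar>f x\<bar>) x powr q \<partial>\<omega>) \<le> (A * C * l) powr q"
    if l: "\<nu> < l" for l n
  proof -
    interpret tw: two_weight "T n" \<sigma> \<omega> K by (rule two_weight_T)
    have "0 \<le> \<nu>" by (simp add: \<nu>_def)
    then have l0: "0 < l" using l by simp
    have "I = \<nu> powr p" using I0 p by (simp add: \<nu>_def powr_powr)
    also have "\<dots> \<le> l powr p" using l p by (intro powr_mono2) (auto simp: \<nu>_def)
    finally have "(\<integral>x. tw.op (\<lambda>x. \<bar>f x\<bar>) x powr q \<partial>\<omega>) \<le> 3 * (2 * form_const p q) powr q * (C * l) powr q"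
      using W f(1)[OF p] exps C l0 by (intro tw.integral_op_bound[where r = r]) (auto simp: I_def)
    also have "\<dots> = (A * (C * l)) powr q"
      using form_const_pos[of q p] exps(1,2) C l0 by (simp add: A_def powr_powr powr_mult)
    finally show ?thesis by (simp add: mult.assoc)
  qed
  have pos: "0 \<le> A * C * l" if "\<nu> < l" for l
  proof -
    have "0 \<le> \<nu>" by (simp add: \<nu>_def)
    then show ?thesis using A C that by simp
  qed
  have op_le: "Lp_norm q \<omega> (T_op K \<sigma> f) \<le> ennreal (A * C * l)" if "\<nu> < l" for l
    using T_op_bound(2)[OF exps(1) pos[OF that] bound[OF that]] .
  have "Lp_norm q \<omega> (T_op K \<sigma> f) \<le> ennreal (A * C * \<nu>)"
  proof -
    obtain t where t: "Lp_norm q \<omega> (T_op K \<sigma> f) = ennreal t" "0 \<le> t"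
      using op_le[of "\<nu> + 1"] by (cases "Lp_norm q \<omega> (T_op K \<sigma> f)") (auto simp: top_unique)
    have "t / (A * C) \<le> \<nu>"
    proof (rule dense_ge)
      fix l assume l: "\<nu> < l"
      then have "t \<le> A * C * l" using op_le[OF l] t pos[OF l] by simp
      then show "t / (A * C) \<le> l" using A C by (simp add: field_simps)
    qed
    then have "t \<le> A * C * \<nu>" using A C by (simp add: field_simps)
    then show ?thesis using t by (simp add: ennreal_leI)
  qed
  also have "ennreal (A * C * \<nu>) = ennreal (A * C) * Lp_norm p \<sigma> f"
    using f(2)[OF p] A C by (simp add: \<nu>_def I_def ennreal_mult)
  finally show "(AE x in \<omega>. (\<lambda>Q. \<bar>T_term K \<sigma> f x Q\<bar>) summable_on dyadic_cubes) \<and>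
      Lp_norm q \<omega> (T_op K \<sigma> f)
        \<le> ennreal ((3 * (2 * form_const p q) powr q) powr (1 / q) * C) * Lp_norm p \<sigma> f"
    using T_op_bound(1)[OF exps(1) pos[of "\<nu> + 1"] bound[of "\<nu> + 1"]] by (simp add: A_def)
qed

text \<open>T f dominates its truncation almost everywhere, and Young's inequality is applied to g
  and T f / C. The result is inhomogeneous, but later scaling of the test functions makes up for
  this.\<close>

lemma form_of_trace:
  assumes exps: "1 < q" "q < p" and C: "0 < C"
    and trace: "trace_inequality p q K \<sigma> \<omega> C"
    and f: "Lp_nonneg p \<sigma> f" and g: "Lp_nonneg (dual_exponent q) \<omega> g"
  shows "two_weight.form (T n) \<sigma> \<omega> K f g
    \<le> C * (1 + (\<integral>x. f x powr p \<partial>\<sigma>) + (\<integral>x. g x powr dual_exponent q \<partial>\<omega>))"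
proof -
  interpret tw: two_weight "T n" \<sigma> \<omega> K by (rule two_weight_T)
  define I where "I = (\<integral>x. f x powr p \<partial>\<sigma>)"
  have p: "0 < p" using exps by simp
  have I0: "0 \<le> I" unfolding I_def by (auto intro!: Bochner_Integration.integral_nonneg)
  note f0 = Lp_nonnegD(2)[OF f]
  note fL = Lp_nonneg_Lp_space[OF f]
  note h = tw.Lp_nonneg_op[of f, OF f0]
  have sum: "AE x in \<omega>. (\<lambda>Q. \<bar>T_term K \<sigma> f x Q\<bar>) summable_on dyadic_cubes"
    and norm: "Lp_norm q \<omega> (T_op K \<sigma> f) \<le> ennreal C * Lp_norm p \<sigma> f"
    using trace fL by (auto simp: trace_inequality_def)
  have "ennreal C * Lp_norm p \<sigma> f = ennreal (C * I powr (1 / p))"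
    using Lp_spaceD(2)[OF fL p] f0 C by (simp add: I_def ennreal_mult)
  then have T_op_le: "(\<integral>\<^sup>+ x. ennreal (\<bar>T_op K \<sigma> f x\<bar> powr q) \<partial>\<omega>) \<le> ennreal ((C * I powr (1 / p)) powr q)"
    using norm exps C by (simp add: Lp_norm_def eLp_norm_le_iff ennreal_powr_ennreal)
  have op_le: "AE x in \<omega>. tw.op f x \<le> \<bar>T_op K \<sigma> f x\<bar>"
    using sum AE_charged
  proof eventually_elim
    case (elim x)
    have nonneg: "0 \<le> T_term K \<sigma> f x Q" if "Q \<in> dyadic_cubes" for Q
      using abs_T_term_le[OF that, of f x] f0 by simp
    have "(\<lambda>Q. T_term K \<sigma> f x Q) summable_on dyadic_cubes"
      using elim(1) nonneg by (subst summable_on_cong[where g = "\<lambda>Q. \<bar>T_term K \<sigma> f x Q\<bar>"]) auto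
    then have "(\<Sum>Q\<in>cube_enum n. T_term K \<sigma> f x Q) \<le> T_op K \<sigma> f x"
      unfolding T_op_def using cube_enum_subset nonneg by (intro finite_sum_le_infsum) auto
    moreover have "(\<Sum>Q\<in>cube_enum n. T_term K \<sigma> f x Q) = tw.op f x"
      using elim(2) by (intro sum_T_term_eq) auto
    ultimately show ?case by simp
  qed
  have "ennreal (\<integral>x. tw.op f x powr q \<partial>\<omega>) = (\<integral>\<^sup>+ x. ennreal (tw.op f x powr q) \<partial>\<omega>)"
    using Lp_nonnegD(3)[OF h] by (intro nn_integral_eq_integral[symmetric]) auto
  also have "\<dots> \<le> (\<integral>\<^sup>+ x. ennreal (\<bar>T_op K \<sigma> f x\<bar> powr q) \<partial>\<omega>)"
  proof (rule nn_integral_mono_AE)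
    show "AE x in \<omega>. ennreal (tw.op f x powr q) \<le> ennreal (\<bar>T_op K \<sigma> f x\<bar> powr q)"
      using op_le
      by eventually_elim (use Lp_nonnegD(2)[OF h] exps in \<open>auto intro!: ennreal_leI powr_mono2\<close>)
  qed
  also note T_op_le
  finally have op_int: "(\<integral>x. tw.op f x powr q \<partial>\<omega>) \<le> C powr q * I powr (q / p)"
    using C I0 by (simp add: powr_mult powr_powr)
  define c where "c = 1 / C"
  have c: "0 < c" "C * c = 1" using C by (auto simp: c_def)
  note ch = Lp_nonneg_mult[OF h, of c]
  have "(\<integral>x. (c * tw.op f x) powr q \<partial>\<omega>) = c powr q * (\<integral>x. tw.op f x powr q \<partial>\<omega>)"
    using ch(2) c by simp
  also have "\<dots> \<le> c powr q * (C powr q * I powr (q / p))"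
    using op_int by (intro mult_left_mono) auto
  also have "\<dots> = (C * c) powr q * I powr (q / p)"
    by (simp add: powr_mult)
  also have "\<dots> = I powr (q / p)" by (simp add: c)
  \<comment> \<open>Since q < p, the power q/p is at most 1 or at most I; this is the source of the
    additive 1.\<close>
  also have "\<dots> \<le> 1 + I"
  proof (cases "I \<le> 1")
    case True
    then have "I powr (q / p) \<le> 1" using I0 exps by (intro powr_le1) auto
    then show ?thesis using I0 by simp
  next
    case False
    then have "I powr (q / p) \<le> I powr 1" using exps by (intro powr_mono) auto
    then show ?thesis using False by simp
  qed
  finally have ch_le: "(\<integral>x. (c * tw.op f x) powr q \<partial>\<omega>) \<le> 1 + I" .
  have q': "1 < dual_exponent q" using exps by (simp add: dual_exponent_gt_1)
  have g_int: "set_integrable \<omega> Q g" if "Q \<in> T n" for Q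
    using tw.omega.Lp_nonneg_set_integrable[OF q' g that] .
  have form: "integrable \<omega> (\<lambda>x. g x * tw.op f x)" "tw.form f g = (\<integral>x. g x * tw.op f x \<partial>\<omega>)"
    using tw.form_eq_integral[of g f] g_int by auto
  have "c * tw.form f g = (\<integral>x. g x * (c * tw.op f x) \<partial>\<omega>)"
    using form by (simp add: mult.left_commute)
  also have "\<dots> \<le> (\<integral>x. g x powr dual_exponent q + (c * tw.op f x) powr q \<partial>\<omega>)"
  proof (rule integral_mono)
    show "integrable \<omega> (\<lambda>x. g x * (c * tw.op f x))"
      using form(1) by (simp add: mult.left_commute)
    show "integrable \<omega> (\<lambda>x. g x powr dual_exponent q + (c * tw.op f x) powr q)"
      using Lp_nonnegD(3)[OF g] Lp_nonnegD(3)[OF ch(1)] c by auto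
    show "g x * (c * tw.op f x) \<le> g x powr dual_exponent q + (c * tw.op f x) powr q" for x
      using Lp_nonnegD(2)[OF g] Lp_nonnegD(2)[OF h] c q' exps inverse_dual_exponent[of q]
      by (intro young_le) auto
  qed
  also have "\<dots> = (\<integral>x. g x powr dual_exponent q \<partial>\<omega>) + (\<integral>x. (c * tw.op f x) powr q \<partial>\<omega>)"
    using Lp_nonnegD(3)[OF g] Lp_nonnegD(3)[OF ch(1)] c by (intro Bochner_Integration.integral_add) auto
  finally have "c * tw.form f g \<le> 1 + I + (\<integral>x. g x powr dual_exponent q \<partial>\<omega>)"
    using ch_le by simp
  then show ?thesis using C by (simp add: c_def I_def field_simps)
qed

text \<open>The form is symmetric under exchanging the measures, so its bound yields both Wolff
  conditions, each with its own test scaling. N dominates both constants, and its power 1/r undoes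
  the r-th power in the integrals.\<close>

lemma wolff_of_trace:
  assumes exps: "1 < q" "q < p" "0 < r" "1 / q = 1 / r + 1 / p" and C: "0 < C"
    and trace: "trace_inequality p q K \<sigma> \<omega> C"
    and \<alpha>\<beta>: "0 < \<alpha>" "0 < \<beta>"
      "\<alpha> powr p * (doob_const (p / q) * (1 + doob_const q)) + \<beta> powr dual_exponent q \<le> \<alpha> * \<beta> / 2"
    and \<alpha>\<beta>': "0 < \<alpha>'" "0 < \<beta>'"
      "\<alpha>' powr dual_exponent q * (doob_const (dual_exponent q / dual_exponent p) * (1 + doob_const (dual_exponent p)))
        + \<beta>' powr p \<le> \<alpha>' * \<beta>' / 2"
    and N: "(1 + doob_const q) * (2 / (\<alpha> * \<beta>)) \<le> N"
      "(1 + doob_const (dual_exponent p)) * (2 / (\<alpha>' * \<beta>')) \<le> N"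
  shows "wolff_condition p q r K \<sigma> \<omega> (N powr (1 / r) * C)"
proof -
  define p' q' where "p' = dual_exponent p" "q' = dual_exponent q"
  note swap_exps = dual_exponents_swap[OF exps(1,2,4), folded p'_q'_def]
  have p'': "dual_exponent p' = p" using exps by (simp add: p'_q'_def dual_exponent_dual_exponent)
  have "0 \<le> (1 + doob_const q) * (2 / (\<alpha> * \<beta>))"
    using doob_const_pos[of q] exps \<alpha>\<beta>(1,2) by (intro mult_nonneg_nonneg) auto
  then have N0: "0 \<le> N" using N by linarith
  have NC: "(N powr (1 / r) * C) powr r = N * C powr r"
    using exps N0 C by (simp add: powr_mult powr_powr)
  note form = form_of_trace[OF exps(1,2) C trace]
  have W1: "(\<integral>x. two_weight.wolff (T n) \<sigma> \<omega> K q x powr (r / q) \<partial>\<sigma>) \<le> N * C powr r" for n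
  proof -
    interpret tw: two_weight "T n" \<sigma> \<omega> K by (rule two_weight_T)
    have "(\<integral>x. tw.wolff q x powr (r / q) \<partial>\<sigma>) \<le> (1 + doob_const q) * (2 / (\<alpha> * \<beta>)) * C powr r"
      by (rule tw.integral_wolff_bound[OF exps(1,2,4) C form \<alpha>\<beta>])
    also have "\<dots> \<le> N * C powr r" using N by (intro mult_right_mono) auto
    finally show ?thesis .
  qed
  have W2: "(\<integral>x. two_weight.wolff (T n) \<omega> \<sigma> K p' x powr (r / p') \<partial>\<omega>) \<le> N * C powr r" for n
  proof -
    interpret tw: two_weight "T n" \<sigma> \<omega> K by (rule two_weight_T)
    interpret sw: two_weight "T n" \<omega> \<sigma> K by (rule tw.swap)
    have "(\<integral>x. sw.wolff p' x powr (r / p') \<partial>\<omega>) \<le> (1 + doob_const p') * (2 / (\<alpha>' * \<beta>')) * C powr r"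
    proof (rule sw.integral_wolff_bound[OF swap_exps C])
      fix g f assume "Lp_nonneg q' \<omega> g" "Lp_nonneg (dual_exponent p') \<sigma> f"
      then show "sw.form g f \<le> C * (1 + (\<integral>x. g x powr q' \<partial>\<omega>) + (\<integral>x. f x powr dual_exponent p' \<partial>\<sigma>))"
        using form[of f g n] p'' by (simp add: tw.swap_form p'_q'_def algebra_simps)
    qed (use \<alpha>\<beta>' in \<open>simp_all add: p'' flip: p'_q'_def\<close>)
    also have "\<dots> \<le> N * C powr r" using N by (intro mult_right_mono) (auto simp: p'_q'_def)
    finally show ?thesis .
  qed
  show ?thesis
    using W1 W2 exps C by (subst wolff_condition_iff) (auto simp: NC p'_q'_def)
qed

end

section \<open>Comparison of the least constants and conclusion\<close>

lemma least_constant_le: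
  assumes A: "0 < A" and imp: "\<And>C. 0 < C \<Longrightarrow> P C \<Longrightarrow> P' (A * C)"
    and mono: "\<And>C C'. C \<le> C' \<Longrightarrow> P C \<Longrightarrow> P C'"
  shows "least_constant P' \<le> ennreal A * least_constant P"
proof -
  have "least_constant P' \<le> ennreal A * ennreal C" if C: "0 \<le> C" "P C" for C
  proof (rule ennreal_le_epsilon)
    fix e :: real assume e: "0 < e"
    \<comment> \<open>The implication is available only for positive constants, so an admissible C,
      possibly zero, is enlarged at a cost of e after multiplication by A.\<close>
    define C' where "C' = C + e / A"
    have C': "0 < C'" "C \<le> C'" using C e A by (auto simp: C'_def add_nonneg_pos)
    have "P' (A * C')" using C' by (intro imp mono[OF _ C(2)]) auto
    then have "least_constant P' \<le> ennreal (A * C')"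
      unfolding least_constant_def using A C' by (intro INF_lower) auto
    also have "A * C' = A * C + e" using A by (simp add: C'_def distrib_left)
    finally show "least_constant P' \<le> ennreal A * ennreal C + ennreal e"
      using A C e by (simp add: ennreal_mult)
  qed
  \<comment> \<open>Division by A turns the claim into a lower bound for an infimum, which also
    covers the case without admissible constants.\<close>
  then have "least_constant P' / ennreal A \<le> least_constant P"
    unfolding least_constant_def[of P] using A
    by (intro INF_greatest) (auto simp: divide_le_posI_ennreal)
  then have "ennreal A * (least_constant P' / ennreal A) \<le> ennreal A * least_constant P"
    by (rule mult_left_mono) simp
  then show ?thesis
    using A by (simp add: ennreal_times_divide mult.commute[of _ "least_constant P'"] mult_divide_eq_ennreal)
qed

lemma trace_inequality_mono:
  assumes "C \<le> C'" "trace_inequality p q K \<sigma> \<omega> C"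
  shows "trace_inequality p q K \<sigma> \<omega> C'"
  using assms(2) unfolding trace_inequality_def
  by (meson assms(1) ennreal_leI mult_right_mono order_trans zero_le)

lemma wolff_condition_mono:
  assumes "C \<le> C'" "wolff_condition p q r K \<sigma> \<omega> C"
  shows "wolff_condition p q r K \<sigma> \<omega> C'"
  using assms(2) ennreal_leI[OF assms(1)] unfolding wolff_condition_def by (auto intro: order_trans)

theorem theorem1p3:
  fixes p q r :: real
  assumes "1 < q" and "q < p" and "1 < r" and "1 / q = 1 / r + 1 / p"
  shows "\<exists>A B :: real. 0 < A \<and> 0 < B \<and>
    (\<forall>(\<sigma> :: (real ^ 'n) measure) (\<omega> :: (real ^ 'n) measure) (K :: (real ^ 'n) set \<Rightarrow> real).
       radon_measure \<sigma> \<longrightarrow> radon_measure \<omega> \<longrightarrow> (\<forall>Q \<in> dyadic_cubes. 0 \<le> K Q) \<longrightarrow>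
       ((\<exists>C\<^sub>1 \<ge> 0. trace_inequality p q K \<sigma> \<omega> C\<^sub>1) \<longleftrightarrow>
        (\<exists>C\<^sub>2 \<ge> 0. wolff_condition p q r K \<sigma> \<omega> C\<^sub>2)) \<and>
       least_constant (trace_inequality p q K \<sigma> \<omega>)
         \<le> ennreal A * least_constant (wolff_condition p q r K \<sigma> \<omega>) \<and>
       least_constant (wolff_condition p q r K \<sigma> \<omega>)
         \<le> ennreal B * least_constant (trace_inequality p q K \<sigma> \<omega>))"
proof -
  define p' q' where "p' = dual_exponent p" "q' = dual_exponent q"
  note swap_exps = dual_exponents_swap[OF assms(1,2,4), folded p'_q'_def]
  have p'': "dual_exponent p' = p" using assms by (simp add: p'_q'_def dual_exponent_dual_exponent)
  have pos: "0 < doob_const (p / q) * (1 + doob_const q)" "0 < doob_const (q' / p') * (1 + doob_const p')"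
    using assms swap_exps by (auto intro!: mult_pos_pos add_pos_pos doob_const_pos)
  \<comment> \<open>Test scalings for the two Wolff conditions, the second for the exchanged
    exponents.\<close>
  obtain \<alpha> \<beta> where \<alpha>\<beta>: "0 < \<alpha>" "0 < \<beta>"
    "\<alpha> powr p * (doob_const (p / q) * (1 + doob_const q)) + \<beta> powr dual_exponent q \<le> \<alpha> * \<beta> / 2"
    using exists_test_scaling[OF assms(1,2) pos(1)] by blast
  obtain \<alpha>' \<beta>' where \<alpha>\<beta>': "0 < \<alpha>'" "0 < \<beta>'"
    "\<alpha>' powr q' * (doob_const (q' / p') * (1 + doob_const p')) + \<beta>' powr p \<le> \<alpha>' * \<beta>' / 2"
    using exists_test_scaling[OF swap_exps(1,2) pos(2)] by (auto simp: p'')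
  define N where "N = max ((1 + doob_const q) * (2 / (\<alpha> * \<beta>))) ((1 + doob_const p') * (2 / (\<alpha>' * \<beta>')))"
  have "0 < (1 + doob_const q) * (2 / (\<alpha> * \<beta>))"
    using \<alpha>\<beta>(1,2) doob_const_pos[OF assms(1)] by (intro mult_pos_pos) auto
  then have N: "0 < N" by (simp add: N_def less_max_iff_disj)
  \<comment> \<open>A and B are built from the exponents alone and fixed before the measures and
    K.\<close>
  define A where "A = (3 * (2 * form_const p q) powr q) powr (1 / q)"
  define B where "B = N powr (1 / r)"
  have AB: "0 < A" "0 < B"
    using form_const_pos[of q p] assms N by (auto simp: A_def B_def)
  have main: "((\<exists>C\<^sub>1 \<ge> 0. trace_inequality p q K \<sigma> \<omega> C\<^sub>1) \<longleftrightarrow>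
        (\<exists>C\<^sub>2 \<ge> 0. wolff_condition p q r K \<sigma> \<omega> C\<^sub>2)) \<and>
       least_constant (trace_inequality p q K \<sigma> \<omega>)
         \<le> ennreal A * least_constant (wolff_condition p q r K \<sigma> \<omega>) \<and>
       least_constant (wolff_condition p q r K \<sigma> \<omega>)
         \<le> ennreal B * least_constant (trace_inequality p q K \<sigma> \<omega>)"
    if "radon_measure \<sigma>" "radon_measure \<omega>" "\<forall>Q \<in> dyadic_cubes. 0 \<le> K Q"
    for \<sigma> \<omega> :: "(real ^ 'n) measure" and K :: "(real ^ 'n) set \<Rightarrow> real"
  proof -
    interpret dyadic_weights \<sigma> \<omega> K by unfold_locales (use that in auto)
    have r: "0 < r" using assms by simp
    have suff: "trace_inequality p q K \<sigma> \<omega> (A * C)"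
      if "0 < C" "wolff_condition p q r K \<sigma> \<omega> C" for C
      unfolding A_def by (rule trace_of_wolff[OF assms(1,2) r assms(4) that])
    have nec: "wolff_condition p q r K \<sigma> \<omega> (B * C)"
      if "0 < C" "trace_inequality p q K \<sigma> \<omega> C" for C
      unfolding B_def
      by (rule wolff_of_trace[OF assms(1,2) r assms(4) that \<alpha>\<beta> \<alpha>\<beta>'[unfolded p'_q'_def]])
         (auto simp: N_def p'_q'_def)
    show ?thesis
    proof (intro conjI iffI)
      assume "\<exists>C\<ge>0. trace_inequality p q K \<sigma> \<omega> C"
      then obtain C where "0 \<le> C" "trace_inequality p q K \<sigma> \<omega> C" by blast
      \<comment> \<open>\<open>nec\<close> needs a positive constant, hence C + 1.\<close>
      then have "wolff_condition p q r K \<sigma> \<omega> (B * (C + 1))"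
        by (intro nec trace_inequality_mono[of C "C + 1"]) auto
      then show "\<exists>C\<ge>0. wolff_condition p q r K \<sigma> \<omega> C"
        using AB \<open>0 \<le> C\<close> by (intro exI[of _ "B * (C + 1)"]) auto
    next
      assume "\<exists>C\<ge>0. wolff_condition p q r K \<sigma> \<omega> C"
      then obtain C where "0 \<le> C" "wolff_condition p q r K \<sigma> \<omega> C" by blast
      then have "trace_inequality p q K \<sigma> \<omega> (A * (C + 1))"
        by (intro suff wolff_condition_mono[of C "C + 1"]) auto
      then show "\<exists>C\<ge>0. trace_inequality p q K \<sigma> \<omega> C"
        using AB \<open>0 \<le> C\<close> by (intro exI[of _ "A * (C + 1)"]) auto
    next
      show "least_constant (trace_inequality p q K \<sigma> \<omega>)
          \<le> ennreal A * least_constant (wolff_condition p q r K \<sigma> \<omega>)"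
        using AB(1) suff wolff_condition_mono by (rule least_constant_le)
      show "least_constant (wolff_condition p q r K \<sigma> \<omega>)
          \<le> ennreal B * least_constant (trace_inequality p q K \<sigma> \<omega>)"
        using AB(2) nec trace_inequality_mono by (rule least_constant_le)
    qed
  qed
  show ?thesis
    using AB main by (intro exI[of _ A] exI[of _ B]) simp
qed

end
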